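(* Let $U:\mathbb{R}^n\to\mathbb{R}$ be of class $C^2$, let $\Omega\subset\mathbb{R}^n$ be a connected component of $\{x\in\mathbb{R}^n:U(x)>0\}$, and assume that $\partial\Omega$ is compact and is the union of $N$ distinct nonempty connected components $\Gamma_1,\ldots,\Gamma_N$. Assume: (a) $N\geq 2$ and, if $\Omega$ is unbounded, there are $r_0>0$ and a non-negative function $\sigma:[r_0,+\infty)\to\mathbb{R}$ such that $\int_{r_0}^{+\infty}\sigma(r)\,dr=+\infty$ and $\sqrt{U(x)}\geq\sigma(|x|)$ for all $x\in\Omega$ with $|x|\geq r_0$; (b) the set $P$ of critical points of $U$ contained in $\partial\Omega$ is finite (possibly empty), each component $\Gamma_j$ consisting of a single point has the form $\{p\}$ with $p\in P$, and whenever $\Gamma\in\{\Gamma_1,\ldots,\Gamma_N\}$ has positive diameter, every $p\in P\cap\Gamma$ is a hyperbolic critical point of $U$. Then for each $\Gamma_-\in\{\Gamma_1,\ldots,\Gamma_N\}$ there exist $\Gamma_+\in\{\Gamma_1,\ldots,\Gamma_N\}\setminus\{\Gamma_-\}$ and a map $u^*:(T_-,T_+)\to\Omega$, with $-\infty\leq T_-<T_+\leq+\infty$, such that $$\ddot u^*=\nabla U(u^* ),\qquad \tfrac12|\dot u^*|^2-U(u^* )=0\qquad\text{on }(T_-,T_+),$$ and $$\lim_{t\to T_-}d(u^*(t),\Gamma_-)=0,\qquad \lim_{t\to T_+}d(u^*(t),\Gamma_+)=0.$$ Moreover, $T_->-\infty$ if and only if $\Gamma_-$ has positive diameter, and $T_+<+\infty$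 if and only if $\Gamma_+$ has positive diameter. If $T_->-\infty$, then $\lim_{t\to T_-}u^*(t)=x_-$ for some $x_-\in\Gamma_-\setminus P$ and $\lim_{t\to T_-}\dot u^*(t)=0$. If $T_+<+\infty$, then $\lim_{t\to T_+}u^*(t)=x_+$ for some $x_+\in\Gamma_+\setminus P$ and $\lim_{t\to T_+}\dot u^*(t)=0$.
   Context: $d$ denotes Euclidean distance. A critical point $p$ of $U$ is hyperbolic if the Hessian of $U$ at $p$ is nonsingular. *)

theory Defs
  imports "HOL-Analysis.Analysis"
begin

text \<open>Since \<^const>\<open>frechet_derivative\<close> is an unspecified value at points of
  non-differentiability, \<open>grad\<close> and \<open>hessian\<close> are meaningful only where the derivative exists;
  \<open>C2\<close> below includes the corresponding differentiability requirements.\<close>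

definition grad :: "(real^'n \<Rightarrow> real) \<Rightarrow> real^'n \<Rightarrow> real^'n" where
  "grad U x = (\<chi> i. frechet_derivative U (at x) (axis i 1))"

definition hessian :: "(real^'n \<Rightarrow> real) \<Rightarrow> real^'n \<Rightarrow> real^'n^'n" where
  "hessian U x = matrix (frechet_derivative (grad U) (at x))"

definition C2 :: "(real^'n \<Rightarrow> real) \<Rightarrow> bool" where
  "C2 U \<longleftrightarrow> U differentiable_on UNIV \<and> grad U differentiable_on UNIV \<and>
     continuous_on UNIV (hessian U)"

definition critical_point :: "(real^'n \<Rightarrow> real) \<Rightarrow> real^'n \<Rightarrow> bool" where
  "critical_point U p \<longleftrightarrow> grad U p = 0"

definition hyperbolic_critical_point :: "(real^'n \<Rightarrow> real) \<Rightarrow> real^'n \<Rightarrow> bool" where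
  "hyperbolic_critical_point U p \<longleftrightarrow> critical_point U p \<and> invertible (hessian U p)"

lemma gderiv_grad:
  fixes U :: "real^'n \<Rightarrow> real"
  assumes "U differentiable (at x)"
  shows "GDERIV U x :> grad U x"
proof -
  have D: "(U has_derivative frechet_derivative U (at x)) (at x)"
    using assms frechet_derivative_works by blast
  then interpret linear "frechet_derivative U (at x)"
    by (rule has_derivative_linear)
  have "frechet_derivative U (at x) h = inner h (grad U x)" for h
  proof -
    have "frechet_derivative U (at x) h = frechet_derivative U (at x) (\<Sum>i\<in>UNIV. (h $ i) *\<^sub>R axis i 1)"
      using basis_expansion[of h] by (simp add: scalar_mult_eq_scaleR)
    then show ?thesis
      by (simp add: sum scaleR inner_vec_def grad_def)
  qed
  then have "frechet_derivative U (at x) = (\<lambda>h. inner h (grad U x))"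
    by blast
  with D show ?thesis
    by (simp add: gderiv_def)
qed

text \<open>For a non-negative \<open>\<sigma>\<close>, this says that the improper integral of \<open>\<sigma>\<close> over
  \<open>[r0, \<infinity>)\<close> is \<open>+\<infinity>\<close>. Integrability on bounded intervals is part of that notion: the divergence
  has to come from infinity and not from a local singularity of \<open>\<sigma>\<close>.\<close>

definition improper_integral_infinite :: "real \<Rightarrow> (real \<Rightarrow> real) \<Rightarrow> bool" where
  "improper_integral_infinite r0 \<sigma> \<longleftrightarrow>
     (\<forall>R\<ge>r0. \<sigma> integrable_on {r0..R}) \<and>
     filterlim (\<lambda>R. integral {r0..R} \<sigma>) at_top at_top"

text \<open>One-sided limits of a function of a real variable at a possibly infinite endpoint of an
  open interval, as in the library's \<open>interval_integral_FTC_integrable\<close>.\<close>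

definition tends_at_lower :: "(real \<Rightarrow> 'a::topological_space) \<Rightarrow> 'a \<Rightarrow> ereal \<Rightarrow> bool" where
  "tends_at_lower f l a \<longleftrightarrow> ((f \<circ> real_of_ereal) \<longlongrightarrow> l) (at_right a)"

definition tends_at_upper :: "(real \<Rightarrow> 'a::topological_space) \<Rightarrow> 'a \<Rightarrow> ereal \<Rightarrow> bool" where
  "tends_at_upper f l b \<longleftrightarrow> ((f \<circ> real_of_ereal) \<longlongrightarrow> l) (at_left b)"

end

theory Submission
  imports Defs "HOL-Complex_Analysis.Great_Picard"
begin

text \<open>Let \<open>A = \<Gamma>\<^sub>-\<close> and let \<open>B\<close> be the union of the other components of \<open>\<partial>\<Omega>\<close>. Minimise the action
  \<open>\<integral> |u'|\<^sup>2 / 2 + U(u)\<close>, with free travel time, over curves in \<open>\<Omega>\<close> that join the \<open>\<delta>\<close>-neighbourhoods of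
  \<open>A\<close> and \<open>B\<close>, and let \<open>\<delta> \<rightarrow> 0\<close>. Hypothesis (a) confines almost minimisers to a ball, and a bound on the
  kinetic energy makes them equi-Hoelder, so a subsequence converges locally uniformly to some \<open>u\<close>.
  Varying the almost minimisers themselves by hat functions and passing to the limit shows that second
  differences of \<open>u\<close> agree with those of a second primitive of \<open>\<nabla>U(u)\<close>; hence \<open>u\<close> is of class \<open>C\<^sup>2\<close>
  and solves the equation, with no semicontinuity or regularity theory. Free travel time forces zero energy.

  At an end reached in finite time the limit point is not critical, by a Gronwall argument, so its
  component is not a single point. At an infinite end \<open>u\<close> converges to a critical point; if its component
  had positive diameter, the Hessian there would be nonsingular and not positive definite, and a
  wide hat in a negative direction would decrease the action to second order. Finally, \<open>u\<close> cannot come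
  from \<open>B\<close>, since almost minimisers could then be shortened by a definite amount.\<close>

section \<open>Curves of finite energy and their action\<close>

text \<open>A minimiser would end on the frontier, where \<open>U\<close> vanishes, possibly after
  infinite time. All comparisons are therefore made for curves inside the open set \<Omega>, up to
  an error that tends to 0.

  Hats are used because they are affine on each half of their window: adding an affine function to a
  curve changes its budget by an explicit term. The unknown kinetic energy of an almost minimiser
  then cancels in the comparison, and only point values and integrals of \<open>U\<close> remain,
  which pass to the limit. The same formula serves the first and the second variation.

  \<open>B\<close> lumps all targets together, so which component is reached is decided by the
  forward limit. The limit curve lives on the whole line and may touch the frontier; only its
  maximal interval around time 0 inside \<Omega> becomes the orbit. The past end is handled by
  reversing time, and for this reason minimality near a saddle is cast as a statement about time
  windows, which does not see the direction of time.

  A nonsingular Hessian cannot be positive definite on a component of positive diameter, because the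
  critical point would then be an isolated zero of \<open>U\<close>.\<close>

text \<open>\<open>e\<close> plays the role of a primitive of \<open>|u'|\<^sup>2\<close>: \<open>energy_budget u e a b\<close> says that \<open>u\<close> lies in
  \<open>H\<^sup>1\<close> with \<open>\<integral> |u'|\<^sup>2 \<le> e t - e s\<close> on every \<open>[s, t] \<subseteq> [a, b]\<close>, without mentioning weak derivatives.\<close>

definition energy_budget :: "(real \<Rightarrow> 'a::euclidean_space) \<Rightarrow> (real \<Rightarrow> real) \<Rightarrow> real \<Rightarrow> real \<Rightarrow> bool" where
  "energy_budget u e a b \<longleftrightarrow>
     (\<forall>x y. a \<le> x \<longrightarrow> x \<le> y \<longrightarrow> y \<le> b \<longrightarrow> (norm (u y - u x))\<^sup>2 \<le> (y - x) * (e y - e x))"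

section \<open>Budgets: monotonicity, Hoelder bounds, gluing and affine changes\<close>

lemma energy_budgetD:
  "energy_budget u e a b \<Longrightarrow> a \<le> x \<Longrightarrow> x \<le> y \<Longrightarrow> y \<le> b \<Longrightarrow> (norm (u y - u x))\<^sup>2 \<le> (y - x) * (e y - e x)"
  by (simp add: energy_budget_def)

lemma energy_budget_subset:
  "energy_budget u e a b \<Longrightarrow> a \<le> s \<Longrightarrow> t \<le> b \<Longrightarrow> energy_budget u e s t"
  by (simp add: energy_budget_def)

lemma energy_budget_mono:
  assumes "energy_budget u e a b" "a \<le> x" "x \<le> y" "y \<le> b"
  shows "e x \<le> e y"
proof (cases "x = y")
  case False
  have "0 \<le> (norm (u y - u x))\<^sup>2" by simp
  also have "\<dots> \<le> (y - x) * (e y - e x)" using assms by (rule energy_budgetD)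
  finally show ?thesis using False assms(3) by (simp add: zero_le_mult_iff)
qed auto

lemma energy_budget_holder:
  assumes "energy_budget u e a b" "x \<in> {a..b}" "y \<in> {a..b}"
  shows "(norm (u y - u x))\<^sup>2 \<le> \<bar>y - x\<bar> * (e b - e a)"
proof -
  have *: "(norm (u y - u x))\<^sup>2 \<le> (y - x) * (e b - e a)" if "a \<le> x" "x \<le> y" "y \<le> b" for x y
  proof -
    have "(norm (u y - u x))\<^sup>2 \<le> (y - x) * (e y - e x)" using assms(1) that by (rule energy_budgetD)
    also have "\<dots> \<le> (y - x) * (e b - e a)"
      using energy_budget_mono[OF assms(1), of a x] energy_budget_mono[OF assms(1), of y b] that
      by (intro mult_left_mono) auto
    finally show ?thesis .
  qed
  show ?thesis
  proof (cases "x \<le> y")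
    case True then show ?thesis using *[of x y] assms by auto
  next
    case False then show ?thesis using *[of y x] assms by (auto simp: norm_minus_commute)
  qed
qed

lemma energy_budget_global_holder:
  assumes "\<And>s t. energy_budget u e s t" "\<And>s t. e t - e s \<le> M"
  shows "(norm (u t - u s))\<^sup>2 \<le> \<bar>t - s\<bar> * M"
proof -
  have "(norm (u t - u s))\<^sup>2 \<le> \<bar>t - s\<bar> * (e (max s t) - e (min s t))"
    by (rule energy_budget_holder[OF assms(1)]) auto
  also have "\<dots> \<le> \<bar>t - s\<bar> * M" by (intro mult_left_mono assms) auto
  finally show ?thesis .
qed

text \<open>Turns the squared Hoelder bound into an explicit modulus of continuity. The denominator
  \<open>M + 1\<close> covers the case \<open>M = 0\<close>.\<close>

lemma half_holder_less:
  fixes d M \<epsilon> h :: real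
  assumes "d\<^sup>2 \<le> h * M" "0 \<le> M" "0 < \<epsilon>" "0 \<le> h" "h < \<epsilon>\<^sup>2 / (M + 1)"
  shows "d < \<epsilon>"
proof -
  have "h * M \<le> h * (M + 1)" using assms by (intro mult_left_mono) auto
  also have "\<dots> < \<epsilon>\<^sup>2" using assms by (simp add: field_simps)
  finally have "d\<^sup>2 < \<epsilon>\<^sup>2" using assms by simp
  then show ?thesis using assms(3) by (simp add: power2_less_imp_less)
qed

lemma half_holder_continuous_on:
  fixes u :: "real \<Rightarrow> 'a::real_normed_vector"
  assumes "\<And>x y. x \<in> S \<Longrightarrow> y \<in> S \<Longrightarrow> (norm (u y - u x))\<^sup>2 \<le> \<bar>y - x\<bar> * M" and "0 \<le> M"
  shows "continuous_on S u"
  unfolding continuous_on_iff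
proof (intro ballI allI impI)
  fix x \<epsilon> :: real assume x: "x \<in> S" "0 < \<epsilon>"
  show "\<exists>d>0. \<forall>x'\<in>S. dist x' x < d \<longrightarrow> dist (u x') (u x) < \<epsilon>"
  proof (intro exI[of _ "\<epsilon>\<^sup>2 / (M + 1)"] conjI ballI impI)
    show "0 < \<epsilon>\<^sup>2 / (M + 1)" using assms(2) x by (simp add: divide_pos_pos add_nonneg_pos)
    fix y assume "y \<in> S" "dist y x < \<epsilon>\<^sup>2 / (M + 1)"
    then show "dist (u y) (u x) < \<epsilon>"
      using half_holder_less[OF assms(1)[OF x(1) \<open>y \<in> S\<close>] assms(2) x(2)]
      by (simp add: dist_norm)
  qed
qed

lemma energy_budget_continuous:
  assumes "energy_budget u e a b"
  shows "continuous_on {a..b} u"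
proof (cases "a \<le> b")
  case True
  then show ?thesis
    using energy_budget_holder[OF assms] energy_budget_mono[OF assms, of a b]
    by (intro half_holder_continuous_on[where M = "e b - e a"]) auto
qed auto

text \<open>Cauchy-Schwarz in the plane for the vectors whose entries are the roots of
  \<open>p\<close>, \<open>q\<close> and of \<open>c\<close>, \<open>d\<close>, squared so that no
  root appears. It is what lets budgets be concatenated.\<close>

lemma square_add_le:
  fixes A B p q c d :: real
  assumes "A\<^sup>2 \<le> p * c" "B\<^sup>2 \<le> q * d" "0 \<le> p" "0 \<le> q" "0 \<le> c" "0 \<le> d"
  shows "(A + B)\<^sup>2 \<le> (p + q) * (c + d)"
proof -
  have "(A * B)\<^sup>2 \<le> (p * c) * (q * d)"
    unfolding power_mult_distrib using assms by (intro mult_mono) auto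
  also have "\<dots> \<le> ((p * d + q * c) / 2)\<^sup>2"
    using zero_le_power2[of "p * d - q * c"] by (simp add: power2_eq_square algebra_simps)
  finally have "A * B \<le> (p * d + q * c) / 2"
    by (rule power2_le_imp_le) (use assms in auto)
  then show ?thesis using assms(1,2) by (simp add: power2_eq_square algebra_simps)
qed

text \<open>Only pairs straddling \<open>b\<close> need an argument: the triangle inequality splits
  the increment at \<open>b\<close>, and \<open>square_add_le\<close> recombines the two
  bounds.\<close>

lemma energy_budget_glue:
  assumes 1: "energy_budget u e a b" and 2: "energy_budget u' e' b c" and eq: "u b = u' b" "e b = e' b"
    and "a \<le> b" "b \<le> c"
  shows "energy_budget (\<lambda>t. if t \<le> b then u t else u' t) (\<lambda>t. if t \<le> b then e t else e' t) a c"
  unfolding energy_budget_def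
proof (intro allI impI)
  fix x y assume xy: "a \<le> x" "x \<le> y" "y \<le> c"
  consider "y \<le> b" | "b < x" | "x \<le> b" "b < y" by linarith
  then show "(norm ((if y \<le> b then u y else u' y) - (if x \<le> b then u x else u' x)))\<^sup>2
      \<le> (y - x) * ((if y \<le> b then e y else e' y) - (if x \<le> b then e x else e' x))"
  proof cases
    case 1 then show ?thesis using xy energy_budgetD[OF assms(1), of x y] by auto
  next
    case 2 then show ?thesis using xy energy_budgetD[OF assms(2), of x y] by auto
  next
    case 3
    have "(norm (u' y - u x))\<^sup>2 \<le> (norm (u' y - u' b) + norm (u b - u x))\<^sup>2"
      using norm_triangle_ineq[of "u' y - u' b" "u b - u x"] eq by (intro power_mono) auto
    also have "\<dots> \<le> ((y - b) + (b - x)) * ((e' y - e' b) + (e b - e x))"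
      using energy_budgetD[OF 1, of x b] energy_budgetD[OF 2, of b y] xy 3
        energy_budget_mono[OF 1, of x b] energy_budget_mono[OF 2, of b y]
      by (intro square_add_le) auto
    also have "\<dots> = (y - x) * (e' y - e x)" using eq by simp
    finally show ?thesis using 3 by simp
  qed
qed

lemma energy_budget_shift:
  "energy_budget u e a b \<Longrightarrow> energy_budget (\<lambda>t. u (t + c)) (\<lambda>t. e (t + c) + k) (a - c) (b - c)"
  unfolding energy_budget_def
proof (intro allI impI)
  fix x y assume a: "\<forall>x y. a \<le> x \<longrightarrow> x \<le> y \<longrightarrow> y \<le> b \<longrightarrow> (norm (u y - u x))\<^sup>2 \<le> (y - x) * (e y - e x)"
    and xy: "a - c \<le> x" "x \<le> y" "y \<le> b - c"
  show "(norm (u (y + c) - u (x + c)))\<^sup>2 \<le> (y - x) * (e (y + c) + k - (e (x + c) + k))"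
    using a[rule_format, of "x + c" "y + c"] xy by simp
qed

lemma norm_add_scaleR_square:
  "(norm (p + k *\<^sub>R m))\<^sup>2 = (norm p)\<^sup>2 + k * (2 * inner m p + (norm m)\<^sup>2 * k)"
proof -
  have "(norm (p + k *\<^sub>R m))\<^sup>2 = inner p p + k * inner p m + (k * inner m p + k * (k * inner m m))"
    by (simp add: power2_norm_eq_inner inner_add_left inner_add_right distrib_left)
  then show ?thesis by (simp add: power2_norm_eq_inner inner_commute[of p m] algebra_simps)
qed

text \<open>Adding \<open>m\<close> to the velocity and expanding the square gives the old budget
  plus an explicit primitive. The change is exact and not just an estimate, which is why all
  variations are piecewise affine.\<close>

lemma energy_budget_affine:
  assumes "energy_budget u e a b"
  shows "energy_budget (\<lambda>t. u t + t *\<^sub>R m + z) (\<lambda>t. e t + 2 * inner m (u t) + (norm m)\<^sup>2 * t) a b"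
  unfolding energy_budget_def
proof (intro allI impI)
  fix x y assume xy: "a \<le> x" "x \<le> y" "y \<le> b"
  have "(norm (u y + y *\<^sub>R m + z - (u x + x *\<^sub>R m + z)))\<^sup>2 = (norm ((u y - u x) + (y - x) *\<^sub>R m))\<^sup>2"
    by (simp add: algebra_simps)
  also have "\<dots> = (norm (u y - u x))\<^sup>2 + (y - x) * (2 * inner m (u y - u x) + (norm m)\<^sup>2 * (y - x))"
    by (rule norm_add_scaleR_square)
  also have "\<dots> \<le> (y - x) * (e y - e x) + (y - x) * (2 * inner m (u y - u x) + (norm m)\<^sup>2 * (y - x))"
    using energy_budgetD[OF assms xy] by simp
  also have "\<dots> = (y - x) * (e y + 2 * inner m (u y) + (norm m)\<^sup>2 * y - (e x + 2 * inner m (u x) + (norm m)\<^sup>2 * x))"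
    by (simp add: algebra_simps inner_diff_right)
  finally show "(norm (u y + y *\<^sub>R m + z - (u x + x *\<^sub>R m + z)))\<^sup>2
       \<le> (y - x) * (e y + 2 * inner m (u y) + (norm m)\<^sup>2 * y - (e x + 2 * inner m (u x) + (norm m)\<^sup>2 * x))" .
qed

section \<open>The action, and joining points at a given cost\<close>

locale potential =
  fixes U :: "'a::euclidean_space \<Rightarrow> real" and \<Omega> :: "'a set"
  assumes open_Omega: "open \<Omega>" and cont_U: "continuous_on UNIV U"
    and U_pos: "x \<in> \<Omega> \<Longrightarrow> 0 < U x"
begin

definition act :: "(real \<Rightarrow> 'a) \<Rightarrow> (real \<Rightarrow> real) \<Rightarrow> real \<Rightarrow> real \<Rightarrow> real" where
  "act u e s t = (e t - e s) / 2 + integral {s..t} (\<lambda>\<tau>. U (u \<tau>))"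

definition curve :: "(real \<Rightarrow> 'a) \<Rightarrow> (real \<Rightarrow> real) \<Rightarrow> real \<Rightarrow> real \<Rightarrow> bool" where
  "curve u e a b \<longleftrightarrow> energy_budget u e a b \<and> u ` {a..b} \<subseteq> \<Omega>"

text \<open>The time interval is bound existentially, so travel time is free, and \<open>c\<close>
  is an upper bound, so no infimum has to be attained. The interval must have positive
  length.\<close>

definition joined :: "'a \<Rightarrow> 'a \<Rightarrow> real \<Rightarrow> bool" where
  "joined x y c \<longleftrightarrow> (\<exists>u e a b. a < b \<and> curve u e a b \<and> u a = x \<and> u b = y \<and> act u e a b \<le> c)"

lemma U_comp_cont: "continuous_on S u \<Longrightarrow> continuous_on S (\<lambda>t. U (u t))"
  using continuous_on_compose2[OF cont_U] by auto

lemma U_comp_int: "continuous_on {a..b} u \<Longrightarrow> (\<lambda>t. U (u t)) integrable_on {a..b::real}"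
  by (intro integrable_continuous_interval U_comp_cont)

lemma curve_subset: "curve u e a b \<Longrightarrow> a \<le> s \<Longrightarrow> t \<le> b \<Longrightarrow> curve u e s t"
  unfolding curve_def image_subset_iff using energy_budget_subset[of u e a b s t] by auto

lemma curve_cont: "curve u e a b \<Longrightarrow> continuous_on {a..b} u"
  by (auto simp: curve_def intro: energy_budget_continuous)

lemma curve_in: "curve u e a b \<Longrightarrow> t \<in> {a..b} \<Longrightarrow> u t \<in> \<Omega>"
  by (auto simp: curve_def)

lemma curve_int_nonneg: "curve u e a b \<Longrightarrow> 0 \<le> integral {a..b} (\<lambda>t. U (u t))"
  using curve_in U_pos by (intro integral_nonneg U_comp_int curve_cont) (auto intro: less_imp_le)

lemma act_ge_integral: "curve u e a b \<Longrightarrow> a \<le> b \<Longrightarrow> integral {a..b} (\<lambda>t. U (u t)) \<le> act u e a b"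
  using energy_budget_mono[of u e a b a b] by (auto simp: act_def curve_def)

lemma act_ge_budget: "curve u e a b \<Longrightarrow> (e b - e a) / 2 \<le> act u e a b"
  using curve_int_nonneg[of u e a b] by (auto simp: act_def)

lemma act_nonneg: "curve u e a b \<Longrightarrow> a \<le> b \<Longrightarrow> 0 \<le> act u e a b"
  using order_trans[OF curve_int_nonneg act_ge_integral] .

lemma act_combine:
  assumes "curve u e a c" "a \<le> b" "b \<le> c"
  shows "act u e a b + act u e b c = act u e a c"
  using Henstock_Kurzweil_Integration.integral_combine[OF assms(2,3) U_comp_int[OF curve_cont[OF assms(1)]]]
  unfolding act_def by argo

lemma act_mono_subset:
  assumes "curve u e a b" "a \<le> s" "s \<le> t" "t \<le> b"
  shows "act u e s t \<le> act u e a b"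
proof -
  have "act u e a b = act u e a s + act u e s t + act u e t b"
    using act_combine[OF assms(1), of t] act_combine[OF curve_subset[OF assms(1), of a t], of s] assms by auto
  then show ?thesis
    using act_nonneg[OF curve_subset[OF assms(1), of a s]] act_nonneg[OF curve_subset[OF assms(1), of t b]] assms
    by auto
qed

lemma joined_nonneg: "joined x y c \<Longrightarrow> 0 \<le> c"
  unfolding joined_def by (meson act_nonneg less_imp_le order_trans)

lemma joined_curve: "curve u e a b \<Longrightarrow> a < b \<Longrightarrow> joined (u a) (u b) (act u e a b)"
  unfolding joined_def by blast

lemma joined_mono: "joined x y c \<Longrightarrow> c \<le> c' \<Longrightarrow> joined x y c'"
  unfolding joined_def by (elim exE conjE, intro exI conjI, assumption+, rule order_trans)

lemma joined_trans:
  assumes "joined x y c" "joined y z c'"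
  shows "joined x z (c + c')"
proof -
  obtain u e a b where 1: "a < b" "curve u e a b" "u a = x" "u b = y" "act u e a b \<le> c"
    using assms(1) unfolding joined_def by blast
  obtain u' e' a' b' where 2: "a' < b'" "curve u' e' a' b'" "u' a' = y" "u' b' = z" "act u' e' a' b' \<le> c'"
    using assms(2) unfolding joined_def by blast
  define k where "k = a' - b"
  define v where "v t = u' (t + k)" for t
  \<comment> \<open>The added constant makes the second budget continue the first one at
    \<open>b\<close>; the action sees only differences of the budget.\<close>
  define f where "f t = e' (t + k) + (e b - e' a')" for t
  define d where "d = b' - k"
  define w where "w t = (if t \<le> b then u t else v t)" for t
  define g where "g t = (if t \<le> b then e t else f t)" for t
  have bd: "b < d" using 2 by (simp add: d_def k_def)
  have vb: "v b = u b" "f b = e b" using 1 2 by (auto simp: v_def f_def k_def)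
  have "energy_budget v f (a' - k) (b' - k)"
    unfolding v_def f_def using 2 by (intro energy_budget_shift) (simp add: curve_def)
  then have ev: "energy_budget v f b d" by (simp add: k_def d_def)
  have ew: "energy_budget w g a d"
    unfolding w_def g_def using 1 2 ev vb bd by (intro energy_budget_glue) (auto simp: curve_def)
  have "w ` {a..d} \<subseteq> \<Omega>"
    using 1 2 by (auto simp: w_def v_def curve_def image_subset_iff d_def k_def)
  then have cw: "curve w g a d" using ew by (simp add: curve_def)
  have i1: "integral {a..b} (\<lambda>t. U (w t)) = integral {a..b} (\<lambda>t. U (u t))"
    by (intro integral_cong) (auto simp: w_def)
  have "integral {b..d} (\<lambda>t. U (w t)) = integral {b..d} ((\<lambda>t. U (u' t)) \<circ> (+) k)"
    using vb by (intro integral_cong) (auto simp: w_def v_def add.commute)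
  also have "\<dots> = integral {a'..b'} (\<lambda>t. U (u' t))"
    unfolding integral_shift_Icc_real by (simp add: k_def d_def)
  finally have i2: "integral {b..d} (\<lambda>t. U (w t)) = integral {a'..b'} (\<lambda>t. U (u' t))" .
  have gd: "g d = e' b' + e b - e' a'" "g b = e b" "g a = e a" using bd 1 by (auto simp: g_def f_def d_def)
  have "act w g a d = act w g a b + act w g b d"
    using act_combine[OF cw, of b] 1 bd by auto
  also have "\<dots> = act u e a b + act u' e' a' b'"
    unfolding act_def i1 i2 gd by simp
  finally have "act w g a d \<le> c + c'" using 1 2 by simp
  moreover have "w a = x" "w d = z" using 1 2 bd by (auto simp: w_def v_def d_def)
  moreover have "a < d" using 1 bd by simp
  ultimately show ?thesis unfolding joined_def using cw by blast
qed

text \<open>Motion along the segment at constant speed. The duration \<open>T\<close> stays free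
  because \<open>zero_energy\<close> compares all durations; elsewhere \<open>T = 1\<close> is
  enough.\<close>

lemma joined_line:
  assumes "closed_segment x y \<subseteq> \<Omega>" "0 < T" "\<And>z. z \<in> closed_segment x y \<Longrightarrow> U z \<le> M"
  shows "joined x y ((norm (y - x))\<^sup>2 / (2 * T) + T * M)"
proof -
  define m where "m = (1 / T) *\<^sub>R (y - x)"
  define u where "u t = x + t *\<^sub>R m" for t
  define e where "e t = (norm m)\<^sup>2 * t" for t
  have "energy_budget (\<lambda>t. 0 + t *\<^sub>R m + x) (\<lambda>t. 0 + 2 * inner m 0 + (norm m)\<^sup>2 * t) 0 T"
    by (rule energy_budget_affine) (simp add: energy_budget_def)
  then have eu: "energy_budget u e 0 T"
    by (simp add: u_def[abs_def] e_def[abs_def] add.commute)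
  have seg: "u t \<in> closed_segment x y" if "t \<in> {0..T}" for t
    unfolding closed_segment_def u_def m_def using assms(2) that
    by (auto intro!: exI[of _ "t / T"] simp: algebra_simps)
  have cu: "curve u e 0 T" using eu seg assms(1) by (auto simp: curve_def)
  have "integral {0..T} (\<lambda>t. U (u t)) \<le> integral {0..T} (\<lambda>t. M)"
    using assms seg by (intro integral_le U_comp_int curve_cont[OF cu]) auto
  then have "integral {0..T} (\<lambda>t. U (u t)) \<le> T * M" using assms by simp
  moreover have "e T - e 0 = (norm (y - x))\<^sup>2 / T"
    using assms by (simp add: e_def m_def power_mult_distrib power2_eq_square)
  ultimately have "act u e 0 T \<le> (norm (y - x))\<^sup>2 / (2 * T) + T * M" by (simp add: act_def)
  moreover have "u 0 = x" "u T = y" using assms by (auto simp: u_def m_def)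
  ultimately show ?thesis unfolding joined_def using cu assms(2) by blast
qed

text \<open>A tent of height 1 and half-width \<open>L\<close>, not cut off at 0; it is used only
  for \<open>t\<close> between \<open>c - L\<close> and \<open>c + L\<close>.\<close>

definition hat :: "real \<Rightarrow> real \<Rightarrow> real \<Rightarrow> real" where
  "hat c L t = 1 - \<bar>t - c\<bar> / L"

text \<open>On each half of the window the hat is affine, so \<open>energy_budget_affine\<close>
  applies there with slopes of opposite sign. The two explicit changes add up to a second difference
  of \<open>u\<close> and the kinetic energy of the hat itself.\<close>

lemma joined_hat:
  assumes cu: "curve u e (c - L) (c + L)" and L: "0 < L"
    and in\<Omega>: "\<And>t. t \<in> {c - L..c + L} \<Longrightarrow> u t + hat c L t *\<^sub>R w \<in> \<Omega>"
  shows "joined (u (c - L)) (u (c + L))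
    ((e (c + L) - e (c - L)) / 2 + inner w (2 *\<^sub>R u c - u (c - L) - u (c + L)) / L + (norm w)\<^sup>2 / L
      + integral {c - L..c + L} (\<lambda>t. U (u t + hat c L t *\<^sub>R w)))"
proof -
  define W where "W t = u t + hat c L t *\<^sub>R w" for t
  define m where "m = (1 / L) *\<^sub>R w"
  \<comment> \<open>The affine formulas of the rising and the falling half, taken as curves of their
    own; each agrees with \<open>W\<close> on its own half.\<close>
  define v1 where "v1 t = u t + t *\<^sub>R m + ((L - c) / L) *\<^sub>R w" for t
  define v2 where "v2 t = u t + t *\<^sub>R (- m) + ((L + c) / L) *\<^sub>R w" for t
  define e1 where "e1 t = e t + 2 * inner m (u t) + (norm m)\<^sup>2 * t" for t
  define e2 where "e2 t = e t + 2 * inner (- m) (u t) + (norm (- m))\<^sup>2 * t" for t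
  have v1: "v1 t = W t" if "t \<le> c" for t
  proof -
    have "hat c L t = t * (1 / L) + (L - c) / L"
      using that L by (simp add: hat_def field_simps)
    then show ?thesis by (simp add: v1_def W_def m_def scaleR_add_left)
  qed
  have v2: "v2 t = W t" if "c \<le> t" for t
  proof -
    have "hat c L t = - t * (1 / L) + (L + c) / L"
      using that L by (simp add: hat_def field_simps)
    then have "hat c L t *\<^sub>R w = (- t * (1 / L)) *\<^sub>R w + ((L + c) / L) *\<^sub>R w"
      by (metis scaleR_add_left)
    then show ?thesis by (simp add: v2_def W_def m_def)
  qed
  have b: "energy_budget u e (c - L) c" "energy_budget u e c (c + L)"
    using cu L by (auto simp: curve_def elim: energy_budget_subset)
  have "energy_budget v1 e1 (c - L) c" "energy_budget v2 e2 c (c + L)"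
    unfolding v1_def[abs_def] e1_def[abs_def] v2_def[abs_def] e2_def[abs_def]
    by (rule energy_budget_affine; rule b)+
  moreover have "v1 ` {c - L..c} \<subseteq> \<Omega>" "v2 ` {c..c + L} \<subseteq> \<Omega>"
    using in\<Omega> v1 v2 L by (auto simp: W_def[symmetric])
  ultimately have cv: "curve v1 e1 (c - L) c" "curve v2 e2 c (c + L)" by (simp_all add: curve_def)
  have "joined (v1 (c - L)) (v1 c) (act v1 e1 (c - L) c)" "joined (v2 c) (v2 (c + L)) (act v2 e2 c (c + L))"
    using cv L by (auto intro: joined_curve)
  moreover have "v1 c = v2 c" using v1[of c] v2[of c] by simp
  ultimately have j: "joined (v1 (c - L)) (v2 (c + L)) (act v1 e1 (c - L) c + act v2 e2 c (c + L))"
    using joined_trans by metis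
  have ends: "v1 (c - L) = u (c - L)" "v2 (c + L) = u (c + L)"
    using v1[of "c - L"] v2[of "c + L"] L by (auto simp: W_def hat_def)
  have "continuous_on {c - L..c + L} W"
    unfolding W_def[abs_def] hat_def[abs_def] using L by (intro continuous_intros curve_cont[OF cu]) auto
  then have "integral {c - L..c + L} (\<lambda>t. U (W t)) = integral {c - L..c} (\<lambda>t. U (W t)) + integral {c..c + L} (\<lambda>t. U (W t))"
    using Henstock_Kurzweil_Integration.integral_combine[OF _ _ U_comp_int, of "c - L" c "c + L" W] L by simp
  moreover have "integral {c - L..c} (\<lambda>t. U (v1 t)) = integral {c - L..c} (\<lambda>t. U (W t))"
    "integral {c..c + L} (\<lambda>t. U (v2 t)) = integral {c..c + L} (\<lambda>t. U (W t))"
    using v1 v2 by (auto intro!: integral_cong)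
  moreover have "(norm m)\<^sup>2 = (norm w)\<^sup>2 / L\<^sup>2" using L by (simp add: m_def power_divide)
  then have "e1 c - e1 (c - L) + (e2 (c + L) - e2 c)
     = e (c + L) - e (c - L) + 2 * inner w (2 *\<^sub>R u c - u (c - L) - u (c + L)) / L + 2 * (norm w)\<^sup>2 / L"
    using L by (simp add: e1_def e2_def m_def inner_diff_right inner_add_right field_simps power2_eq_square)
  ultimately have "act v1 e1 (c - L) c + act v2 e2 c (c + L) = ((e (c + L) - e (c - L)) / 2 + inner w (2 *\<^sub>R u c - u (c - L) - u (c + L)) / L + (norm w)\<^sup>2 / L
      + integral {c - L..c + L} (\<lambda>t. U (W t)))"
    unfolding act_def by (simp add: field_simps)
  with j ends show ?thesis by (simp add: W_def)
qed

text \<open>Young's inequality: the action dominates the length weighted with the square root of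
  \<open>U\<close>. The factor sqrt 2 that it would also yield is given away, since only the
  divergence of a radial integral will matter.\<close>

lemma act_lower:
  assumes cu: "curve u e s t" and "s \<le> t" and mu: "\<And>\<tau>. \<tau> \<in> {s..t} \<Longrightarrow> \<mu> \<le> sqrt (U (u \<tau>))"
  shows "\<mu> * norm (u t - u s) \<le> act u e s t"
proof (cases "s = t \<or> \<mu> \<le> 0")
  case True
  then have "\<mu> * norm (u t - u s) \<le> 0" by (auto simp: mult_nonpos_nonneg)
  then show ?thesis using act_nonneg[OF cu \<open>s \<le> t\<close>] by simp
next
  case False
  define T where "T = t - s"
  define D where "D = norm (u t - u s)"
  have T: "0 < T" and \<mu>: "0 < \<mu>" using False assms by (auto simp: T_def)
  have "\<mu>\<^sup>2 \<le> U (u \<tau>)" if "\<tau> \<in> {s..t}" for \<tau>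
    using mu[OF that] \<mu> U_pos[OF curve_in[OF cu that]]
    by (metis less_imp_le power_mono real_sqrt_pow2)
  then have "integral {s..t} (\<lambda>_. \<mu>\<^sup>2) \<le> integral {s..t} (\<lambda>\<tau>. U (u \<tau>))"
    by (intro integral_le U_comp_int curve_cont[OF cu]) auto
  then have 1: "T * \<mu>\<^sup>2 \<le> integral {s..t} (\<lambda>\<tau>. U (u \<tau>))" using T by (simp add: T_def)
  have "D\<^sup>2 \<le> T * (e t - e s)"
    using cu \<open>s \<le> t\<close> energy_budgetD[of u e s t s t] by (simp add: curve_def D_def T_def)
  then have 2: "D\<^sup>2 / T \<le> e t - e s" using T by (simp add: field_simps)
  have "0 \<le> (D - \<mu> * T)\<^sup>2 + (\<mu> * T)\<^sup>2" by simp
  then have "2 * \<mu> * D * T \<le> D\<^sup>2 + 2 * T * \<mu>\<^sup>2 * T" by (simp add: power2_eq_square algebra_simps)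
  then have "2 * (\<mu> * D) \<le> D\<^sup>2 / T + 2 * (T * \<mu>\<^sup>2)" using T by (simp add: field_simps)
  moreover have "\<And>a b c d f::real. 2 * a \<le> b + 2 * c \<Longrightarrow> c \<le> d \<Longrightarrow> b \<le> f \<Longrightarrow> a \<le> f / 2 + d"
    by linarith
  ultimately show ?thesis unfolding act_def D_def[symmetric] using 1 2 by blast
qed

end

section \<open>Escaping curves have large action\<close>

lemma first_crossing:
  fixes n :: "real \<Rightarrow> real"
  assumes "continuous_on {p..q} n" "p \<le> q" "n p \<le> c" "c \<le> n q"
  obtains s where "s \<in> {p..q}" "n s = c" "\<And>t. t \<in> {p..<s} \<Longrightarrow> n t < c"
proof -
  define S where "S = {t \<in> {p..q}. c \<le> n t}"
  have cl: "closed S" unfolding S_def by (intro continuous_on_closed_Collect_le assms continuous_intros)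
  have q: "q \<in> S" using assms by (auto simp: S_def)
  have bd: "bdd_below S" by (auto simp: S_def)
  have s: "Inf S \<in> S" using closed_contains_Inf[OF _ bd cl] q by blast
  have lt: "n t < c" if "t \<in> {p..<Inf S}" for t
    using cInf_lower[OF _ bd, of t] that s by (force simp: S_def)
  have "n (Inf S) = c"
  proof (rule ccontr)
    assume "n (Inf S) \<noteq> c"
    then have "c \<le> n (Inf S)" using s by (auto simp: S_def)
    moreover have "continuous_on {p..Inf S} n" using s by (intro continuous_on_subset[OF assms(1)]) (auto simp: S_def)
    ultimately obtain t where "p \<le> t" "t \<le> Inf S" "n t = c"
      using IVT'[of n p c "Inf S"] assms s by (auto simp: S_def)
    then show False using lt[of t] \<open>n (Inf S) \<noteq> c\<close> by (cases "t = Inf S") auto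
  qed
  then show ?thesis using that[of "Inf S"] s lt by (auto simp: S_def)
qed

lemma last_crossing:
  fixes n :: "real \<Rightarrow> real"
  assumes "continuous_on {p..q} n" "p \<le> q" "n p \<le> c" "c \<le> n q"
  obtains s where "s \<in> {p..q}" "n s = c" "\<And>t. t \<in> {s<..q} \<Longrightarrow> c < n t"
proof -
  have "continuous_on {- q..- p} (\<lambda>t. - n (- t))"
    by (intro continuous_intros continuous_on_compose2[OF assms(1)]) auto
  then obtain s where "s \<in> {- q..- p}" "- n (- s) = - c" "\<And>t. t \<in> {- q..<s} \<Longrightarrow> - n (- t) < - c"
    using first_crossing[of "- q" "- p" "\<lambda>t. - n (- t)" "- c"] assms by auto
  note s = this
  show ?thesis
  proof (rule that[of "- s"])
    fix t assume "t \<in> {- s<..q}"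
    then show "c < n t" using s(3)[of "- t"] by auto
  qed (use s(1,2) in simp_all)
qed

context potential
begin

text \<open>\<open>\<sigma>\<close> is merely gauge integrable, so the integral is compared with the action directly on a fine
  tagged division, the piece \<open>[c, d]\<close> being charged to the time between the first visits to the
  spheres of radius \<open>c\<close> and \<open>d\<close>.\<close>

lemma act_radial_lower:
  assumes cu: "curve u e a b" and "a \<le> b"
    and \<sigma>: "\<And>x. x \<in> \<Omega> \<Longrightarrow> r1 \<le> norm x \<Longrightarrow> \<sigma> (norm x) \<le> sqrt (U x)"
    and start: "norm (u a) \<le> r1" and "r1 \<le> R" and fin: "R \<le> norm (u b)"
    and int: "\<sigma> integrable_on {r1..R}"
  shows "integral {r1..R} \<sigma> \<le> act u e a b"
proof -
  define n where "n t = norm (u t)" for t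
  have contn: "continuous_on {a..b} n"
    unfolding n_def using curve_cont[OF cu] by (intro continuous_intros)
  have "\<forall>r\<in>{r1..R}. \<exists>t. t \<in> {a..b} \<and> n t = r \<and> (\<forall>s\<in>{a..<t}. n s < r)"
  proof
    fix r assume "r \<in> {r1..R}"
    then have "n a \<le> r" "r \<le> n b" using start fin by (auto simp: n_def)
    then obtain t where "t \<in> {a..b}" "n t = r" "\<And>s. s \<in> {a..<t} \<Longrightarrow> n s < r"
      using first_crossing[OF contn \<open>a \<le> b\<close>] by blast
    then show "\<exists>t. t \<in> {a..b} \<and> n t = r \<and> (\<forall>s\<in>{a..<t}. n s < r)" by blast
  qed
  \<comment> \<open>\<open>\<tau> r\<close> is the first time at radius \<open>r\<close>. First
    times increase with \<open>r\<close>, so the action up to \<open>\<tau> r\<close> is a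
    nondecreasing function \<open>f\<close> of the radius whose increments can be charged to
    shells.\<close>
  from bchoice[OF this]
  obtain \<tau> where \<tau>: "\<And>r. r \<in> {r1..R} \<Longrightarrow> \<tau> r \<in> {a..b} \<and> n (\<tau> r) = r \<and> (\<forall>s\<in>{a..<\<tau> r}. n s < r)"
    by blast
  have \<tau>_mono: "\<tau> r \<le> \<tau> r'" if "r \<in> {r1..R}" "r' \<in> {r1..R}" "r \<le> r'" for r r'
  proof (rule ccontr)
    assume "\<not> \<tau> r \<le> \<tau> r'"
    then have "\<tau> r' \<in> {a..<\<tau> r}" using \<tau>[OF that(2)] by auto
    then have "n (\<tau> r') < r" using \<tau>[OF that(1)] by blast
    then show False using \<tau>[OF that(2)] that(3) by simp
  qed
  define f where "f r = act u e a (\<tau> r)" for r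
  have f_diff: "f r' - f r = act u e (\<tau> r) (\<tau> r')" if "r \<in> {r1..R}" "r' \<in> {r1..R}" "r \<le> r'" for r r'
  proof -
    have "a \<le> \<tau> r" "\<tau> r' \<le> b" using \<tau> that by auto
    then show ?thesis
      using act_combine[OF curve_subset[OF cu order_refl], of "\<tau> r'" "\<tau> r"] \<tau>_mono[OF that]
      by (simp add: f_def)
  qed
  have f_mono: "f r \<le> f r'" if "r \<in> {r1..R}" "r' \<in> {r1..R}" "r \<le> r'" for r r'
    using f_diff[OF that] act_nonneg[OF curve_subset[OF cu], of "\<tau> r" "\<tau> r'"] \<tau>_mono[OF that] \<tau> that by auto
  \<comment> \<open>The accuracy \<open>\<eta>\<close> is spent twice: on lowering
    \<open>\<sigma>\<close> by \<open>\<eta>\<close> over the length \<open>R - r1\<close>, and on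
    the error of the Riemann sum.\<close>
  have main: "integral {r1..R} \<sigma> \<le> (f R - f r1) + \<eta> * (R - r1 + 1)" if "0 < \<eta>" for \<eta>
  proof -
    \<comment> \<open>Nothing relates the values of \<open>\<sigma>\<close> at different radii, but
      \<open>U\<close> along the curve is continuous. The times at which it is too small form a
      compact set whose radii stay away from \<open>r\<close>, so the bound at \<open>r\<close>
      persists, up to \<open>\<eta>\<close>, at nearby radii.\<close>
    have "\<exists>\<epsilon>>0. \<forall>t\<in>{a..b}. \<bar>n t - r\<bar> < \<epsilon> \<longrightarrow> \<sigma> r - \<eta> \<le> sqrt (U (u t))" if r: "r1 \<le> r" for r
    proof -
      define A where "A = {t \<in> {a..b}. sqrt (U (u t)) \<le> \<sigma> r - \<eta>}"
      have "closed A" unfolding A_def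
        by (intro continuous_on_closed_Collect_le continuous_intros U_comp_cont curve_cont[OF cu] closed_atLeastAtMost)
      moreover have "A \<subseteq> {a..b}" by (auto simp: A_def)
      ultimately have "compact A" using compact_Int_closed[OF compact_Icc[of a b], of A] by (simp add: inf.absorb2)
      then have "compact (n ` A)"
        using \<open>A \<subseteq> {a..b}\<close> by (intro compact_continuous_image continuous_on_subset[OF contn])
      then have "closed (n ` A)" by (rule compact_imp_closed)
      have "r \<notin> n ` A"
        using \<sigma>[OF curve_in[OF cu]] r \<open>0 < \<eta>\<close> by (force simp: A_def n_def)
      then obtain d where "0 < d" and d: "\<And>x. x \<in> n ` A \<Longrightarrow> d \<le> dist r x"
        using separate_point_closed[OF \<open>closed (n ` A)\<close>] by blast
      show ?thesis
      proof (intro exI[of _ d] conjI ballI impI)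
        fix t assume t: "t \<in> {a..b}" "\<bar>n t - r\<bar> < d"
        then have "t \<notin> A" using d[of "n t"] by (auto simp: dist_real_def)
        then show "\<sigma> r - \<eta> \<le> sqrt (U (u t))" using t by (auto simp: A_def)
      qed (use \<open>0 < d\<close> in auto)
    qed
    then have "\<exists>\<epsilon>. 0 < \<epsilon> \<and> (\<forall>t\<in>{a..b}. \<bar>n t - r\<bar> < \<epsilon> \<longrightarrow> r1 \<le> r \<longrightarrow> \<sigma> r - \<eta> \<le> sqrt (U (u t)))" for r
      by (cases "r1 \<le> r") (auto intro: exI[of _ 1])
    then have "\<forall>r. \<exists>\<epsilon>. 0 < \<epsilon> \<and> (\<forall>t\<in>{a..b}. \<bar>n t - r\<bar> < \<epsilon> \<longrightarrow> r1 \<le> r \<longrightarrow> \<sigma> r - \<eta> \<le> sqrt (U (u t)))" ..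
    from choice[OF this] obtain \<epsilon> where \<epsilon>: "\<And>r. 0 < \<epsilon> r"
      and \<epsilon>': "\<And>r t. t \<in> {a..b} \<Longrightarrow> \<bar>n t - r\<bar> < \<epsilon> r \<Longrightarrow> r1 \<le> r \<Longrightarrow> \<sigma> r - \<eta> \<le> sqrt (U (u t))"
      by blast
    have piece: "(\<sigma> r - \<eta>) * (d - c) \<le> f d - f c"
      if "c \<le> d" "r1 \<le> c" "d \<le> R" "r \<in> {c..d}" "{c..d} \<subseteq> ball r (\<epsilon> r)" for c d r
    proof -
      have cd: "c \<in> {r1..R}" "d \<in> {r1..R}" using that by auto
      note tc = \<tau>[OF cd(1)] and td = \<tau>[OF cd(2)] and tm = \<tau>_mono[OF cd \<open>c \<le> d\<close>]
      have "continuous_on {\<tau> c..\<tau> d} n" using tc td by (intro continuous_on_subset[OF contn]) auto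
      \<comment> \<open>After its first visit to radius \<open>c\<close> the curve may dip below it
        again. Starting from the last such visit before \<open>\<tau> d\<close> keeps the norm
        between \<open>c\<close> and \<open>d\<close>, where the lower bound at the tag
        \<open>r\<close> is available.\<close>
      then obtain s where s: "s \<in> {\<tau> c..\<tau> d}" "n s = c" "\<And>t. t \<in> {s<..\<tau> d} \<Longrightarrow> c < n t"
        using last_crossing[of "\<tau> c" "\<tau> d" n c] tc td tm \<open>c \<le> d\<close> by auto
      have b: "a \<le> \<tau> c" "\<tau> c \<le> s" "s \<le> \<tau> d" "\<tau> d \<le> b" "n (\<tau> c) = c" "n (\<tau> d) = d" "n s = c"
        using tc td s(1,2) by simp_all
      have cs: "curve u e s (\<tau> d)" using b by (intro curve_subset[OF cu]) auto
      have "(\<sigma> r - \<eta>) * norm (u (\<tau> d) - u s) \<le> act u e s (\<tau> d)"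
      proof (rule act_lower[OF cs])
        fix t assume t: "t \<in> {s..\<tau> d}"
        have "c \<le> n t" using t s(3)[of t] b by (cases "t = s") (auto intro: less_imp_le)
        moreover have "t < \<tau> d \<Longrightarrow> n t < d" using t b td by (auto dest!: bspec[of _ _ t])
        then have "n t \<le> d" using t b by (cases "t = \<tau> d") auto
        ultimately have "n t \<in> ball r (\<epsilon> r)" using that by auto
        then show "\<sigma> r - \<eta> \<le> sqrt (U (u t))"
          using \<epsilon>'[of t r] t b that by (auto simp: dist_real_def)
      qed (use b in simp)
      also have "\<dots> \<le> act u e (\<tau> c) (\<tau> d)"
        using b by (intro act_mono_subset curve_subset[OF cu]) auto
      also have "\<dots> = f d - f c" using f_diff cd \<open>c \<le> d\<close> by auto
      finally have 1: "(\<sigma> r - \<eta>) * norm (u (\<tau> d) - u s) \<le> f d - f c" .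
      have "d - c \<le> norm (u (\<tau> d) - u s)" using norm_triangle_ineq2[of "u (\<tau> d)" "u s"] b by (auto simp: n_def)
      show ?thesis
      proof (cases "0 \<le> \<sigma> r - \<eta>")
        case True
        then show ?thesis
          using mult_left_mono[OF \<open>d - c \<le> norm (u (\<tau> d) - u s)\<close> True] 1 by linarith
      next
        case False
        then have "(\<sigma> r - \<eta>) * (d - c) \<le> 0" using \<open>c \<le> d\<close> by (intro mult_nonpos_nonneg) auto
        then show ?thesis using f_mono[OF cd \<open>c \<le> d\<close>] by linarith
      qed
    qed
    obtain \<gamma> where "gauge \<gamma> \<and> (\<forall>p. p tagged_division_of {r1..R} \<and> \<gamma> fine p \<longrightarrow>
        norm ((\<Sum>(x, k)\<in>p. measure lborel k *\<^sub>R \<sigma> x) - integral {r1..R} \<sigma>) < \<eta>)"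
      using integrable_integral[OF int, unfolded has_integral_real] \<open>0 < \<eta>\<close> by (elim allE impE exE)
    then have "gauge \<gamma>" and \<gamma>: "\<And>p. p tagged_division_of {r1..R} \<Longrightarrow> \<gamma> fine p \<Longrightarrow>
        norm ((\<Sum>(x, k)\<in>p. measure lborel k *\<^sub>R \<sigma> x) - integral {r1..R} \<sigma>) < \<eta>"
      by simp_all
    \<comment> \<open>Refining by the balls makes every interval of the division small enough for
      \<open>piece\<close> at its tag.\<close>
    define \<gamma>' where "\<gamma>' r = \<gamma> r \<inter> ball r (\<epsilon> r)" for r
    have "gauge \<gamma>'" unfolding \<gamma>'_def using \<open>gauge \<gamma>\<close> \<epsilon> by (intro gauge_Int gauge_ball_dependent) auto
    then obtain p where p: "p tagged_division_of {r1..R}" "\<gamma>' fine p"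
      using fine_division_exists_real by blast
    have "\<gamma> fine p" using p(2) by (auto simp: fine_def \<gamma>'_def)
    \<comment> \<open>The loss \<open>\<eta>\<close> is absorbed into the function
      \<open>f r + \<eta> * r\<close>, whose increments telescope over the division.\<close>
    have "(\<Sum>(x, k)\<in>p. measure lborel k *\<^sub>R \<sigma> x)
        \<le> (\<Sum>(x, k)\<in>p. (f (Sup k) + \<eta> * Sup k) - (f (Inf k) + \<eta> * Inf k))"
    proof (rule sum_mono, safe)
      fix x k assume xk: "(x, k) \<in> p"
      then obtain c d where k: "k = {c..d}" using tagged_division_ofD(4)[OF p(1)] by (metis box_real(2))
      have x: "x \<in> k" "k \<subseteq> {r1..R}" using tagged_division_ofD(2,3)[OF p(1) xk] by auto
      then have "c \<le> d" using k by auto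
      have "k \<subseteq> ball x (\<epsilon> x)" using p(2) xk by (auto simp: fine_def \<gamma>'_def)
      then have "(\<sigma> x - \<eta>) * (d - c) \<le> f d - f c" using piece[of c d x] x k \<open>c \<le> d\<close> by auto
      then show "measure lborel k *\<^sub>R \<sigma> x \<le> f (Sup k) + \<eta> * Sup k - (f (Inf k) + \<eta> * Inf k)"
        using \<open>c \<le> d\<close> k by (simp add: algebra_simps)
    qed
    also have "\<dots> = (f R + \<eta> * R) - (f r1 + \<eta> * r1)"
      using additive_tagged_division_1[OF \<open>r1 \<le> R\<close> p(1), of "\<lambda>x. f x + \<eta> * x"] by simp
    finally show ?thesis using \<gamma>[OF p(1) \<open>\<gamma> fine p\<close>] by (simp add: algebra_simps abs_if split: if_splits)
  qed
  have "integral {r1..R} \<sigma> \<le> f R - f r1"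
  proof (rule field_le_epsilon)
    fix \<epsilon> :: real assume "0 < \<epsilon>"
    have "0 < \<epsilon> / (R - r1 + 1)" using \<open>0 < \<epsilon>\<close> \<open>r1 \<le> R\<close> by simp
    from main[OF this] show "integral {r1..R} \<sigma> \<le> f R - f r1 + \<epsilon>" using \<open>r1 \<le> R\<close> by simp
  qed
  also have "\<dots> = act u e (\<tau> r1) (\<tau> R)" using f_diff \<open>r1 \<le> R\<close> by auto
  also have "\<dots> \<le> act u e a b"
    using \<tau>_mono[of r1 R] \<tau>[of r1, THEN conjunct1] \<tau>[of R, THEN conjunct1] \<open>r1 \<le> R\<close>
    by (intro act_mono_subset cu) auto
  finally show ?thesis .
qed

end

section \<open>The Euler--Lagrange equation from hat-shaped variations\<close>

text \<open>The second derivative of a hat consists of three point masses, so two integrations by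
  parts turn its integral against \<open>f\<close> into a second difference of the second primitive
  \<open>F2\<close>.\<close>

lemma hat_integral_second_difference:
  fixes f F1 F2 :: "real \<Rightarrow> 'a::euclidean_space"
  assumes L: "0 < L"
    and F1: "\<And>t. t \<in> {c - L..c + L} \<Longrightarrow> (F1 has_vector_derivative f t) (at t within {c - L..c + L})"
    and F2: "\<And>t. t \<in> {c - L..c + L} \<Longrightarrow> (F2 has_vector_derivative F1 t) (at t within {c - L..c + L})"
  shows "((\<lambda>t. (1 - \<bar>t - c\<bar> / L) *\<^sub>R f t) has_integral
    (1 / L) *\<^sub>R (F2 (c + L) - 2 *\<^sub>R F2 c + F2 (c - L))) {c - L..c + L}"
proof -
  \<comment> \<open>\<open>k\<close> replaces the absolute value by its sign: 1 on the right half of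
    the window and -1 on the left half.\<close>
  have ftc: "((\<lambda>t. (L - k * (t - c)) *\<^sub>R f t) has_integral
      ((L - k * (b - c)) *\<^sub>R F1 b + k *\<^sub>R F2 b) - ((L - k * (a - c)) *\<^sub>R F1 a + k *\<^sub>R F2 a)) {a..b}"
    if ab: "a \<le> b" "{a..b} \<subseteq> {c - L..c + L}" for k a b
  proof (rule fundamental_theorem_of_calculus[OF ab(1)])
    fix t assume "t \<in> {a..b}"
    then have "t \<in> {c - L..c + L}" using ab(2) by blast
    note d = has_vector_derivative_within_subset[OF F1[OF this] ab(2)]
      has_vector_derivative_within_subset[OF F2[OF this] ab(2)]
    have "((\<lambda>t. (L - k * (t - c)) *\<^sub>R F1 t + k *\<^sub>R F2 t) has_vector_derivative
      ((L - k * (t - c)) *\<^sub>R f t + (0 - k * (1 - 0)) *\<^sub>R F1 t) + (k *\<^sub>R F1 t + 0 *\<^sub>R F2 t)) (at t within {a..b})"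
      by (intro has_vector_derivative_add has_vector_derivative_scaleR d DERIV_diff DERIV_cmult DERIV_const DERIV_ident)
    then show "((\<lambda>t. (L - k * (t - c)) *\<^sub>R F1 t + k *\<^sub>R F2 t) has_vector_derivative (L - k * (t - c)) *\<^sub>R f t)
      (at t within {a..b})" by simp
  qed
  have i1: "((\<lambda>t. (L - \<bar>t - c\<bar>) *\<^sub>R f t) has_integral (F2 (c + L) - L *\<^sub>R F1 c - F2 c)) {c..c + L}"
    by (rule has_integral_eq[OF _ has_integral_eq_rhs[OF ftc[of c "c + L" 1]]]) (use L in auto)
  have i2: "((\<lambda>t. (L - \<bar>t - c\<bar>) *\<^sub>R f t) has_integral (L *\<^sub>R F1 c - F2 c + F2 (c - L))) {c - L..c}"
    by (rule has_integral_eq[OF _ has_integral_eq_rhs[OF ftc[of "c - L" c "-1"]]]) (use L in auto)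
  have "((\<lambda>t. (L - \<bar>t - c\<bar>) *\<^sub>R f t) has_integral
      (L *\<^sub>R F1 c - F2 c + F2 (c - L)) + (F2 (c + L) - L *\<^sub>R F1 c - F2 c)) {c - L..c + L}"
    by (rule has_integral_combine[OF _ _ i2 i1]) (use L in auto)
  from has_integral_cmul[OF this, of "1 / L"]
  have "((\<lambda>t. (1 / L) *\<^sub>R (L - \<bar>t - c\<bar>) *\<^sub>R f t) has_integral
      (1 / L) *\<^sub>R (F2 (c + L) - 2 *\<^sub>R F2 c + F2 (c - L))) {c - L..c + L}"
    by (rule has_integral_eq_rhs) (simp add: algebra_simps scaleR_2)
  moreover have "(\<lambda>t. (1 / L) *\<^sub>R (L - \<bar>t - c\<bar>) *\<^sub>R f t) = (\<lambda>t. (1 - \<bar>t - c\<bar> / L) *\<^sub>R f t)"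
    using L by (intro ext) (simp add: diff_divide_distrib)
  ultimately show ?thesis by simp
qed

text \<open>Maximum principle: once the chord is subtracted, the maximum of any linear functional
  along the curve spreads to an end point, where the value is 0.\<close>

lemma midpoint_affine:
  fixes z :: "real \<Rightarrow> 'a::euclidean_space"
  assumes "p < q" and cont: "continuous_on {p..q} z"
    and mid: "\<And>c L. 0 < L \<Longrightarrow> p \<le> c - L \<Longrightarrow> c + L \<le> q \<Longrightarrow> z (c + L) + z (c - L) = 2 *\<^sub>R z c"
  shows "\<exists>a b. \<forall>t\<in>{p..q}. z t = a + t *\<^sub>R b"
proof -
  define b where "b = (1 / (q - p)) *\<^sub>R (z q - z p)"
  define a where "a = z p - p *\<^sub>R b"
  define y where "y t = z t - (a + t *\<^sub>R b)" for t
  have yp: "y p = 0" by (simp add: y_def a_def)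
  have "(q - p) *\<^sub>R b = z q - z p" using \<open>p < q\<close> by (simp add: b_def)
  then have yq: "y q = 0" by (simp add: y_def a_def algebra_simps)
  have ymid: "y (c + L) + y (c - L) = 2 *\<^sub>R y c" if "0 < L" "p \<le> c - L" "c + L \<le> q" for c L
  proof -
    have "y (c + L) + y (c - L) = (z (c + L) + z (c - L)) - 2 *\<^sub>R (a + c *\<^sub>R b)"
      by (simp add: y_def scaleR_add_left scaleR_diff_left scaleR_2)
    then show ?thesis unfolding mid[OF that] by (simp add: y_def scaleR_diff_right)
  qed
  have conty: "continuous_on {p..q} y" unfolding y_def by (intro continuous_intros cont)
  have le: "inner (y t) w \<le> 0" if t: "t \<in> {p..q}" for t w
  proof -
    have "continuous_on {p..q} (\<lambda>t. inner (y t) w)" by (intro continuous_intros conty)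
    then obtain c where c: "c \<in> {p..q}" and max: "\<And>s. s \<in> {p..q} \<Longrightarrow> inner (y s) w \<le> inner (y c) w"
      using continuous_attains_sup[of "{p..q}" "\<lambda>t. inner (y t) w"] t by fastforce
    have "inner (y c) w = 0"
    proof (cases "c = p \<or> c = q")
      case False
      \<comment> \<open>The widest window around \<open>c\<close> reaches an end point, and the
        midpoint identity carries the maximum there.\<close>
      define L where "L = min (c - p) (q - c)"
      have L: "0 < L" "p \<le> c - L" "c + L \<le> q" using False c by (auto simp: L_def)
      have "inner (y (c + L)) w + inner (y (c - L)) w = 2 * inner (y c) w"
        using ymid[OF L] by (metis inner_add_left inner_scaleR_left)
      moreover have "inner (y (c + L)) w \<le> inner (y c) w" "inner (y (c - L)) w \<le> inner (y c) w"
        using L by (auto intro!: max)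
      ultimately have "inner (y (c + L)) w = inner (y c) w" "inner (y (c - L)) w = inner (y c) w" by linarith+
      moreover have "c - L = p \<or> c + L = q" by (auto simp: L_def min_def)
      ultimately show ?thesis using yp yq by auto
    qed (use yp yq in auto)
    then show ?thesis using max[OF t] by simp
  qed
  have "z t = a + t *\<^sub>R b" if "t \<in> {p..q}" for t
  proof -
    have "inner (y t) (y t) = 0" using le[OF that, of "y t"] inner_ge_zero[of "y t"] by linarith
    then show ?thesis by (simp add: y_def)
  qed
  then show ?thesis by blast
qed

text \<open>No differentiability of \<open>u\<close> is presupposed. The difference of
  \<open>u\<close> and a second primitive of \<open>f\<close> satisfies the midpoint identity, so it
  is affine, and \<open>u\<close> inherits the regularity of the primitive.\<close>

lemma euler_lagrange_imp_ode:
  fixes u f :: "real \<Rightarrow> 'a::euclidean_space"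
  assumes contu: "continuous_on {p<..<q} u" and contf: "continuous_on {p<..<q} f"
    and EL: "\<And>c L. 0 < L \<Longrightarrow> {c - L..c + L} \<subseteq> {p<..<q} \<Longrightarrow>
      (1 / L) *\<^sub>R (2 *\<^sub>R u c - u (c - L) - u (c + L))
        + integral {c - L..c + L} (\<lambda>t. (1 - \<bar>t - c\<bar> / L) *\<^sub>R f t) = 0"
    and t: "t \<in> {p<..<q}"
  shows "(u has_vector_derivative vector_derivative u (at t)) (at t)"
    "((\<lambda>t. vector_derivative u (at t)) has_vector_derivative f t) (at t)"
proof -
  obtain p' where p': "p < p'" "p' < t" using t dense[of p t] by auto
  obtain q' where q': "t < q'" "q' < q" using t dense[of t q] by auto
  have sub: "{p'..q'} \<subseteq> {p<..<q}" using p' q' by auto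
  define F1 where "F1 t = integral {p'..t} f" for t
  define F2 where "F2 t = integral {p'..t} F1" for t
  have contf': "continuous_on {p'..q'} f" using contf sub by (rule continuous_on_subset)
  have dF1: "(F1 has_vector_derivative f s) (at s within {p'..q'})" if "s \<in> {p'..q'}" for s
    unfolding F1_def using contf' that by (rule integral_has_vector_derivative)
  then have "continuous_on {p'..q'} F1"
    by (meson continuous_on_eq_continuous_within has_vector_derivative_continuous)
  then have dF2: "(F2 has_vector_derivative F1 s) (at s within {p'..q'})" if "s \<in> {p'..q'}" for s
    unfolding F2_def using that by (rule integral_has_vector_derivative)
  then have contF2: "continuous_on {p'..q'} F2"
    by (meson continuous_on_eq_continuous_within has_vector_derivative_continuous)
  have "\<exists>a b. \<forall>s\<in>{p'..q'}. u s - F2 s = a + s *\<^sub>R b"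
  proof (rule midpoint_affine[of p' q' "\<lambda>s. u s - F2 s"])
    show "p' < q'" using p' q' by simp
    show "continuous_on {p'..q'} (\<lambda>s. u s - F2 s)"
      by (intro continuous_intros contF2 continuous_on_subset[OF contu sub])
    fix c L :: real assume L: "0 < L" "p' \<le> c - L" "c + L \<le> q'"
    have s1: "{c - L..c + L} \<subseteq> {p'..q'}" using L by auto
    have "((\<lambda>t. (1 - \<bar>t - c\<bar> / L) *\<^sub>R f t) has_integral
       (1 / L) *\<^sub>R (F2 (c + L) - 2 *\<^sub>R F2 c + F2 (c - L))) {c - L..c + L}"
      by (rule hat_integral_second_difference[OF L(1)])
        (use s1 dF1 dF2 in \<open>blast intro: has_vector_derivative_within_subset\<close>)+
    then have "(1 / L) *\<^sub>R (2 *\<^sub>R u c - u (c - L) - u (c + L))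
        + (1 / L) *\<^sub>R (F2 (c + L) - 2 *\<^sub>R F2 c + F2 (c - L)) = 0"
      using EL[OF L(1) subset_trans[OF s1 sub]] by (simp only: integral_unique)
    then have "(1 / L) *\<^sub>R ((2 *\<^sub>R u c - u (c - L) - u (c + L)) + (F2 (c + L) - 2 *\<^sub>R F2 c + F2 (c - L))) = 0"
      by (simp add: scaleR_add_right)
    then have "(2 *\<^sub>R u c - u (c - L) - u (c + L)) + (F2 (c + L) - 2 *\<^sub>R F2 c + F2 (c - L)) = 0"
      using L by simp
    then show "u (c + L) - F2 (c + L) + (u (c - L) - F2 (c - L)) = 2 *\<^sub>R (u c - F2 c)"
      by (simp add: algebra_simps)
  qed
  then obtain a b where ab: "\<And>s. s \<in> {p'..q'} \<Longrightarrow> u s - F2 s = a + s *\<^sub>R b" by blast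
  have du: "(u has_vector_derivative F1 s + b) (at s)" if s: "s \<in> {p'<..<q'}" for s
  proof -
    have at: "at s within {p'..q'} = at s" using s by (intro at_within_interior) (auto simp: interior_atLeastAtMost_real)
    have "((\<lambda>s. F2 s + (a + s *\<^sub>R b)) has_vector_derivative F1 s + (0 + (s *\<^sub>R 0 + 1 *\<^sub>R b))) (at s)"
      using dF2[of s] s unfolding at
      by (intro has_vector_derivative_add has_vector_derivative_scaleR has_vector_derivative_const DERIV_ident) auto
    moreover have "F2 x + (a + x *\<^sub>R b) = u x" if "x \<in> {p'<..<q'}" for x
      using ab[of x] that by (auto simp: algebra_simps)
    ultimately show ?thesis
      using has_vector_derivative_transform_within_open[of _ _ s "{p'<..<q'}" u] s by simp
  qed
  have v: "vector_derivative u (at s) = F1 s + b" if "s \<in> {p'<..<q'}" for s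
    using du[OF that] by (rule vector_derivative_at)
  have t': "t \<in> {p'<..<q'}" using p' q' by auto
  show "(u has_vector_derivative vector_derivative u (at t)) (at t)"
    using du[OF t'] v[OF t'] by simp
  have at: "at t within {p'..q'} = at t" using t' by (intro at_within_interior) (auto simp: interior_atLeastAtMost_real)
  have "((\<lambda>s. F1 s + b) has_vector_derivative f t + 0) (at t)"
    using dF1[of t] t' unfolding at by (intro has_vector_derivative_add has_vector_derivative_const) auto
  then show "((\<lambda>t. vector_derivative u (at t)) has_vector_derivative f t) (at t)"
    using has_vector_derivative_transform_within_open[of "\<lambda>s. F1 s + b" "f t" t "{p'<..<q'}" "\<lambda>t. vector_derivative u (at t)"]
      t' v by simp
qed

text \<open>Testing with a small negative multiple of \<open>X\<close> lets the linear term win over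
  the quadratic error. This serves the Euler-Lagrange equation and, later, the minimiser of the
  Hessian form on the unit sphere.\<close>

lemma first_order_condition:
  fixes X :: "'a::real_inner"
  assumes "0 < r" "0 \<le> C" and ineq: "\<And>w. norm w \<le> r \<Longrightarrow> 0 \<le> inner w X + C * (norm w)\<^sup>2"
  shows "X = 0"
proof (rule ccontr)
  assume "X \<noteq> 0"
  \<comment> \<open>The first bound keeps the test vector admissible, the second gives
    \<open>s * C < 1\<close>.\<close>
  define s where "s = min (r / norm X) (1 / (2 * C + 1))"
  have s: "0 < s" "s * norm X \<le> r" using assms \<open>X \<noteq> 0\<close> by (auto simp: s_def min_def field_simps)
  have "s * C < 1"
  proof -
    have "s * C \<le> 1 / (2 * C + 1) * C" using assms by (intro mult_right_mono) (auto simp: s_def)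
    also have "\<dots> < 1" using assms by (simp add: field_simps)
    finally show ?thesis .
  qed
  have "0 \<le> inner (- s *\<^sub>R X) X + C * (norm (- s *\<^sub>R X))\<^sup>2" using s by (intro ineq) auto
  also have "\<dots> = - (s * (norm X)\<^sup>2 * (1 - s * C))"
    by (simp add: power2_norm_eq_inner[symmetric] power_mult_distrib) (simp add: power2_eq_square algebra_simps)
  finally have "s * (norm X)\<^sup>2 * (1 - s * C) \<le> 0" by simp
  moreover have "0 < s * (norm X)\<^sup>2 * (1 - s * C)" using s \<open>X \<noteq> 0\<close> \<open>s * C < 1\<close> by simp
  ultimately show False by simp
qed

text \<open>\<open>g\<close> is the gradient of \<open>U\<close>. Its Lipschitz bound on balls gives
  the quadratic remainder behind the first variation and the Gronwall argument; second derivatives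
  enter later, as hypotheses of individual lemmas.\<close>

locale smooth_potential = potential U \<Omega> for U :: "'a::euclidean_space \<Rightarrow> real" and \<Omega> +
  fixes g :: "'a \<Rightarrow> 'a"
  assumes dU: "(U has_derivative (\<lambda>h. inner (g x) h)) (at x)"
    and grad_lipschitz: "\<exists>K\<ge>0. \<forall>x\<in>cball 0 R. \<forall>y\<in>cball 0 R. norm (g x - g y) \<le> K * norm (x - y)"
begin

lemma U_line_deriv: "((\<lambda>s. U (x + s *\<^sub>R h)) has_real_derivative inner (g (x + s *\<^sub>R h)) h) (at s)"
proof -
  have "((\<lambda>s. x + s *\<^sub>R h) has_derivative (\<lambda>k. k *\<^sub>R h)) (at s)"
    by (auto intro!: derivative_eq_intros)
  from has_derivative_compose[OF this dU]
  show ?thesis by (simp add: has_field_derivative_def mult.commute[of _ "inner (g (x + s *\<^sub>R h)) h"] cong del: if_weak_cong)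
qed

lemma U_mean_value: "\<exists>\<xi>. 0 < \<xi> \<and> \<xi> < 1 \<and> U (x + h) - U x = inner (g (x + \<xi> *\<^sub>R h)) h"
proof -
  have "\<exists>z::real. 0 < z \<and> z < 1 \<and> U (x + 1 *\<^sub>R h) - U (x + 0 *\<^sub>R h) = (1 - 0) * inner (g (x + z *\<^sub>R h)) h"
    by (rule MVT2) (auto intro: U_line_deriv)
  then show ?thesis by simp
qed

lemma grad_continuous: "continuous_on S g"
proof -
  have "isCont g x" for x
  proof -
    obtain K where "0 \<le> K" and K: "\<And>y. y \<in> cball 0 (norm x + 1) \<Longrightarrow> norm (g y - g x) \<le> K * norm (y - x)"
      using grad_lipschitz[of "norm x + 1"] by (auto simp: norm_minus_commute)
    have "((\<lambda>y. g y - g x) \<longlongrightarrow> 0) (at x)"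
    proof (rule Lim_null_comparison)
      have "\<forall>\<^sub>F y in at x. y \<in> ball x 1" by (intro eventually_at_in_open') auto
      then show "\<forall>\<^sub>F y in at x. norm (g y - g x) \<le> K * norm (y - x)"
      proof eventually_elim
        case (elim y)
        have "norm y \<le> norm x + norm (y - x)" by (metis norm_triangle_sub)
        then show ?case using elim by (intro K) (auto simp: dist_norm norm_minus_commute)
      qed
      show "((\<lambda>y. K * norm (y - x)) \<longlongrightarrow> 0) (at x)" by (auto intro!: tendsto_eq_intros)
    qed
    then show ?thesis by (simp add: isCont_def LIM_zero_iff)
  qed
  then show ?thesis by (simp add: continuous_at_imp_continuous_on)
qed

lemma U_taylor:
  obtains K where "0 \<le> K" "\<And>x y. x \<in> cball 0 R \<Longrightarrow> y \<in> cball 0 R \<Longrightarrow>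
    \<bar>U y - U x - inner (g x) (y - x)\<bar> \<le> K * (norm (y - x))\<^sup>2"
proof -
  obtain K where "0 \<le> K" and K: "\<And>x y. x \<in> cball 0 R \<Longrightarrow> y \<in> cball 0 R \<Longrightarrow> norm (g x - g y) \<le> K * norm (x - y)"
    using grad_lipschitz[of R] by auto
  have "\<bar>U y - U x - inner (g x) (y - x)\<bar> \<le> K * (norm (y - x))\<^sup>2" if xy: "x \<in> cball 0 R" "y \<in> cball 0 R" for x y
  proof -
    obtain \<xi> where \<xi>: "0 < \<xi>" "\<xi> < 1" "U (x + (y - x)) - U x = inner (g (x + \<xi> *\<^sub>R (y - x))) (y - x)"
      using U_mean_value by blast
    let ?z = "x + \<xi> *\<^sub>R (y - x)"
    have "?z = (1 - \<xi>) *\<^sub>R x + \<xi> *\<^sub>R y" by (simp add: algebra_simps)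
    then have z: "?z \<in> cball 0 R"
      using convexD[OF convex_cball xy, of "1 - \<xi>" \<xi>] \<xi> by simp
    have "\<bar>U y - U x - inner (g x) (y - x)\<bar> = \<bar>inner (g ?z - g x) (y - x)\<bar>"
      using \<xi>(3) by (simp add: inner_diff_left)
    also have "\<dots> \<le> norm (g ?z - g x) * norm (y - x)" by (rule Cauchy_Schwarz_ineq2)
    also have "\<dots> \<le> (K * norm (?z - x)) * norm (y - x)" by (intro mult_right_mono K z xy) auto
    also have "\<dots> \<le> (K * norm (y - x)) * norm (y - x)"
      using \<xi> \<open>0 \<le> K\<close> by (intro mult_right_mono mult_left_mono) (auto intro: mult_left_le_one_le)
    finally show ?thesis by (simp add: power2_eq_square mult.assoc)
  qed
  with \<open>0 \<le> K\<close> show ?thesis by (rule that)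
qed

end

section \<open>Limits of almost minimisers\<close>

text \<open>\<open>{\<alpha> n..\<beta> n}\<close> is the true domain of the almost minimiser
  \<open>X n\<close>, which is extended to the whole line; \<open>inner_time\<close> says that it
  eventually surrounds every time at which the limit is inside \<Omega>. Minimality is stated
  through \<open>joined\<close>, so competitors may take a different time.\<close>

locale minimizing_limit = smooth_potential U \<Omega> g
  for U :: "'a::euclidean_space \<Rightarrow> real" and \<Omega> and g +
  fixes X :: "nat \<Rightarrow> real \<Rightarrow> 'a" and E :: "nat \<Rightarrow> real \<Rightarrow> real" and \<alpha> \<beta> \<epsilon> :: "nat \<Rightarrow> real"
    and u :: "real \<Rightarrow> 'a" and M R :: real
  assumes budget: "energy_budget (X n) (E n) s t"
    and budget_bound: "E n t - E n s \<le> M"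
    and X_bound: "norm (X n t) \<le> R"
    and X_conv: "(\<lambda>n. X n t) \<longlonglongrightarrow> u t"
    and X_Omega: "t \<in> {\<alpha> n..\<beta> n} \<Longrightarrow> X n t \<in> \<Omega>"
    and inner_time: "u t \<in> \<Omega> \<Longrightarrow> \<forall>\<^sub>F n in sequentially. \<alpha> n < t \<and> t < \<beta> n"
    and almost_minimal: "\<alpha> n \<le> s \<Longrightarrow> s < t \<Longrightarrow> t \<le> \<beta> n \<Longrightarrow> joined (X n s) (X n t) c \<Longrightarrow>
      act (X n) (E n) s t \<le> c + \<epsilon> n"
    and eps_0: "\<epsilon> \<longlonglongrightarrow> 0"
begin

lemma M_nonneg: "0 \<le> M"
  using budget_bound[of n t t] by simp

lemma X_holder: "(norm (X n t - X n s))\<^sup>2 \<le> \<bar>t - s\<bar> * M"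
  by (rule energy_budget_global_holder[OF budget budget_bound])

lemma u_holder: "(norm (u t - u s))\<^sup>2 \<le> \<bar>t - s\<bar> * M"
  by (rule LIMSEQ_le_const2[of "\<lambda>n. (norm (X n t - X n s))\<^sup>2"])
    (use X_holder in \<open>auto intro!: tendsto_intros X_conv\<close>)

lemma u_continuous: "continuous_on S u"
  by (rule half_holder_continuous_on[OF u_holder M_nonneg])

lemma X_continuous: "continuous_on S (X n)"
  by (rule half_holder_continuous_on[OF X_holder M_nonneg])

lemma u_bound: "norm (u t) \<le> R"
  by (rule LIMSEQ_le_const2[of "\<lambda>n. norm (X n t)"]) (use X_bound in \<open>auto intro!: tendsto_intros X_conv\<close>)

lemma uniform:
  assumes "0 < \<delta>"
  shows "\<forall>\<^sub>F n in sequentially. \<forall>\<tau>\<in>{s..t}. norm (X n \<tau> - u \<tau>) < \<delta>"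
proof -
  \<comment> \<open>Within time \<open>\<eta>\<close> neither \<open>X n\<close> nor
    \<open>u\<close> moves by \<open>\<delta> / 3\<close>, so convergence at the points of a finite
    \<open>\<eta>\<close>-net suffices.\<close>
  define \<eta> where "\<eta> = (\<delta> / 3)\<^sup>2 / (M + 1)"
  have "0 < \<eta>" using assms M_nonneg by (auto simp: \<eta>_def intro!: divide_pos_pos)
  then obtain k where k: "finite k" "{s..t} \<subseteq> (\<Union>x\<in>k. ball x \<eta>)"
    using compact_Icc[of s t] unfolding compact_eq_totally_bounded by blast
  have "\<forall>\<^sub>F n in sequentially. dist (X n x) (u x) < \<delta> / 3" for x
    using X_conv[of x] assms by (intro tendstoD) auto
  then have "\<forall>\<^sub>F n in sequentially. \<forall>x\<in>k. dist (X n x) (u x) < \<delta> / 3"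
    using k by (intro eventually_ball_finite) auto
  then show ?thesis
  proof eventually_elim
    case (elim n)
    show ?case
    proof
      fix \<tau> assume "\<tau> \<in> {s..t}"
      then obtain x where x: "x \<in> k" "dist x \<tau> < \<eta>" using k by force
      have "norm (X n \<tau> - X n x) < \<delta> / 3"
        by (rule half_holder_less[OF X_holder M_nonneg]) (use assms x in \<open>auto simp: \<eta>_def dist_real_def abs_minus_commute\<close>)
      moreover have "norm (u \<tau> - u x) < \<delta> / 3"
        by (rule half_holder_less[OF u_holder M_nonneg]) (use assms x in \<open>auto simp: \<eta>_def dist_real_def abs_minus_commute\<close>)
      moreover have "norm (X n x - u x) < \<delta> / 3" using elim x by (simp add: dist_norm)
      moreover have "norm (X n \<tau> - u \<tau>) \<le> norm (X n \<tau> - X n x) + norm (X n x - u x) + norm (u \<tau> - u x)"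
        using norm_triangle_ineq4[of "(X n \<tau> - X n x) + (X n x - u x)" "u \<tau> - u x"]
          norm_triangle_ineq[of "X n \<tau> - X n x" "X n x - u x"] by simp
      ultimately show "norm (X n \<tau> - u \<tau>) < \<delta>" by linarith
    qed
  qed
qed

text \<open>Dominated convergence, all curves lying in one ball. The perturbation
  \<open>\<phi>\<close> covers hats; the unperturbed case is \<phi> = 0, which explains the terms
  \<open>+ 0\<close> in later statements.\<close>

lemma integral_converges:
  assumes \<phi>: "continuous_on {s..t} \<phi>" "\<And>\<tau>. \<tau> \<in> {s..t} \<Longrightarrow> norm (\<phi> \<tau>) \<le> B"
  shows "(\<lambda>n. integral {s..t} (\<lambda>\<tau>. U (X n \<tau> + \<phi> \<tau>))) \<longlonglongrightarrow> integral {s..t} (\<lambda>\<tau>. U (u \<tau> + \<phi> \<tau>))"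
proof -
  have "bounded (U ` cball 0 (R + B))"
    using compact_continuous_image[OF continuous_on_subset[OF cont_U subset_UNIV] compact_cball]
    by (rule compact_imp_bounded)
  then obtain C where C: "\<And>x. x \<in> cball 0 (R + B) \<Longrightarrow> norm (U x) \<le> C" unfolding bounded_iff by blast
  show ?thesis
  proof (rule dominated_convergence(2)[where h = "\<lambda>_. C"])
    show "(\<lambda>\<tau>. U (X n \<tau> + \<phi> \<tau>)) integrable_on {s..t}" for n
      by (intro integrable_continuous_interval U_comp_cont continuous_intros X_continuous \<phi>)
    show "norm (U (X n \<tau> + \<phi> \<tau>)) \<le> C" if "\<tau> \<in> {s..t}" for n \<tau>
      using norm_triangle_ineq[of "X n \<tau>" "\<phi> \<tau>"] X_bound[of n \<tau>] \<phi>(2)[OF that] by (intro C) auto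
    show "(\<lambda>n. U (X n \<tau> + \<phi> \<tau>)) \<longlonglongrightarrow> U (u \<tau> + \<phi> \<tau>)" if "\<tau> \<in> {s..t}" for \<tau>
      using cont_U by (intro isCont_tendsto_compose[of _ U] tendsto_intros X_conv)
        (auto simp: continuous_on_eq_continuous_at)
  qed auto
qed

text \<open>The factor 2 leaves room for two deviations of size \<open>r\<close>: that of
  \<open>X n\<close> from \<open>u\<close>, and that of the hat.\<close>

lemma tube:
  assumes "u ` {s..t} \<subseteq> \<Omega>"
  obtains r where "0 < r" "\<And>\<tau> z. \<tau> \<in> {s..t} \<Longrightarrow> norm z \<le> 2 * r \<Longrightarrow> u \<tau> + z \<in> \<Omega>"
proof -
  have "compact (u ` {s..t})" by (intro compact_continuous_image u_continuous) auto
  moreover have "closed (- \<Omega>)" using open_Omega by (simp add: closed_Compl)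
  moreover have "u ` {s..t} \<inter> - \<Omega> = {}" using assms by auto
  ultimately obtain d where d: "0 < d" "\<And>x y. x \<in> u ` {s..t} \<Longrightarrow> y \<in> - \<Omega> \<Longrightarrow> d \<le> dist x y"
    using separate_compact_closed[of "u ` {s..t}" "- \<Omega>"] by auto
  show ?thesis
  proof (rule that[of "d / 3"])
    fix \<tau> and z :: 'a assume *: "\<tau> \<in> {s..t}" "norm z \<le> 2 * (d / 3)"
    show "u \<tau> + z \<in> \<Omega>"
    proof (rule ccontr)
      assume "u \<tau> + z \<notin> \<Omega>"
      then have "d \<le> dist (u \<tau>) (u \<tau> + z)" using * by (intro d) auto
      then show False using * d(1) by (auto simp: dist_norm)
    qed
  qed (use d in auto)
qed

lemma eventually_inner_interval:
  assumes "u ` {s..t} \<subseteq> \<Omega>" "s \<le> t"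
  shows "\<forall>\<^sub>F n in sequentially. \<alpha> n < s \<and> t < \<beta> n"
proof -
  have "\<forall>\<^sub>F n in sequentially. \<alpha> n < s \<and> s < \<beta> n" "\<forall>\<^sub>F n in sequentially. \<alpha> n < t \<and> t < \<beta> n"
    using assms by (auto intro!: inner_time)
  then show ?thesis by eventually_elim auto
qed

section \<open>Hat variations, the Euler-Lagrange equation and the energy\<close>

lemma hat_bounds: "0 < L \<Longrightarrow> t \<in> {c - L..c + L} \<Longrightarrow> 0 \<le> hat c L t" "0 < L \<Longrightarrow> hat c L t \<le> 1"
  by (auto simp: hat_def field_simps)

lemma hat_continuous: "0 < L \<Longrightarrow> continuous_on S (hat c L)"
  unfolding hat_def[abs_def] by (intro continuous_intros) auto

lemma hat_grad_continuous: "0 < L \<Longrightarrow> continuous_on S (\<lambda>t. hat c L t *\<^sub>R g (u t))"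
  by (intro continuous_intros hat_continuous continuous_on_compose2[OF grad_continuous[of UNIV] u_continuous]) auto

lemma hat_perturbation_continuous: "0 < L \<Longrightarrow> continuous_on S (\<lambda>t. u t + hat c L t *\<^sub>R w)"
  by (intro continuous_intros hat_continuous u_continuous)

text \<open>The change of the action when the hat with peak \<open>w\<close> is added to
  \<open>u\<close>. The kinetic energy of \<open>u\<close> has cancelled, so the formula makes sense
  before \<open>u\<close> is known to be differentiable.\<close>

definition hat_gain :: "real \<Rightarrow> real \<Rightarrow> 'a \<Rightarrow> real" where
  "hat_gain c L w = inner w (2 *\<^sub>R u c - u (c - L) - u (c + L)) / L + (norm w)\<^sup>2 / L
      + integral {c - L..c + L} (\<lambda>t. U (u t + hat c L t *\<^sub>R w)) - integral {c - L..c + L} (\<lambda>t. U (u t))"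

text \<open>The competitor is built from \<open>X n\<close> and not from \<open>u\<close>. The
  budget of \<open>X n\<close> occurs on both sides of almost minimality and drops out; what is
  left, three point values and two integrals, converges.\<close>

lemma hat_variation:
  assumes L: "0 < L" and in\<Omega>: "u ` {c - L..c + L} \<subseteq> \<Omega>"
  obtains r where "0 < r" "\<And>w. norm w \<le> r \<Longrightarrow> 0 \<le> hat_gain c L w"
proof -
  obtain r where r: "0 < r" "\<And>\<tau> z. \<tau> \<in> {c - L..c + L} \<Longrightarrow> norm z \<le> 2 * r \<Longrightarrow> u \<tau> + z \<in> \<Omega>"
    using tube[OF in\<Omega>] by blast
  show ?thesis
  proof (rule that[OF r(1)])
    fix w :: 'a assume w: "norm w \<le> r"
    have hw: "norm (hat c L t *\<^sub>R w) \<le> r" if "t \<in> {c - L..c + L}" for t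
    proof -
      have "\<bar>hat c L t\<bar> * norm w \<le> 1 * norm w"
        using hat_bounds[OF L, where t = t and c = c] that by (intro mult_right_mono) auto
      then show ?thesis using w by simp
    qed
    have ch: "continuous_on S (\<lambda>t. hat c L t *\<^sub>R w)" for S
      by (intro continuous_intros hat_continuous L)
    define Q where "Q n = inner w (2 *\<^sub>R X n c - X n (c - L) - X n (c + L)) / L + (norm w)\<^sup>2 / L
      + integral {c - L..c + L} (\<lambda>t. U (X n t + hat c L t *\<^sub>R w))
      - integral {c - L..c + L} (\<lambda>t. U (X n t + 0)) + \<epsilon> n" for n
    have "Q \<longlonglongrightarrow> inner w (2 *\<^sub>R u c - u (c - L) - u (c + L)) / L + (norm w)\<^sup>2 / L
      + integral {c - L..c + L} (\<lambda>t. U (u t + hat c L t *\<^sub>R w))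
      - integral {c - L..c + L} (\<lambda>t. U (u t + 0)) + 0"
      unfolding Q_def
      by (intro tendsto_intros X_conv eps_0 integral_converges[where B = r] ch hw) (use L r in auto)
    then have "Q \<longlonglongrightarrow> hat_gain c L w" by (simp only: hat_gain_def add_0_right)
    moreover have le: "c - L \<le> c + L" using L by simp
    have "\<forall>\<^sub>F n in sequentially. 0 \<le> Q n"
      using uniform[OF r(1), of "c - L" "c + L"] eventually_inner_interval[OF in\<Omega> le]
    proof eventually_elim
      case (elim n)
      then have ab: "\<alpha> n < c - L" "c + L < \<beta> n" using L by auto
      have cu: "curve (X n) (E n) (c - L) (c + L)"
        unfolding curve_def using budget X_Omega[of _ n] ab by (auto simp: image_subset_iff)
      have "X n t + hat c L t *\<^sub>R w \<in> \<Omega>" if "t \<in> {c - L..c + L}" for t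
      proof -
        have "norm ((X n t - u t) + hat c L t *\<^sub>R w) \<le> 2 * r"
          using norm_triangle_ineq[of "X n t - u t" "hat c L t *\<^sub>R w"] elim(1) that hw[OF that] by force
        from r(2)[OF that this] show ?thesis by simp
      qed
      from almost_minimal[OF _ _ _ joined_hat[OF cu L this]]
      show ?case using ab L by (simp add: act_def Q_def)
    qed
    ultimately show "0 \<le> hat_gain c L w" by (rule tendsto_lowerbound) simp
  qed
qed

text \<open>The inner product of \<open>w\<close> with the left-hand side is the first-order part of
  \<open>hat_gain c L w\<close>, so \<open>first_order_condition\<close> applies.\<close>

lemma euler_lagrange:
  assumes L: "0 < L" and in\<Omega>: "u ` {c - L..c + L} \<subseteq> \<Omega>"
  shows "(1 / L) *\<^sub>R (2 *\<^sub>R u c - u (c - L) - u (c + L))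
    + integral {c - L..c + L} (\<lambda>t. hat c L t *\<^sub>R g (u t)) = 0" (is "?X = 0")
proof -
  obtain r where r: "0 < r" and V: "\<And>w. norm w \<le> r \<Longrightarrow> 0 \<le> hat_gain c L w"
    using hat_variation[OF assms] by blast
  obtain K where "0 \<le> K" and K: "\<And>x y. x \<in> cball 0 (R + r) \<Longrightarrow> y \<in> cball 0 (R + r) \<Longrightarrow>
      \<bar>U y - U x - inner (g x) (y - x)\<bar> \<le> K * (norm (y - x))\<^sup>2"
    using U_taylor[of "R + r"] by blast
  show ?thesis
  \<comment> \<open>\<open>1 / L\<close> comes from the kinetic energy of the hat,
    \<open>2 * L * K\<close> from the Taylor remainder over a window of length
    \<open>2 * L\<close>.\<close>
  proof (rule first_order_condition[OF r, of "1 / L + 2 * L * K"])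
    fix w :: 'a assume w: "norm w \<le> r"
    note cw = hat_perturbation_continuous[OF L, of _ c w] and contg = hat_grad_continuous[OF L, of _ c]
    have "integral {c - L..c + L} (\<lambda>t. U (u t + hat c L t *\<^sub>R w)) - integral {c - L..c + L} (\<lambda>t. U (u t))
      = integral {c - L..c + L} (\<lambda>t. U (u t + hat c L t *\<^sub>R w) - U (u t))"
      by (intro integral_diff[symmetric] U_comp_int cw u_continuous)
    also have "\<dots> \<le> integral {c - L..c + L} (\<lambda>t. inner w (hat c L t *\<^sub>R g (u t)) + K * (norm w)\<^sup>2)"
    proof (rule integral_le)
      fix t assume t: "t \<in> {c - L..c + L}"
      have h: "\<bar>hat c L t\<bar> * norm w \<le> 1 * norm w"
        using hat_bounds[OF L, where t = t and c = c] t by (intro mult_right_mono) auto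
      have "\<bar>U (u t + hat c L t *\<^sub>R w) - U (u t) - inner (g (u t)) (u t + hat c L t *\<^sub>R w - u t)\<bar>
          \<le> K * (norm (u t + hat c L t *\<^sub>R w - u t))\<^sup>2"
        using u_bound[of t] norm_triangle_ineq[of "u t" "hat c L t *\<^sub>R w"] h w r by (intro K) auto
      also have "\<dots> \<le> K * (norm w)\<^sup>2" using h \<open>0 \<le> K\<close> by (intro mult_left_mono power_mono) auto
      finally show "U (u t + hat c L t *\<^sub>R w) - U (u t) \<le> inner w (hat c L t *\<^sub>R g (u t)) + K * (norm w)\<^sup>2"
        by (auto simp: inner_commute abs_le_iff)
    qed (intro integrable_diff U_comp_int cw u_continuous integrable_continuous_interval continuous_intros contg)+
    also have "\<dots> = integral {c - L..c + L} (\<lambda>t. inner w (hat c L t *\<^sub>R g (u t))) + 2 * L * (K * (norm w)\<^sup>2)"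
      using L integral_add[OF integrable_continuous_interval[OF continuous_on_inner[OF continuous_on_const contg]]
        integrable_const_ivl[of "K * (norm w)\<^sup>2" "c - L" "c + L"], of w] by simp
    also have "integral {c - L..c + L} (\<lambda>t. inner w (hat c L t *\<^sub>R g (u t)))
        = inner w (integral {c - L..c + L} (\<lambda>t. hat c L t *\<^sub>R g (u t)))"
      using integral_linear[OF integrable_continuous_interval[OF contg] bounded_linear_inner_right[of w]]
      by (simp add: o_def)
    finally have "integral {c - L..c + L} (\<lambda>t. U (u t + hat c L t *\<^sub>R w)) - integral {c - L..c + L} (\<lambda>t. U (u t))
      \<le> inner w (integral {c - L..c + L} (\<lambda>t. hat c L t *\<^sub>R g (u t))) + 2 * L * (K * (norm w)\<^sup>2)" .
    moreover have "inner w ?X = inner w (2 *\<^sub>R u c - u (c - L) - u (c + L)) / L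
      + inner w (integral {c - L..c + L} (\<lambda>t. hat c L t *\<^sub>R g (u t)))"
      by (simp only: inner_add_right inner_scaleR_right) simp
    moreover have "(1 / L + 2 * L * K) * (norm w)\<^sup>2 = (norm w)\<^sup>2 / L + 2 * L * (K * (norm w)\<^sup>2)"
      by (simp add: algebra_simps)
    ultimately show "0 \<le> inner w ?X + (1 / L + 2 * L * K) * (norm w)\<^sup>2"
      using V[OF w] unfolding hat_gain_def by linarith
  qed (use L \<open>0 \<le> K\<close> in auto)
qed

lemma ode:
  assumes "u ` {p<..<q} \<subseteq> \<Omega>" "t \<in> {p<..<q}"
  shows "(u has_vector_derivative vector_derivative u (at t)) (at t)"
    "((\<lambda>t. vector_derivative u (at t)) has_vector_derivative g (u t)) (at t)"
proof -
  have "continuous_on {p<..<q} (\<lambda>t. g (u t))"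
    by (rule continuous_on_compose2[OF grad_continuous[of UNIV] u_continuous]) auto
  moreover have "(1 / L) *\<^sub>R (2 *\<^sub>R u c - u (c - L) - u (c + L))
        + integral {c - L..c + L} (\<lambda>t. (1 - \<bar>t - c\<bar> / L) *\<^sub>R g (u t)) = 0"
    if "0 < L" "{c - L..c + L} \<subseteq> {p<..<q}" for c L
    using euler_lagrange[OF that(1), of c] that(2) assms(1) unfolding hat_def by blast
  ultimately show "(u has_vector_derivative vector_derivative u (at t)) (at t)"
    "((\<lambda>t. vector_derivative u (at t)) has_vector_derivative g (u t)) (at t)"
    using euler_lagrange_imp_ode[OF u_continuous, of p q "\<lambda>t. g (u t)"] assms(2) by blast+
qed

text \<open>Compared with the straight segment run through in time \<open>\<theta> h\<close> instead of \<open>h\<close>, minimality gives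
  \<open>a + w \<le> a / \<theta> + \<theta> w\<close> for all \<open>\<theta> > 0\<close>, where \<open>a\<close> and \<open>w\<close> are the kinetic and potential terms.\<close>

lemma zero_energy:
  assumes s: "u s \<in> \<Omega>" and dv: "(u has_vector_derivative v) (at s)"
  shows "(norm v)\<^sup>2 / 2 = U (u s)"
proof -
  define a where "a = (norm v)\<^sup>2 / 2"
  define w where "w = U (u s)"
  \<comment> \<open>The potential is replaced by \<open>w - \<eta>\<close> from below along the
    curve and by \<open>w + \<eta>\<close> from above on the competing segment.\<close>
  have main: "a * (1 - 1 / \<theta>) + w - \<eta> \<le> \<theta> * (w + \<eta>)" if "0 < \<theta>" "0 < \<eta>" for \<theta> \<eta> :: real
  proof -
    have "isCont U (u s)" using cont_U by (simp add: continuous_on_eq_continuous_at)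
    then obtain d where d: "0 < d" "\<And>x. dist x (u s) < d \<Longrightarrow> dist (U x) (U (u s)) < \<eta>"
      using \<open>0 < \<eta>\<close> unfolding continuous_at_eps_delta by blast
    obtain d' where d': "0 < d'" "ball (u s) d' \<subseteq> \<Omega>"
      by (rule openE[OF open_Omega s])
    define r where "r = min d d' / 2"
    have r: "0 < r" "ball (u s) r \<subseteq> \<Omega>" "\<And>x. x \<in> ball (u s) r \<Longrightarrow> \<bar>U x - w\<bar> < \<eta>"
      using d d' by (auto simp: r_def w_def dist_commute dist_real_def)
    define h0 where "h0 = r\<^sup>2 / (M + 1)"
    have "0 < h0" using r M_nonneg by (simp add: h0_def)
    have near: "u t \<in> ball (u s) r" if "t \<in> {s..<s + h0}" for t
      using half_holder_less[OF u_holder M_nonneg r(1), of t s] that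
      by (auto simp: h0_def dist_norm norm_minus_commute)
    have ineq: "(norm (u (s + h) - u s))\<^sup>2 / (2 * h) + h * (w - \<eta>)
        \<le> (norm (u (s + h) - u s))\<^sup>2 / (2 * (\<theta> * h)) + (\<theta> * h) * (w + \<eta>)" if h: "0 < h" "h < h0" for h
    proof -
      define k where "k x d = (norm (x (s + h) - x s))\<^sup>2 / (2 * d)" for x :: "real \<Rightarrow> 'a" and d
      have sub: "u ` {s..s + h} \<subseteq> ball (u s) r" using near h by auto
      have "integral {s..s + h} (\<lambda>t. w - \<eta>) \<le> integral {s..s + h} (\<lambda>t. U (u t))"
        using sub r(3) by (intro integral_le U_comp_int u_continuous) force+
      then have low: "h * (w - \<eta>) \<le> integral {s..s + h} (\<lambda>t. U (u t + 0))" using h by simp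
      have lim1: "(\<lambda>n. k (X n) h + integral {s..s + h} (\<lambda>t. U (X n t + 0)))
        \<longlonglongrightarrow> k u h + integral {s..s + h} (\<lambda>t. U (u t + 0))"
        unfolding k_def by (intro tendsto_intros X_conv integral_converges[where B = 0]) (use h in auto)
      have lim2: "(\<lambda>n. k (X n) (\<theta> * h) + (\<theta> * h) * (w + \<eta>) + \<epsilon> n)
        \<longlonglongrightarrow> k u (\<theta> * h) + (\<theta> * h) * (w + \<eta>) + 0"
        unfolding k_def by (intro tendsto_intros X_conv eps_0) (use h \<open>0 < \<theta>\<close> in auto)
      have ev: "\<forall>\<^sub>F n in sequentially. k (X n) h + integral {s..s + h} (\<lambda>t. U (X n t + 0))
        \<le> k (X n) (\<theta> * h) + (\<theta> * h) * (w + \<eta>) + \<epsilon> n"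
      proof -
        have "\<forall>\<^sub>F n in sequentially. X n t \<in> ball (u s) r" if "t \<in> {s..s + h}" for t
          using X_conv[of t] open_ball near[of t] that h by (intro topological_tendstoD) auto
        then have "\<forall>\<^sub>F n in sequentially. X n s \<in> ball (u s) r" "\<forall>\<^sub>F n in sequentially. X n (s + h) \<in> ball (u s) r"
          using h by auto
        moreover have "\<forall>\<^sub>F n in sequentially. \<alpha> n < s \<and> s + h < \<beta> n"
          using sub r(2) h by (intro eventually_inner_interval) auto
        ultimately show ?thesis
        proof eventually_elim
          case (elim n)
          have seg: "closed_segment (X n s) (X n (s + h)) \<subseteq> ball (u s) r"
            using elim by (intro closed_segment_subset) auto
          have "joined (X n s) (X n (s + h)) (k (X n) (\<theta> * h) + (\<theta> * h) * (w + \<eta>))"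
            unfolding k_def using seg r(2,3) h \<open>0 < \<theta>\<close> by (intro joined_line) force+
          from almost_minimal[OF _ _ _ this]
          have A: "act (X n) (E n) s (s + h) \<le> k (X n) (\<theta> * h) + (\<theta> * h) * (w + \<eta>) + \<epsilon> n"
            using elim h by auto
          \<comment> \<open>The budget dominates the kinetic term of straight motion of the same
            duration, so only end points of \<open>X n\<close> remain in the kinetic part.\<close>
          have B: "k (X n) h \<le> (E n (s + h) - E n s) / 2"
            using energy_budgetD[OF budget[of n s "s + h"], of s "s + h"] h by (simp add: k_def field_simps)
          show ?case using order_trans[OF add_right_mono[OF B] A[unfolded act_def]] by simp
        qed
      qed
      have "k u h + integral {s..s + h} (\<lambda>t. U (u t + 0))
        \<le> k u (\<theta> * h) + (\<theta> * h) * (w + \<eta>) + 0"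
        by (rule tendsto_le[OF sequentially_bot lim2 lim1 ev])
      then show ?thesis using low by (simp add: k_def)
    qed
    define q where "q h = (norm ((1 / h) *\<^sub>R (u (s + h) - u s)))\<^sup>2 / 2" for h
    have "(\<lambda>h. norm ((1 / h) *\<^sub>R (u (s + h) - u s) - v)) \<midarrow>0\<rightarrow> 0"
    proof (rule LIM_equal[THEN iffD1, rule_format])
      show "(\<lambda>h. norm (u (s + h) - u s - h *\<^sub>R v) / norm h) \<midarrow>0\<rightarrow> 0"
        using dv by (simp add: has_vector_derivative_def has_derivative_at)
      fix h :: real assume "h \<noteq> 0"
      then have "(1 / h) *\<^sub>R (u (s + h) - u s) - v = (1 / h) *\<^sub>R (u (s + h) - u s - h *\<^sub>R v)"
        by (simp add: scaleR_diff_right)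
      then show "norm (u (s + h) - u s - h *\<^sub>R v) / norm h = norm ((1 / h) *\<^sub>R (u (s + h) - u s) - v)" by simp
    qed
    from LIM_zero_cancel[OF tendsto_norm_zero_cancel[OF this]]
    have "((\<lambda>h. (1 / h) *\<^sub>R (u (s + h) - u s)) \<longlongrightarrow> v) (at_right 0)"
      by (rule tendsto_within_subset) auto
    then have q: "(q \<longlongrightarrow> a) (at_right 0)"
      unfolding q_def[abs_def] a_def by (intro tendsto_intros) auto
    have h0': "\<forall>\<^sub>F h in at_right 0. h < h0"
      by (rule eventually_at_rightI[OF _ \<open>0 < h0\<close>]) auto
    have "\<forall>\<^sub>F h in at_right 0. q h * (1 - 1 / \<theta>) + w - \<eta> \<le> \<theta> * (w + \<eta>)"
      using eventually_at_right_less[of 0] h0'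
    proof eventually_elim
      case (elim h)
      have qh: "(norm (u (s + h) - u s))\<^sup>2 = 2 * q h * h\<^sup>2"
        using elim by (simp add: q_def power_mult_distrib power_divide)
      have "2 * q h * h\<^sup>2 / (2 * h) + h * (w - \<eta>) \<le> 2 * q h * h\<^sup>2 / (2 * (\<theta> * h)) + (\<theta> * h) * (w + \<eta>)"
        using ineq[of h] elim unfolding qh by auto
      then have "h * (q h + (w - \<eta>)) \<le> h * (q h / \<theta> + \<theta> * (w + \<eta>))"
        using elim \<open>0 < \<theta>\<close> by (simp add: power2_eq_square field_simps)
      then have "q h + (w - \<eta>) \<le> q h / \<theta> + \<theta> * (w + \<eta>)"
        using elim by (simp only: mult_le_cancel_left_pos)
      moreover have "q h * (1 - 1 / \<theta>) = q h - q h / \<theta>" by (simp add: right_diff_distrib)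
      ultimately show ?case by linarith
    qed
    then show ?thesis
      by (intro tendsto_upperbound[of "\<lambda>h. q h * (1 - 1 / \<theta>) + w - \<eta>" _ "at_right 0"] tendsto_intros q) auto
  qed
  have main': "a * (1 - 1 / \<theta>) + w \<le> \<theta> * w" if "0 < \<theta>" for \<theta> :: real
  proof (rule field_le_epsilon)
    fix e :: real assume "0 < e"
    define \<eta> where "\<eta> = e / (1 + \<theta>)"
    have \<eta>: "0 < \<eta>" "(1 + \<theta>) * \<eta> = e" using \<open>0 < e\<close> \<open>0 < \<theta>\<close> by (simp_all add: \<eta>_def)
    have "a * (1 - 1 / \<theta>) + w \<le> \<theta> * w + (1 + \<theta>) * \<eta>"
      using main[OF \<open>0 < \<theta>\<close> \<eta>(1)] by (simp add: algebra_simps)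
    then show "a * (1 - 1 / \<theta>) + w \<le> \<theta> * w + e" using \<eta> by simp
  qed
  have prod: "(\<theta> - 1) * (a - \<theta> * w) \<le> 0" if "0 < \<theta>" for \<theta> :: real
    using main'[OF that] that by (simp add: field_simps)
  have "0 < w" "0 \<le> a" using U_pos[OF s] by (auto simp: w_def a_def)
  \<comment> \<open>With \<theta> halfway between 1 and \<open>a / w\<close>, the product in
    \<open>prod\<close> is the square of \<open>a - w\<close> divided by \<open>4 * w\<close>, which
    forces \<open>a = w\<close>.\<close>
  have "(a - w)\<^sup>2 = ((a + w) / (2 * w) - 1) * (a - (a + w) / (2 * w) * w) * (4 * w)"
    using \<open>0 < w\<close> by (simp add: field_simps power2_eq_square)
  also have "\<dots> \<le> 0 * (4 * w)"
    using \<open>0 < w\<close> \<open>0 \<le> a\<close> by (intro mult_right_mono prod) (auto intro!: divide_pos_pos add_nonneg_pos)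
  finally have "a = w" by simp
  then show ?thesis by (simp add: a_def w_def)
qed

lemma hat_has_integral: "0 < L \<Longrightarrow> (hat c L has_integral L) {c - L..c + L}"
proof -
  assume "0 < L"
  have "((\<lambda>t. (1 - \<bar>t - c\<bar> / L) *\<^sub>R (1::real)) has_integral
    (1 / L) *\<^sub>R ((c + L)\<^sup>2 / 2 - 2 *\<^sub>R (c\<^sup>2 / 2) + (c - L)\<^sup>2 / 2)) {c - L..c + L}"
    by (rule hat_integral_second_difference[OF \<open>0 < L\<close>, of c "\<lambda>t. t" "\<lambda>_. 1" "\<lambda>t. t\<^sup>2 / 2"])
      (auto simp: has_real_derivative_iff_has_vector_derivative[symmetric] intro!: derivative_eq_intros)
  moreover have "(1 / L) *\<^sub>R ((c + L)\<^sup>2 / 2 - 2 *\<^sub>R (c\<^sup>2 / 2) + (c - L)\<^sup>2 / 2) = L"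
    using \<open>0 < L\<close> by (simp add: field_simps power2_eq_square)
  ultimately show ?thesis by (simp add: hat_def[abs_def])
qed

text \<open>The second variation along a hat of height \<open>s\<close> and half-width \<open>L\<close> is at most
  \<open>s\<^sup>2 / L - \<mu> s\<^sup>2 L / 2\<close>.\<close>

lemma no_wide_window_near_concave_direction:
  assumes concave: "\<And>x h. x \<in> ball p r \<Longrightarrow> 0 \<le> h \<Longrightarrow> h \<le> r \<Longrightarrow> U (x + h *\<^sub>R d) \<le> U x + h * inner (g x) d - \<mu> * h\<^sup>2"
    and "0 < r" "0 < \<mu>" "norm d = 1" and L: "0 < L" and wide: "2 < \<mu> * L\<^sup>2"
    and in\<Omega>: "u ` {c - L..c + L} \<subseteq> \<Omega>" and near: "u ` {c - L..c + L} \<subseteq> ball p r"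
  shows False
proof -
  obtain \<rho> where \<rho>: "0 < \<rho>" and V: "\<And>w. norm w \<le> \<rho> \<Longrightarrow> 0 \<le> hat_gain c L w"
    using hat_variation[OF L in\<Omega>] by blast
  \<comment> \<open>The height must be admissible for the variation and must stay in the range of
    \<open>concave\<close>.\<close>
  define s where "s = min \<rho> r"
  have s: "0 < s" "s \<le> \<rho>" "s \<le> r" using \<rho> \<open>0 < r\<close> by (auto simp: s_def)
  define w where "w = s *\<^sub>R d"
  have nw: "norm w = s" using s \<open>norm d = 1\<close> by (simp add: w_def)
  note cw = hat_perturbation_continuous[OF L, of _ c w] and contg = hat_grad_continuous[OF L, of _ c]
  define J where "J = integral {c - L..c + L} (\<lambda>t. hat c L t *\<^sub>R g (u t))"
  have i1: "((\<lambda>t. U (u t)) has_integral integral {c - L..c + L} (\<lambda>t. U (u t))) {c - L..c + L}"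
    by (intro integrable_integral U_comp_int u_continuous)
  have i2: "((\<lambda>t. inner w (hat c L t *\<^sub>R g (u t))) has_integral inner w J) {c - L..c + L}"
    using has_integral_linear[OF integrable_integral[OF integrable_continuous_interval[OF contg]] bounded_linear_inner_right[of w]]
    by (simp add: o_def J_def)
  \<comment> \<open>The square of a number is at least the number minus 1/4. This trades the
    integral of the squared hat for that of the hat, at the price of \<open>L / 2\<close> in place
    of \<open>2 * L / 3\<close>.\<close>
  have i3: "((\<lambda>t. \<mu> * s\<^sup>2 * (hat c L t - 1 / 4)) has_integral \<mu> * s\<^sup>2 * (L - (1 / 4) * (2 * L))) {c - L..c + L}"
    using has_integral_const_real[of "1 / 4 :: real" "c - L" "c + L"] L
    by (intro has_integral_mult_right has_integral_diff hat_has_integral) (auto simp: mult.commute)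
  have "integral {c - L..c + L} (\<lambda>t. U (u t + hat c L t *\<^sub>R w))
     \<le> integral {c - L..c + L} (\<lambda>t. U (u t)) + inner w J - \<mu> * s\<^sup>2 * (L - (1 / 4) * (2 * L))"
  proof (rule has_integral_le[OF integrable_integral[OF U_comp_int[OF cw]] has_integral_diff[OF has_integral_add[OF i1 i2] i3]])
    fix t assume t: "t \<in> {c - L..c + L}"
    let ?h = "hat c L t * s"
    have h: "0 \<le> hat c L t" "hat c L t \<le> 1" using hat_bounds[OF L, where t = t and c = c] t by auto
    then have "?h \<le> 1 * r" using s by (intro mult_mono) auto
    then have "U (u t + ?h *\<^sub>R d) \<le> U (u t) + ?h * inner (g (u t)) d - \<mu> * ?h\<^sup>2"
      using subsetD[OF near imageI[OF t]] h s by (intro concave) auto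
    moreover have "\<mu> * s\<^sup>2 * (hat c L t - 1 / 4) \<le> \<mu> * s\<^sup>2 * (hat c L t)\<^sup>2"
      using \<open>0 < \<mu>\<close> zero_le_power2[of "hat c L t - 1 / 2"]
      by (intro mult_left_mono) (auto simp: power2_eq_square algebra_simps)
    ultimately show "U (u t + hat c L t *\<^sub>R w)
      \<le> U (u t) + inner w (hat c L t *\<^sub>R g (u t)) - \<mu> * s\<^sup>2 * (hat c L t - 1 / 4)"
      by (simp add: w_def inner_commute power_mult_distrib mult_ac)
  qed
  \<comment> \<open>The terms linear in \<open>w\<close> vanish by the Euler-Lagrange equation; what
    remains is quadratic in \<open>s\<close>.\<close>
  moreover have "inner w (2 *\<^sub>R u c - u (c - L) - u (c + L)) / L + inner w J = 0"
    using arg_cong[OF euler_lagrange[OF L in\<Omega>], of "inner w"] unfolding J_def[symmetric]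
    by (simp only: inner_add_right inner_scaleR_right inner_zero_right) simp
  ultimately have "0 \<le> s\<^sup>2 / L - \<mu> * s\<^sup>2 * (L - (1 / 4) * (2 * L))"
    using V[of w] s(2) unfolding nw hat_gain_def by linarith
  then have "s\<^sup>2 * (\<mu> * L\<^sup>2) \<le> s\<^sup>2 * 2" using L by (simp add: field_simps power2_eq_square)
  then show False using s wide by simp
qed

end

section \<open>Behaviour at the ends\<close>

context smooth_potential
begin

text \<open>At a critical end point \<open>U\<close> is bounded by a multiple of the squared
  distance, so zero energy bounds the speed by a multiple of the distance. The distance then decays
  at most exponentially and cannot vanish in finite time.\<close>

lemma finite_end:
  assumes "0 < b" and contu: "continuous_on UNIV u" and bd: "\<And>t. norm (u t) \<le> R"
    and in\<Omega>: "\<And>t. 0 \<le> t \<Longrightarrow> t < b \<Longrightarrow> u t \<in> \<Omega>"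
    and du: "\<And>t. 0 \<le> t \<Longrightarrow> t < b \<Longrightarrow> (u has_vector_derivative v t) (at t)"
    and en: "\<And>t. 0 \<le> t \<Longrightarrow> t < b \<Longrightarrow> (norm (v t))\<^sup>2 / 2 = U (u t)"
    and end_out: "u b \<notin> \<Omega>" and U0: "U (u b) = 0"
  shows "(v \<longlongrightarrow> 0) (at_left b)" "g (u b) \<noteq> 0"
proof -
  have ev: "\<forall>\<^sub>F t in at_left b. 0 \<le> t \<and> t < b"
    by (rule eventually_at_leftI[OF _ \<open>0 < b\<close>]) auto
  have ub: "(u \<longlongrightarrow> u b) (at_left b)"
    using contu by (auto simp: continuous_on_eq_continuous_at isCont_def intro: tendsto_within_subset)
  have "((\<lambda>t. U (u t)) \<longlongrightarrow> U (u b)) (at_left b)"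
    using cont_U by (intro isCont_tendsto_compose[of _ U] ub) (auto simp: continuous_on_eq_continuous_at)
  then have "((\<lambda>t. sqrt (2 * U (u t))) \<longlongrightarrow> sqrt (2 * U (u b))) (at_left b)" by (intro tendsto_intros)
  moreover have "\<forall>\<^sub>F t in at_left b. sqrt (2 * U (u t)) = norm (v t)"
    using ev
  proof eventually_elim
    case (elim t)
    then have "2 * U (u t) = (norm (v t))\<^sup>2" using en[of t] by simp
    then show ?case by simp
  qed
  ultimately have "((\<lambda>t. norm (v t)) \<longlongrightarrow> sqrt (2 * U (u b))) (at_left b)"
    by (rule Lim_transform_eventually)
  then show "(v \<longlongrightarrow> 0) (at_left b)" using U0 by (simp add: tendsto_norm_zero_iff)
  show "g (u b) \<noteq> 0"
  proof
    assume g0: "g (u b) = 0"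
    define x where "x = u b"
    obtain K where "0 \<le> K" and K: "\<And>x y. x \<in> cball 0 R \<Longrightarrow> y \<in> cball 0 R \<Longrightarrow>
      \<bar>U y - U x - inner (g x) (y - x)\<bar> \<le> K * (norm (y - x))\<^sup>2"
      using U_taylor[of R] by blast
    \<comment> \<open>The squared speed is \<open>2 * U (u t)\<close>, and \<open>U (u t)\<close> is
      at most \<open>K\<close> times the squared distance to \<open>x\<close>.\<close>
    define k where "k = sqrt (2 * K)"
    define z where "z t = inner (u t - x) (u t - x)" for t
    \<comment> \<open>The exponential compensates the fastest possible decay of \<open>z\<close>, so
      \<open>y\<close> is nondecreasing, although it tends to 0 at \<open>b\<close>.\<close>
    define y where "y t = z t * exp (2 * k * t)" for t
    have nv: "norm (v t) \<le> k * norm (u t - x)" if t: "0 \<le> t" "t < b" for t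
    proof -
      have "U (u t) \<le> K * (norm (u t - x))\<^sup>2"
        using K[of x "u t"] bd[of t] bd[of b] U0 g0 by (auto simp: x_def)
      then have "(norm (v t))\<^sup>2 \<le> (k * norm (u t - x))\<^sup>2"
        using en[OF t] \<open>0 \<le> K\<close> by (simp add: power_mult_distrib k_def)
      then show ?thesis using \<open>0 \<le> K\<close> by (elim power2_le_imp_le) (simp add: k_def)
    qed
    have dz: "(z has_real_derivative 2 * inner (u t - x) (v t)) (at t)" if t: "0 \<le> t" "t < b" for t
    proof -
      have "((\<lambda>t. u t - x) has_derivative (\<lambda>h. h *\<^sub>R v t)) (at t)"
        using du[OF t] by (auto simp: has_vector_derivative_def intro!: derivative_eq_intros)
      from has_derivative_inner[OF this this] show ?thesis
        unfolding z_def[abs_def] has_field_derivative_def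
        by (rule has_derivative_eq_rhs) (auto simp: inner_commute algebra_simps)
    qed
    have mono: "y 0 \<le> y t" if t: "0 \<le> t" "t < b" for t
    proof (rule DERIV_nonneg_imp_nondecreasing[OF t(1)])
      fix s assume s: "0 \<le> s" "s \<le> t"
      then have s': "0 \<le> s" "s < b" using t by auto
      have "(y has_real_derivative (2 * inner (u s - x) (v s)) * exp (2 * k * s) + z s * (exp (2 * k * s) * (2 * k))) (at s)"
        unfolding y_def[abs_def] by (auto intro!: derivative_eq_intros dz s')
      moreover have "0 \<le> (2 * inner (u s - x) (v s)) * exp (2 * k * s) + z s * (exp (2 * k * s) * (2 * k))"
      proof -
        have "- inner (u s - x) (v s) \<le> norm (u s - x) * norm (v s)"
          using Cauchy_Schwarz_ineq2[of "u s - x" "v s"] by (simp add: abs_le_iff)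
        also have "\<dots> \<le> norm (u s - x) * (k * norm (u s - x))" by (intro mult_left_mono nv s') auto
        also have "\<dots> = k * z s" by (simp add: z_def power2_norm_eq_inner[symmetric] power2_eq_square)
        finally have "0 \<le> (2 * (inner (u s - x) (v s) + k * z s)) * exp (2 * k * s)" by simp
        then show ?thesis by (simp add: algebra_simps)
      qed
      ultimately show "\<exists>y'. (y has_real_derivative y') (at s) \<and> 0 \<le> y'" by blast
    qed
    have "(y \<longlongrightarrow> inner (u b - x) (u b - x) * exp (2 * k * b)) (at_left b)"
      unfolding y_def[abs_def] z_def[abs_def] by (intro tendsto_intros ub)
    moreover have "\<forall>\<^sub>F t in at_left b. y 0 \<le> y t" using ev by eventually_elim (auto intro: mono)
    ultimately have "y 0 \<le> inner (u b - x) (u b - x) * exp (2 * k * b)"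
      by (rule tendsto_lowerbound) simp
    then have "inner (u 0 - x) (u 0 - x) \<le> 0" by (simp add: y_def z_def x_def)
    then have "inner (u 0 - x) (u 0 - x) = 0" using inner_ge_zero[of "u 0 - x"] by linarith
    then have "u 0 = u b" by (simp add: x_def)
    then show False using in\<Omega>[of 0] end_out \<open>0 < b\<close> by auto
  qed
qed

end

text \<open>A bounded curve with finitely many cluster points cannot keep returning to two of them:
  by continuity it would cross a separating sphere at arbitrarily late times and so have a cluster
  point on that sphere.\<close>

lemma tendsto_finite_cluster_set:
  fixes u :: "real \<Rightarrow> 'a::euclidean_space"
  assumes contu: "continuous_on UNIV u" and bd: "\<And>t. norm (u t) \<le> R" and "finite P"
    and cluster: "\<And>q. (\<And>\<delta> T. 0 < \<delta> \<Longrightarrow> \<exists>t\<ge>T. dist (u t) q < \<delta>) \<Longrightarrow> q \<in> P"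
  obtains p where "p \<in> P" "(u \<longlongrightarrow> p) at_top"
proof -
  \<comment> \<open>By compactness the late visits to \<open>K\<close> accumulate, and their limit
    is a cluster point of the curve.\<close>
  have ex: "\<exists>q\<in>P. q \<in> K" if K: "closed K" "\<And>T. \<exists>t\<ge>T. u t \<in> K" for K
  proof -
    have "\<exists>t\<ge>real n. u t \<in> K" for n using K(2) by blast
    then obtain s where s: "\<And>n. real n \<le> s n" "\<And>n. u (s n) \<in> K" by metis
    have "compact (K \<inter> cball 0 R)" using K(1) by (intro closed_Int_compact) auto
    moreover have "\<forall>n. (u \<circ> s) n \<in> K \<inter> cball 0 R" using s bd by auto
    ultimately obtain q r where q: "q \<in> K \<inter> cball 0 R" "strict_mono (r::nat \<Rightarrow> nat)" "((u \<circ> s) \<circ> r) \<longlonglongrightarrow> q"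
      using compact_imp_seq_compact seq_compactE by metis
    have "q \<in> P"
    proof (rule cluster)
      fix \<delta> T :: real assume "0 < \<delta>"
      then have "\<forall>\<^sub>F n in sequentially. dist (u (s (r n))) q < \<delta>"
        using tendstoD[OF q(3)] by simp
      moreover obtain n0 where n0: "T \<le> real n0" using real_arch_simple by blast
      ultimately obtain n where n: "dist (u (s (r n))) q < \<delta>" "n0 \<le> n"
        using eventually_happens[OF eventually_conj[OF _ eventually_ge_at_top[of n0]]] by force
      have "T \<le> s (r n)" using n0 n(2) s(1)[of "r n"] seq_suble[OF q(2), of n] by linarith
      then show "\<exists>t\<ge>T. dist (u t) q < \<delta>" using n(1) by blast
    qed
    then show ?thesis using q(1) by blast
  qed
  have far: "\<exists>T. \<forall>t\<ge>T. dist (u t) p \<noteq> \<delta>'" if "0 < \<delta>'" "\<forall>q\<in>P. q \<noteq> p \<longrightarrow> \<delta>' < dist p q" for \<delta>' p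
  proof (rule ccontr)
    assume "\<nexists>T. \<forall>t\<ge>T. dist (u t) p \<noteq> \<delta>'"
    then have "\<And>T. \<exists>t\<ge>T. u t \<in> sphere p \<delta>'" by (auto simp: dist_commute)
    then obtain q where "q \<in> P" "q \<in> sphere p \<delta>'" using ex[of "sphere p \<delta>'"] by auto
    then show False using that by auto
  qed
  obtain p where p: "p \<in> P" and cl: "\<And>\<delta> T. 0 < \<delta> \<Longrightarrow> \<exists>t\<ge>T. dist (u t) p < \<delta>"
  proof (rule ccontr)
    assume "\<not> thesis"
    then have "\<forall>p\<in>P. \<exists>\<delta> T. 0 < \<delta> \<and> (\<forall>t\<ge>T. \<delta> \<le> dist (u t) p)" using that by (meson not_le_imp_less)
    then obtain \<delta> T where *: "\<And>p. p \<in> P \<Longrightarrow> 0 < \<delta> p" "\<And>p t. p \<in> P \<Longrightarrow> T p \<le> t \<Longrightarrow> \<delta> p \<le> dist (u t) p" by metis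
    \<comment> \<open>If no point of \<open>P\<close> were a cluster point, the curve would finally
      stay in this closed set, which misses \<open>P\<close>.\<close>
    define K where "K = - (\<Union>p\<in>P. ball p (\<delta> p))"
    have "closed K" unfolding K_def by (intro closed_Compl open_UN) auto
    moreover have "\<exists>t\<ge>T'. u t \<in> K" for T'
    proof (intro exI conjI)
      show "T' \<le> Max (insert T' (T ` P))" using \<open>finite P\<close> by auto
      have "T p \<le> Max (insert T' (T ` P))" if "p \<in> P" for p using \<open>finite P\<close> that by auto
      then show "u (Max (insert T' (T ` P))) \<in> K"
        unfolding K_def using *(2) by (force simp: dist_commute not_less)
    qed
    ultimately obtain q where "q \<in> P" "q \<in> K" using ex by blast
    then show False using *(1) by (auto simp: K_def)
  qed
  obtain d where d: "0 < d" "\<forall>q\<in>P. q \<noteq> p \<longrightarrow> d \<le> dist p q"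
    using finite_set_avoid[OF \<open>finite P\<close>, of p] by blast
  have "(u \<longlongrightarrow> p) at_top"
  proof (rule tendstoI)
    fix e :: real assume "0 < e"
    \<comment> \<open>At most half the distance to any other point of \<open>P\<close>, so the
      sphere of this radius around \<open>p\<close> misses \<open>P\<close>.\<close>
    define \<delta>' where "\<delta>' = min e d / 2"
    have \<delta>': "0 < \<delta>'" "\<delta>' < e" "\<forall>q\<in>P. q \<noteq> p \<longrightarrow> \<delta>' < dist p q"
      using d \<open>0 < e\<close> by (force simp: \<delta>'_def)+
    obtain T where T: "\<forall>t\<ge>T. dist (u t) p \<noteq> \<delta>'" using far[OF \<delta>'(1,3)] by blast
    obtain t0 where t0: "T \<le> t0" "dist (u t0) p < \<delta>'" using cl[OF \<delta>'(1)] by blast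
    have "dist (u t) p < e" if "t0 \<le> t" for t
    proof (rule ccontr)
      assume "\<not> dist (u t) p < e"
      then have 1: "dist (u t0) p \<le> \<delta>'" "\<delta>' \<le> dist (u t) p" using t0 \<delta>' by auto
      have 2: "continuous_on {t0..t} (\<lambda>t. dist (u t) p)"
        by (intro continuous_intros continuous_on_subset[OF contu]) auto
      have "\<exists>s\<ge>t0. s \<le> t \<and> dist (u s) p = \<delta>'" by (rule IVT'[OF 1 that 2])
      then obtain s where "t0 \<le> s" "dist (u s) p = \<delta>'" by blast
      then show False using T t0 by auto
    qed
    then show "\<forall>\<^sub>F t in at_top. dist (u t) p < e" unfolding eventually_at_top_linorder by blast
  qed
  then show ?thesis using that p by blast
qed

lemma continuous_bounded_on_cball:
  fixes f :: "'a::euclidean_space \<Rightarrow> 'b::real_normed_vector"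
  assumes "continuous_on UNIV f"
  obtains B where "0 \<le> B" "\<And>x. norm x \<le> R \<Longrightarrow> norm (f x) \<le> B"
proof -
  have "bounded (f ` cball 0 R)"
    by (intro compact_imp_bounded compact_continuous_image continuous_on_subset[OF assms]) auto
  then obtain B where B: "0 < B" "\<forall>y\<in>f ` cball 0 R. norm y \<le> B" unfolding bounded_pos by blast
  show ?thesis by (rule that[of B]) (use B in auto)
qed

lemma norm_diff_le_of_vector_derivative:
  fixes f :: "real \<Rightarrow> 'a::real_normed_vector"
  assumes "a \<le> b" and f: "\<And>x. x \<in> {a..b} \<Longrightarrow> (f has_vector_derivative f' x) (at x)"
    and K: "\<And>x. x \<in> {a..b} \<Longrightarrow> norm (f' x) \<le> K"
  shows "norm (f b - f a) \<le> K * (b - a)"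
proof -
  have "norm (f b - f a) \<le> K * norm (b - a)"
  proof (rule differentiable_bound[of "{a..b}" f "\<lambda>x h. h *\<^sub>R f' x"])
    show "(f has_derivative (\<lambda>h. h *\<^sub>R f' x)) (at x within {a..b})" if "x \<in> {a..b}" for x
      using f[OF that] by (auto simp: has_vector_derivative_def intro: has_derivative_at_withinI)
    show "onorm (\<lambda>h. h *\<^sub>R f' x) \<le> K" if "x \<in> {a..b}" for x
      using K[OF that] by (intro onorm_le) (simp add: mult.commute[of K] mult_left_mono)
  qed (use \<open>a \<le> b\<close> in auto)
  then show ?thesis using \<open>a \<le> b\<close> by simp
qed

context smooth_potential
begin

text \<open>The integral of \<open>U\<close> along the curve is finite and \<open>U\<close> falls at
  a bounded rate, so \<open>U (u t)\<close> and with it the speed tend to 0. Cluster points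
  therefore lie on the frontier, and near a cluster point \<open>q\<close> the acceleration is
  almost \<open>g q\<close>, which is compatible with vanishing speed only if
  \<open>g q = 0\<close>.\<close>

lemma infinite_end:
  assumes contu: "continuous_on UNIV u" and bd: "\<And>t. norm (u t) \<le> R"
    and in\<Omega>: "\<And>t. 0 \<le> t \<Longrightarrow> u t \<in> \<Omega>"
    and du: "\<And>t. 0 \<le> t \<Longrightarrow> (u has_vector_derivative v t) (at t)"
    and dv: "\<And>t. 0 \<le> t \<Longrightarrow> (v has_vector_derivative g (u t)) (at t)"
    and en: "\<And>t. 0 \<le> t \<Longrightarrow> (norm (v t))\<^sup>2 / 2 = U (u t)"
    and act: "\<And>\<tau>. 0 \<le> \<tau> \<Longrightarrow> integral {0..\<tau>} (\<lambda>t. U (u t)) \<le> C"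
    and "finite P" and P: "\<And>q. q \<in> frontier \<Omega> \<Longrightarrow> g q = 0 \<Longrightarrow> q \<in> P"
  shows "\<exists>p\<in>P. (u \<longlongrightarrow> p) at_top"
proof -
  obtain BU where BU: "0 \<le> BU" "\<And>x. norm x \<le> R \<Longrightarrow> norm (U x) \<le> BU"
    using continuous_bounded_on_cball[OF cont_U] by blast
  obtain G where G: "0 \<le> G" "\<And>x. norm x \<le> R \<Longrightarrow> norm (g x) \<le> G"
    using continuous_bounded_on_cball[OF grad_continuous] by blast
  \<comment> \<open>Bounds the rate of change of \<open>U\<close> along the curve: \<open>G\<close>
    bounds the gradient and \<open>sqrt (2 * BU)\<close> the speed.\<close>
  define B where "B = G * sqrt (2 * BU)"
  have "0 \<le> B" using G BU by (simp add: B_def)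
  have nv: "norm (v t) = sqrt (2 * U (u t))" if "0 \<le> t" for t
  proof -
    have "2 * U (u t) = (norm (v t))\<^sup>2" using en[OF that] by simp
    then show ?thesis by simp
  qed
  have U_lip: "U (u t) - B * (s - t) \<le> U (u s)" if ts: "0 \<le> t" "t \<le> s" for s t
  proof -
    have "U (u t) + B * t \<le> U (u s) + B * s"
    proof (rule DERIV_nonneg_imp_nondecreasing[OF ts(2)])
      fix x assume x: "t \<le> x" "x \<le> s"
      have "((\<lambda>s. U (u s)) has_derivative (\<lambda>h. inner (g (u x)) (h *\<^sub>R v x))) (at x)"
        using du[of x] x ts by (intro has_derivative_compose[OF _ dU]) (auto simp: has_vector_derivative_def)
      then have "((\<lambda>s. U (u s)) has_real_derivative inner (g (u x)) (v x)) (at x)"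
        unfolding has_field_derivative_def by (rule has_derivative_eq_rhs) auto
      then have "((\<lambda>s. U (u s) + B * s) has_real_derivative inner (g (u x)) (v x) + B) (at x)"
        by (auto intro!: derivative_eq_intros)
      moreover have "\<bar>inner (g (u x)) (v x)\<bar> \<le> B"
      proof -
        have nvx: "norm (v x) \<le> sqrt (2 * BU)" using BU(2)[OF bd[of x]] nv[of x] x ts by auto
        have "\<bar>inner (g (u x)) (v x)\<bar> \<le> norm (g (u x)) * norm (v x)" by (rule Cauchy_Schwarz_ineq2)
        also have "\<dots> \<le> G * sqrt (2 * BU)"
          using G(2)[OF bd] G(1) nvx by (intro mult_mono) auto
        finally show ?thesis by (simp add: B_def)
      qed
      ultimately show "\<exists>y. ((\<lambda>s. U (u s) + B * s) has_real_derivative y) (at x) \<and> 0 \<le> y" by (force simp: abs_le_iff)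
    qed
    then show ?thesis by (simp add: algebra_simps)
  qed
  have U0: "\<exists>T\<ge>0. \<forall>t\<ge>T. U (u t) < \<eta>" if "0 < \<eta>" for \<eta>
  proof -
    define F where "F \<tau> = integral {0..\<tau>} (\<lambda>t. U (u t))" for \<tau>
    have contu': "continuous_on S u" for S using contu continuous_on_subset by blast
    have F_diff: "F b - F a = integral {a..b} (\<lambda>t. U (u t))" if "0 \<le> a" "a \<le> b" for a b
      using Henstock_Kurzweil_Integration.integral_combine[OF that U_comp_int[OF contu']] by (simp add: F_def)
    have F_mono: "F a \<le> F b" if "0 \<le> a" "a \<le> b" for a b
    proof -
      have "0 \<le> integral {a..b} (\<lambda>t. U (u t))"
        using U_pos[OF in\<Omega>] that by (intro integral_nonneg U_comp_int contu') (auto intro: less_imp_le)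
      then show ?thesis using F_diff[OF that] by simp
    qed
    \<comment> \<open>If \<open>U (u t)\<close> reaches \<open>\<eta>\<close>, it stays at least
      \<open>\<eta> / 2\<close> for time \<open>\<delta>\<close>, which contributes
      \<open>\<delta> * (\<eta> / 2)\<close> to the integral; beyond \<open>T\<close> less than that
      is left.\<close>
    define \<delta> where "\<delta> = \<eta> / (2 * (B + 1))"
    have \<delta>: "0 < \<delta>" "B * \<delta> \<le> \<eta> / 2" using \<open>0 < \<eta>\<close> \<open>0 \<le> B\<close> by (auto simp: \<delta>_def field_simps)
    have bdd: "bdd_above (F ` {0..})" using act by (auto simp: F_def bdd_above_def)
    have "Sup (F ` {0..}) - \<delta> * (\<eta> / 2) < Sup (F ` {0..})" using \<delta> \<open>0 < \<eta>\<close> by simp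
    then have "\<exists>y\<in>F ` {0..}. Sup (F ` {0..}) - \<delta> * (\<eta> / 2) < y" by (intro less_cSupD) auto
    then obtain T where T: "0 \<le> T" "Sup (F ` {0..}) - \<delta> * (\<eta> / 2) < F T" by auto
    have "U (u t) < \<eta>" if "T \<le> t" for t
    proof (rule ccontr)
      assume "\<not> U (u t) < \<eta>"
      have "integral {t..t + \<delta>} (\<lambda>_. \<eta> / 2) \<le> integral {t..t + \<delta>} (\<lambda>t. U (u t))"
      proof (intro integral_le U_comp_int contu')
        fix s assume s: "s \<in> {t..t + \<delta>}"
        have "U (u t) - B * (s - t) \<le> U (u s)" using s T that by (intro U_lip) auto
        moreover have "B * (s - t) \<le> B * \<delta>" using s \<open>0 \<le> B\<close> by (intro mult_left_mono) auto
        ultimately show "\<eta> / 2 \<le> U (u s)" using \<delta> \<open>\<not> U (u t) < \<eta>\<close> by linarith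
      qed auto
      then have "\<delta> * (\<eta> / 2) \<le> F (t + \<delta>) - F t" using F_diff[of t "t + \<delta>"] T that \<delta> by simp
      moreover have "F (t + \<delta>) \<le> Sup (F ` {0..})" using T that \<delta> by (intro cSup_upper bdd) auto
      moreover have "F T \<le> F t" using F_mono T that by auto
      ultimately show False using T by linarith
    qed
    then show ?thesis using T by blast
  qed
  have v0: "\<exists>T\<ge>0. \<forall>t\<ge>T. norm (v t) < \<epsilon>" if "0 < \<epsilon>" for \<epsilon>
  proof -
    obtain T where T: "0 \<le> T" "\<forall>t\<ge>T. U (u t) < \<epsilon>\<^sup>2 / 2" using U0[of "\<epsilon>\<^sup>2 / 2"] \<open>0 < \<epsilon>\<close> by auto
    have "norm (v t) < \<epsilon>" if "T \<le> t" for t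
      by (rule power2_less_imp_less) (use en[of t] T that \<open>0 < \<epsilon>\<close> in auto)
    then show ?thesis using T by blast
  qed
  have cluster: "q \<in> P" if cl: "\<And>\<delta> T. 0 < \<delta> \<Longrightarrow> \<exists>t\<ge>T. dist (u t) q < \<delta>" for q
  proof (rule P)
    have "q \<in> closure \<Omega>" unfolding closure_approachable
    proof (intro allI impI)
      fix e :: real assume "0 < e"
      then obtain t where "0 \<le> t" "dist (u t) q < e" using cl by blast
      then show "\<exists>y\<in>\<Omega>. dist y q < e" using in\<Omega> by blast
    qed
    moreover have "U q \<le> 0"
    proof (rule field_le_epsilon)
      fix e :: real assume "0 < e"
      then have "0 < e / 2" by simp
      obtain d where d: "0 < d" "\<And>x. dist x q < d \<Longrightarrow> dist (U x) (U q) < e / 2"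
        using cont_U \<open>0 < e / 2\<close> unfolding continuous_on_iff by (metis UNIV_I)
      obtain T where T: "\<forall>t\<ge>T. U (u t) < e / 2" using U0[OF \<open>0 < e / 2\<close>] by blast
      obtain t where t: "T \<le> t" "dist (u t) q < d" using cl d(1) by blast
      have "dist (U (u t)) (U q) < e / 2" "U (u t) < e / 2" using d t T by auto
      then show "U q \<le> 0 + e" by (simp add: dist_real_def abs_if split: if_splits)
    qed
    then have "q \<notin> \<Omega>" using U_pos[of q] by auto
    ultimately show "q \<in> frontier \<Omega>" using open_Omega by (simp add: frontier_def interior_open)
    have "norm (g q) \<le> 0"
    proof (rule field_le_epsilon)
      fix e :: real assume "0 < e"
      define \<epsilon> where "\<epsilon> = e / 3"
      have "0 < \<epsilon>" using \<open>0 < e\<close> by (simp add: \<epsilon>_def)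
      obtain d where d: "0 < d" "\<And>x. dist x q < d \<Longrightarrow> dist (g x) (g q) < \<epsilon>"
        using grad_continuous[of UNIV] \<open>0 < \<epsilon>\<close> unfolding continuous_on_iff by (metis UNIV_I)
      obtain T where T: "0 \<le> T" "\<forall>t\<ge>T. norm (v t) < min \<epsilon> (d / 2)" using v0[of "min \<epsilon> (d / 2)"] \<open>0 < \<epsilon>\<close> d by auto
      obtain t where t: "T \<le> t" "dist (u t) q < d / 2" using cl[of "d / 2" T] d(1) by auto
      have near: "dist (u s) q < d" if s: "s \<in> {t..t + 1}" for s
      proof -
        have "norm (u s - u t) \<le> d / 2 * (s - t)"
          using s T t by (intro norm_diff_le_of_vector_derivative[OF _ du]) (auto intro: less_imp_le)
        also have "\<dots> \<le> d / 2 * 1" using s d by (intro mult_left_mono) auto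
        finally have "dist (u s) (u t) \<le> d / 2" by (simp add: dist_norm)
        then show ?thesis using t dist_triangle[of "u s" q "u t"] by simp
      qed
      \<comment> \<open>Over one unit of time the velocity changes by almost \<open>g q\<close>,
        while both of its end values are smaller than \<open>\<epsilon>\<close>.\<close>
      have "norm ((v (t + 1) - (t + 1) *\<^sub>R g q) - (v t - t *\<^sub>R g q)) \<le> \<epsilon> * (t + 1 - t)"
      proof (rule norm_diff_le_of_vector_derivative)
        fix x assume x: "x \<in> {t..t + 1}"
        have "((\<lambda>x. v x - x *\<^sub>R g q) has_vector_derivative g (u x) - (x *\<^sub>R 0 + 1 *\<^sub>R g q)) (at x)"
          using dv[of x] t T x
          by (intro has_vector_derivative_diff has_vector_derivative_scaleR has_vector_derivative_const DERIV_ident) auto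
        then show "((\<lambda>x. v x - x *\<^sub>R g q) has_vector_derivative g (u x) - g q) (at x)" by simp
        show "norm (g (u x) - g q) \<le> \<epsilon>" using d(2)[OF near[OF x]] by (auto simp: dist_norm)
      qed simp
      then have "norm (v (t + 1) - v t - g q) \<le> \<epsilon>" by (simp add: algebra_simps)
      moreover have "norm (v (t + 1)) < \<epsilon>" "norm (v t) < \<epsilon>" using T t by auto
      moreover have "norm (g q) \<le> norm (v (t + 1)) + norm (v t) + norm (v (t + 1) - v t - g q)"
        using norm_triangle_ineq4[of "v (t + 1) - v t" "v (t + 1) - v t - g q"] norm_triangle_ineq4[of "v (t + 1)" "v t"]
        by simp
      ultimately show "norm (g q) \<le> 0 + e" by (simp add: \<epsilon>_def)
    qed
    then show "g q = 0" by simp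
  qed
  show ?thesis
    using tendsto_finite_cluster_set[OF contu bd \<open>finite P\<close> cluster] by blast
qed

section \<open>Second derivatives of the potential\<close>

definition second_difference :: "'a \<Rightarrow> real \<Rightarrow> 'a \<Rightarrow> 'a \<Rightarrow> real" where
  "second_difference p s x y = U (p + s *\<^sub>R x + s *\<^sub>R y) - U (p + s *\<^sub>R x) - U (p + s *\<^sub>R y) + U p"

text \<open>The mean value theorem in the direction \<open>y\<close> reduces the second difference
  to a difference of two gradients, and both are expanded at \<open>p\<close>, the one point where
  \<open>g\<close> is differentiated.\<close>

lemma second_difference_estimate:
  assumes H: "(g has_derivative H) (at p)" and "0 < \<epsilon>"
  shows "\<exists>s0>0. \<forall>s. 0 < s \<longrightarrow> s < s0 \<longrightarrow>
    \<bar>second_difference p s x y - s\<^sup>2 * inner (H x) y\<bar>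
      \<le> 2 * \<epsilon> * (norm x + norm y) * norm y * s\<^sup>2"
proof -
  interpret H: bounded_linear H using H by (rule has_derivative_bounded_linear)
  obtain d where d: "0 < d" "\<And>z. norm (z - p) < d \<Longrightarrow> norm (g z - g p - H (z - p)) \<le> \<epsilon> * norm (z - p)"
    using H[unfolded has_derivative_at_alt, THEN conjunct2, rule_format, OF \<open>0 < \<epsilon>\<close>] by blast
  define N where "N = norm x + norm y"
  show ?thesis
  proof (intro exI[of _ "d / (N + 1)"] conjI allI impI)
    have "0 \<le> N" by (simp add: N_def)
    then show "0 < d / (N + 1)" using d by simp
    fix s :: real assume s: "0 < s" "s < d / (N + 1)"
    have "s * (N + 1) < d" using s \<open>0 \<le> N\<close> by (simp add: field_simps)
    then have sN: "s * N < d" using s by (simp add: distrib_left)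
    define \<phi> where "\<phi> \<tau> = U (p + s *\<^sub>R x + \<tau> *\<^sub>R (s *\<^sub>R y)) - U (p + \<tau> *\<^sub>R (s *\<^sub>R y))" for \<tau>
    have "\<exists>\<theta>::real. 0 < \<theta> \<and> \<theta> < 1 \<and> \<phi> 1 - \<phi> 0 = (1 - 0) *
        (inner (g (p + s *\<^sub>R x + \<theta> *\<^sub>R (s *\<^sub>R y))) (s *\<^sub>R y) - inner (g (p + \<theta> *\<^sub>R (s *\<^sub>R y))) (s *\<^sub>R y))"
      unfolding \<phi>_def by (rule MVT2, rule zero_less_one, rule DERIV_diff; rule U_line_deriv)
    then obtain \<theta> where \<theta>: "0 < \<theta>" "\<theta> < 1" and eq: "\<phi> 1 - \<phi> 0 =
        inner (g (p + s *\<^sub>R x + \<theta> *\<^sub>R (s *\<^sub>R y)) - g (p + \<theta> *\<^sub>R (s *\<^sub>R y))) (s *\<^sub>R y)"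
      unfolding inner_diff_left by fastforce
    define a where "a = s *\<^sub>R x + \<theta> *\<^sub>R (s *\<^sub>R y)"
    define b where "b = \<theta> *\<^sub>R (s *\<^sub>R y)"
    have nb: "norm b \<le> s * norm y" using \<theta> s by (simp add: b_def mult_left_le_one_le)
    have ab: "a = s *\<^sub>R x + b" by (simp add: a_def b_def)
    have na: "norm a \<le> s * N"
      using norm_triangle_ineq[of "s *\<^sub>R x" b] nb s by (simp add: ab N_def distrib_left)
    have nb': "norm b \<le> s * N" 
    proof -
      have "0 \<le> s * norm x" using s by simp
      then show ?thesis using nb unfolding N_def distrib_left by linarith
    qed
    define ra where "ra = g (p + a) - g p - H a"
    define rb where "rb = g (p + b) - g p - H b"
    have "norm ra \<le> \<epsilon> * norm a" "norm rb \<le> \<epsilon> * norm b"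
      using d(2)[of "p + a"] d(2)[of "p + b"] na nb' sN by (auto simp: ra_def rb_def)
    moreover have "\<epsilon> * norm a \<le> \<epsilon> * (s * N)" "\<epsilon> * norm b \<le> \<epsilon> * (s * N)"
      using na nb' \<open>0 < \<epsilon>\<close> by auto
    ultimately have r: "norm (ra - rb) \<le> 2 * (\<epsilon> * (s * N))"
      using norm_triangle_ineq4[of ra rb] by linarith
    have "g (p + a) - g (p + b) = s *\<^sub>R H x + (ra - rb)"
      by (simp add: ra_def rb_def a_def b_def H.add H.scaleR)
    moreover have "\<phi> 1 - \<phi> 0 = inner (g (p + a) - g (p + b)) (s *\<^sub>R y)"
      unfolding eq a_def b_def add.assoc ..
    ultimately have "\<phi> 1 - \<phi> 0 - s\<^sup>2 * inner (H x) y = inner (ra - rb) (s *\<^sub>R y)"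
      by (simp add: inner_add_left power2_eq_square distrib_left mult.assoc)
    also have "\<bar>\<dots>\<bar> \<le> norm (ra - rb) * norm (s *\<^sub>R y)" by (rule Cauchy_Schwarz_ineq2)
    also have "\<dots> \<le> 2 * (\<epsilon> * (s * N)) * (s * norm y)"
      using mult_right_mono[OF r, of "s * norm y"] s by simp
    also have "\<dots> = 2 * \<epsilon> * N * norm y * s\<^sup>2" by (simp add: power2_eq_square)
    finally show "\<bar>second_difference p s x y - s\<^sup>2 * inner (H x) y\<bar>
      \<le> 2 * \<epsilon> * (norm x + norm y) * norm y * s\<^sup>2"
      by (simp add: \<phi>_def N_def second_difference_def algebra_simps)
  qed
qed

text \<open>Exchanging \<open>x\<close> and \<open>y\<close> leaves the second difference unchanged,
  so both values of the form are approximated by the same quotient.\<close>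

lemma hessian_symmetric:
  assumes H: "(g has_derivative H) (at p)"
  shows "inner (H x) y = inner (H y) x"
proof -
  define N where "N = norm x + norm y"
  have "\<bar>inner (H x) y - inner (H y) x\<bar> \<le> 0"
  proof (rule field_le_epsilon)
    fix e :: real assume "0 < e"
    \<comment> \<open>The errors of the two orders add up to \<open>\<epsilon> * (2 * N * N)\<close>
      after division by the square of \<open>s\<close>; the summand 1 keeps the denominator
      positive.\<close>
    define \<epsilon> where "\<epsilon> = e / (2 * N * N + 1)"
    have "0 < 2 * N * N + 1" by (simp add: add_nonneg_pos)
    then have \<epsilon>: "0 < \<epsilon>" "\<epsilon> * (2 * N * N + 1) = e" using \<open>0 < e\<close> by (auto simp: \<epsilon>_def)
    obtain s1 where s1: "0 < s1" "\<forall>s. 0 < s \<longrightarrow> s < s1 \<longrightarrow>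
      \<bar>second_difference p s x y - s\<^sup>2 * inner (H x) y\<bar>
      \<le> 2 * \<epsilon> * (norm x + norm y) * norm y * s\<^sup>2"
      using second_difference_estimate[OF H \<epsilon>(1), of x y] by blast
    obtain s2 where s2: "0 < s2" "\<forall>s. 0 < s \<longrightarrow> s < s2 \<longrightarrow>
      \<bar>second_difference p s y x - s\<^sup>2 * inner (H y) x\<bar>
      \<le> 2 * \<epsilon> * (norm y + norm x) * norm x * s\<^sup>2"
      using second_difference_estimate[OF H \<epsilon>(1), of y x] by blast
    define s where "s = min s1 s2 / 2"
    have s: "0 < s" "s < s1" "s < s2" using s1(1) s2(1) by (auto simp: s_def)
    define D where "D = second_difference p s x y"
    have 1: "\<bar>D - s\<^sup>2 * inner (H x) y\<bar> \<le> 2 * \<epsilon> * N * norm y * s\<^sup>2"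
      using s1(2)[rule_format, OF s(1,2)] by (simp add: D_def N_def)
    have "second_difference p s y x = D" by (simp add: D_def second_difference_def algebra_simps)
    then have 2: "\<bar>D - s\<^sup>2 * inner (H y) x\<bar> \<le> 2 * \<epsilon> * N * norm x * s\<^sup>2"
      using s2(2)[rule_format, OF s(1,3)] by (simp add: N_def add.commute)
    have "s\<^sup>2 * \<bar>inner (H x) y - inner (H y) x\<bar> = \<bar>s\<^sup>2 * inner (H x) y - s\<^sup>2 * inner (H y) x\<bar>"
      by (simp add: right_diff_distrib[symmetric] abs_mult)
    also have "\<dots> \<le> 2 * \<epsilon> * N * norm y * s\<^sup>2 + 2 * \<epsilon> * N * norm x * s\<^sup>2" using 1 2 by linarith
    also have "\<dots> = s\<^sup>2 * (\<epsilon> * (2 * N * N))" by (simp add: N_def algebra_simps)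
    finally have "\<bar>inner (H x) y - inner (H y) x\<bar> \<le> \<epsilon> * (2 * N * N)"
      using s by (simp only: mult_le_cancel_left_pos zero_less_power)
    also have "\<dots> \<le> e" using \<epsilon> by (simp add: distrib_left)
    finally show "\<bar>inner (H x) y - inner (H y) x\<bar> \<le> 0 + e" by simp
  qed
  then show ?thesis by simp
qed

text \<open>Semidefinite and injective means definite: a unit vector \<open>e\<close> on which the
  form vanishes minimises it, and by symmetry of \<open>H\<close> the first-order condition gives
  \<open>H e = 0\<close>. Definiteness then makes the radial derivative of \<open>U\<close> positive
  near \<open>p\<close>.\<close>

lemma isolated_zero_of_semidefinite:
  assumes H: "(g has_derivative H) (at p)" and "g p = 0" "U p = 0"
    and inj: "\<And>x. H x = 0 \<Longrightarrow> x = 0" and psd: "\<And>x. 0 \<le> inner (H x) x"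
  obtains r where "0 < r" "\<And>x. x \<in> ball p r \<Longrightarrow> x \<noteq> p \<Longrightarrow> 0 < U x"
proof -
  interpret H: bounded_linear H using H by (rule has_derivative_bounded_linear)
  have "continuous_on (sphere 0 1) (\<lambda>x. inner (H x) x)"
    by (intro continuous_intros H.continuous_on)
  moreover have "sphere (0::'a) 1 \<noteq> {}" by simp
  ultimately obtain e where e: "norm e = 1" and min: "\<And>x. norm x = 1 \<Longrightarrow> inner (H e) e \<le> inner (H x) x"
    using continuous_attains_inf[OF compact_sphere, of 0 1 "\<lambda>x. inner (H x) x"] by auto
  define m where "m = inner (H e) e"
  have "0 < m"
  proof (rule ccontr)
    assume "\<not> 0 < m"
    then have m0: "inner (H e) e = 0" using psd[of e] by (simp add: m_def)
    obtain K where K: "0 < K" "\<And>x. norm (H x) \<le> norm x * K" using H.pos_bounded by blast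
    have "2 *\<^sub>R H e = 0"
    proof (rule first_order_condition[of 1 K])
      fix w :: 'a
      have "0 \<le> inner (H (e + w)) (e + w)" by (rule psd)
      also have "\<dots> = inner (H e) e + inner (H e) w + (inner (H w) e + inner (H w) w)"
        by (simp only: H.add inner_add_left inner_add_right)
      also have "\<dots> = inner w (2 *\<^sub>R H e) + inner (H w) w"
        unfolding m0 hessian_symmetric[OF H, of w e] by (simp add: inner_commute)
      finally have "0 \<le> inner w (2 *\<^sub>R H e) + inner (H w) w" .
      moreover have "inner (H w) w \<le> K * (norm w)\<^sup>2"
      proof -
        have "inner (H w) w \<le> norm (H w) * norm w" by (rule norm_cauchy_schwarz)
        also have "\<dots> \<le> (norm w * K) * norm w" by (intro mult_right_mono K) auto
        finally show ?thesis by (simp add: power2_eq_square mult_ac)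
      qed
      ultimately show "0 \<le> inner w (2 *\<^sub>R H e) + K * (norm w)\<^sup>2" by simp
    qed (use K in auto)
    then have "e = 0" using inj by simp
    then show False using e by simp
  qed
  have pd: "m * (norm z)\<^sup>2 \<le> inner (H z) z" for z
  proof (cases "z = 0")
    case False
    have "m \<le> inner (H ((1 / norm z) *\<^sub>R z)) ((1 / norm z) *\<^sub>R z)"
      unfolding m_def using False by (intro min) simp
    also have "\<dots> = inner (H z) z / (norm z)\<^sup>2"
      by (simp add: H.scaleR power2_eq_square)
    finally show ?thesis using False by (simp add: field_simps)
  qed (simp add: H.zero)
  \<comment> \<open>Half of \<open>m\<close> is given up to the linearisation error of
    \<open>g\<close>.\<close>
  obtain d where d: "0 < d" "\<And>z. norm (z - p) < d \<Longrightarrow> norm (g z - g p - H (z - p)) \<le> m / 2 * norm (z - p)"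
    using H[unfolded has_derivative_at_alt, THEN conjunct2, rule_format, of "m / 2"] \<open>0 < m\<close> by auto
  show ?thesis
  proof (rule that[OF d(1)])
    fix x assume x: "x \<in> ball p d" "x \<noteq> p"
    obtain \<xi> where \<xi>: "0 < \<xi>" "\<xi> < 1" "U (p + (x - p)) - U p = inner (g (p + \<xi> *\<^sub>R (x - p))) (x - p)"
      using U_mean_value by blast
    define z where "z = \<xi> *\<^sub>R (x - p)"
    have "z \<noteq> 0" using \<xi> x by (simp add: z_def)
    have "norm z \<le> norm (x - p)" using \<xi> by (simp add: z_def mult_left_le_one_le)
    then have "norm (g (p + z) - H z) \<le> m / 2 * norm z"
      using d(2)[of "p + z"] x \<open>g p = 0\<close> by (simp add: dist_norm norm_minus_commute)
    then have "norm (g (p + z) - H z) * norm z \<le> m / 2 * norm z * norm z" by (intro mult_right_mono) auto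
    moreover have "\<bar>inner (g (p + z) - H z) z\<bar> \<le> norm (g (p + z) - H z) * norm z" by (rule Cauchy_Schwarz_ineq2)
    ultimately have "inner (H z) z - m / 2 * (norm z)\<^sup>2 \<le> inner (g (p + z)) z"
      by (simp add: inner_diff_left power2_eq_square abs_le_iff)
    moreover have "0 < m / 2 * (norm z)\<^sup>2" using \<open>0 < m\<close> \<open>z \<noteq> 0\<close> by simp
    ultimately have "0 < inner (g (p + z)) z" using pd[of z] by simp
    then have "0 < \<xi> * inner (g (p + z)) (x - p)" by (simp add: z_def)
    then have "0 < inner (g (p + z)) (x - p)" using \<xi> by (simp add: zero_less_mult_iff)
    then show "0 < U x" using \<xi>(3) \<open>U p = 0\<close> by (simp add: z_def)
  qed
qed

lemma concave_direction:
  assumes dG: "\<And>x. (g has_derivative G x) (at x)" and cont: "continuous_on UNIV (\<lambda>x. G x d)"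
    and neg: "inner (G p d) d < 0" and "norm d = 1"
  obtains r \<mu> where "0 < r" "0 < \<mu>" "\<And>x h. x \<in> ball p r \<Longrightarrow> 0 \<le> h \<Longrightarrow> h \<le> r \<Longrightarrow>
    U (x + h *\<^sub>R d) \<le> U x + h * inner (g x) d - \<mu> * h\<^sup>2"
proof -
  \<comment> \<open>One factor 2 pays for the variation of the Hessian form near \<open>p\<close>,
    the other is the 1/2 in Taylor's formula.\<close>
  define \<mu> where "\<mu> = - inner (G p d) d / 4"
  have "0 < \<mu>" using neg by (simp add: \<mu>_def)
  have "continuous_on UNIV (\<lambda>x. inner (G x d) d)" by (intro continuous_intros cont)
  then obtain r0 where r0: "0 < r0" "\<And>x. dist x p < r0 \<Longrightarrow> dist (inner (G x d) d) (inner (G p d) d) < 2 * \<mu>"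
    using \<open>0 < \<mu>\<close> unfolding continuous_on_iff by (metis UNIV_I mult_pos_pos zero_less_numeral)
  have Gneg: "inner (G x d) d \<le> - (2 * \<mu>)" if "dist x p < r0" for x
    using r0(2)[OF that] by (simp add: \<mu>_def dist_real_def abs_if split: if_splits)
  show ?thesis
  proof (rule that[of "r0 / 2" \<mu>])
    fix x h assume x: "x \<in> ball p (r0 / 2)" and h: "0 \<le> h" "h \<le> r0 / 2"
    have near: "dist (x + s *\<^sub>R d) p < r0" if "0 \<le> s" "s \<le> h" for s
    proof -
      have "dist (x + s *\<^sub>R d) p \<le> norm (s *\<^sub>R d) + dist x p"
        using norm_triangle_ineq[of "s *\<^sub>R d" "x - p"] by (simp add: dist_norm algebra_simps)
      then show ?thesis using x h that \<open>norm d = 1\<close> by (simp add: dist_commute)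
    qed
    have slope: "inner (g (x + s *\<^sub>R d)) d + 2 * \<mu> * s \<le> inner (g (x + 0 *\<^sub>R d)) d + 2 * \<mu> * 0" if s: "0 \<le> s" "s \<le> h" for s
    proof (rule DERIV_nonpos_imp_nonincreasing[OF s(1)])
      fix y assume y: "0 \<le> y" "y \<le> s"
      have "((\<lambda>s. x + s *\<^sub>R d) has_derivative (\<lambda>k. k *\<^sub>R d)) (at y)" by (auto intro!: derivative_eq_intros)
      from has_derivative_compose[OF this dG]
      have "((\<lambda>s. inner (g (x + s *\<^sub>R d)) d) has_derivative (\<lambda>k. inner (G (x + y *\<^sub>R d) (k *\<^sub>R d)) d)) (at y)"
        by (intro has_derivative_inner_left)
      then have "((\<lambda>s. inner (g (x + s *\<^sub>R d)) d) has_real_derivative inner (G (x + y *\<^sub>R d) d) d) (at y)"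
        unfolding has_field_derivative_def
        by (rule has_derivative_eq_rhs) (auto simp: linear_cmul[OF has_derivative_linear[OF dG]])
      then have "((\<lambda>s. inner (g (x + s *\<^sub>R d)) d + 2 * \<mu> * s) has_real_derivative inner (G (x + y *\<^sub>R d) d) d + 2 * \<mu>) (at y)"
        by (auto intro!: derivative_eq_intros)
      moreover have "inner (G (x + y *\<^sub>R d) d) d + 2 * \<mu> \<le> 0" using Gneg[OF near[of y]] y s by simp
      ultimately show "\<exists>z. ((\<lambda>s. inner (g (x + s *\<^sub>R d)) d + 2 * \<mu> * s) has_real_derivative z) (at y) \<and> z \<le> 0" by blast
    qed
    have "U (x + h *\<^sub>R d) + \<mu> * h\<^sup>2 - h * inner (g x) d \<le> U (x + 0 *\<^sub>R d) + \<mu> * 0\<^sup>2 - 0 * inner (g x) d"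
    proof (rule DERIV_nonpos_imp_nonincreasing[OF h(1)])
      fix s assume s: "0 \<le> s" "s \<le> h"
      have "((\<lambda>h. U (x + h *\<^sub>R d) + \<mu> * h\<^sup>2 - h * inner (g x) d) has_real_derivative
          inner (g (x + s *\<^sub>R d)) d + \<mu> * (2 * s) - inner (g x) d) (at s)"
        by (auto intro!: derivative_eq_intros U_line_deriv)
      moreover have "inner (g (x + s *\<^sub>R d)) d + \<mu> * (2 * s) - inner (g x) d \<le> 0" using slope[OF s] by (simp add: mult_ac)
      ultimately show "\<exists>z. ((\<lambda>h. U (x + h *\<^sub>R d) + \<mu> * h\<^sup>2 - h * inner (g x) d) has_real_derivative z) (at s) \<and> z \<le> 0" by blast
    qed
    then show "U (x + h *\<^sub>R d) \<le> U x + h * inner (g x) d - \<mu> * h\<^sup>2" by simp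
  qed (use r0 \<open>0 < \<mu>\<close> in auto)
qed

end

text \<open>Continuity of the derivative is given direction by direction. Summing the bounds over
  \<open>Basis\<close> controls its operator norm, which is a Lipschitz constant because the ball is
  convex.\<close>

lemma continuous_derivative_imp_lipschitz_on_cball:
  fixes g :: "'a::euclidean_space \<Rightarrow> 'b::real_normed_vector"
  assumes dG: "\<And>x. (g has_derivative G x) (at x)" and cont: "\<And>d. continuous_on UNIV (\<lambda>x. G x d)"
  shows "\<exists>K\<ge>0. \<forall>x\<in>cball 0 R. \<forall>y\<in>cball 0 R. norm (g x - g y) \<le> K * norm (x - y)"
proof -
  have "\<exists>B. 0 \<le> B \<and> (\<forall>x. norm x \<le> R \<longrightarrow> norm (G x b) \<le> B)" for b
    using continuous_bounded_on_cball[OF cont] by metis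
  then obtain B where B: "\<And>b. 0 \<le> B b" "\<And>b x. norm x \<le> R \<Longrightarrow> norm (G x b) \<le> B b" by metis
  define K where "K = (\<Sum>b\<in>Basis. B b)"
  have "0 \<le> K" unfolding K_def by (intro sum_nonneg B)
  have "onorm (G x) \<le> K" if x: "x \<in> cball 0 R" for x
  proof (rule onorm_le)
    fix v :: 'a
    interpret G: bounded_linear "G x" using dG by (rule has_derivative_bounded_linear)
    have "norm (G x v) = norm (\<Sum>b\<in>Basis. inner v b *\<^sub>R G x b)"
      by (subst euclidean_representation[of v, symmetric]) (simp add: G.sum G.scaleR)
    also have "\<dots> \<le> (\<Sum>b\<in>Basis. norm (inner v b *\<^sub>R G x b))" by (rule norm_sum)
    also have "\<dots> \<le> (\<Sum>b\<in>Basis. norm v * B b)"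
      using x B by (intro sum_mono) (auto intro!: mult_mono Basis_le_norm)
    finally show "norm (G x v) \<le> K * norm v" by (simp add: K_def sum_distrib_left mult.commute)
  qed
  then show ?thesis
    using differentiable_bound[OF convex_cball has_derivative_at_withinI[OF dG], of 0 R K] \<open>0 \<le> K\<close> by blast
qed

section \<open>Almost minimisers between two parts of the boundary\<close>

text \<open>\<open>A\<close> and \<open>B\<close> are just two disjoint compact parts of the
  frontier; its components return when the ends of the limit are analysed.\<close>

locale split_frontier = smooth_potential U \<Omega> g
  for U :: "'a::euclidean_space \<Rightarrow> real" and \<Omega> and g +
  fixes A B :: "'a set"
  assumes connected_Omega: "connected \<Omega>"
    and frontier_eq: "frontier \<Omega> = A \<union> B"
    and compact_A: "compact A" and compact_B: "compact B"
    and A_ne: "A \<noteq> {}" and B_ne: "B \<noteq> {}" and disjoint: "A \<inter> B = {}"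
    and escape: "\<not> bounded \<Omega> \<Longrightarrow> \<exists>r0 \<sigma>. (\<forall>R\<ge>r0. \<sigma> integrable_on {r0..R}) \<and>
        filterlim (\<lambda>R. integral {r0..R} \<sigma>) at_top at_top \<and>
        (\<forall>x\<in>\<Omega>. r0 \<le> norm x \<longrightarrow> \<sigma> (norm x) \<le> sqrt (U x))"
begin

lemma Omega_disjoint: "x \<in> \<Omega> \<Longrightarrow> x \<notin> A" "x \<in> \<Omega> \<Longrightarrow> x \<notin> B"
  using frontier_disjoint_eq[of \<Omega>] open_Omega frontier_eq by auto

text \<open>Nearby points are joined by segments, and connectedness does the rest. Asking for both
  directions makes the relation symmetric.\<close>

lemma joined_all:
  assumes "x \<in> \<Omega>" "y \<in> \<Omega>"
  shows "\<exists>c. joined x y c"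
proof -
  have line: "\<exists>c. joined x y c" if seg: "closed_segment x y \<subseteq> \<Omega>" for x y
  proof -
    have "compact (U ` closed_segment x y)"
      by (intro compact_continuous_image continuous_on_subset[OF cont_U]) auto
    then obtain M where "\<And>z. z \<in> closed_segment x y \<Longrightarrow> U z \<le> M"
      using compact_imp_bounded bounded_imp_bdd_above unfolding bdd_above_def by (metis imageI)
    from joined_line[OF seg zero_less_one this] show ?thesis by blast
  qed
  have "(\<exists>c. joined x y c) \<and> (\<exists>c. joined y x c)"
  proof (rule connected_equivalence_relation[OF connected_Omega assms])
    fix a assume a: "a \<in> \<Omega>"
    then obtain r where r: "0 < r" "ball a r \<subseteq> \<Omega>" using open_Omega by (meson open_contains_ball)
    have "(\<exists>c. joined a x c) \<and> (\<exists>c. joined x a c)" if "x \<in> ball a r" for x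
    proof -
      have "closed_segment a x \<subseteq> ball a r" using that r by (intro closed_segment_subset) auto
      then have "closed_segment a x \<subseteq> \<Omega>" using r by auto
      then show ?thesis using line[of a x] line[of x a] by (simp add: closed_segment_commute)
    qed
    moreover have "openin (top_of_set \<Omega>) (ball a r)" using r open_Omega by (simp add: openin_open_eq)
    ultimately show "\<exists>T. openin (top_of_set \<Omega>) T \<and> a \<in> T \<and> (\<forall>x\<in>T. (\<exists>c. joined a x c) \<and> (\<exists>c. joined x a c))"
      using r by (intro exI[of _ "ball a r"]) auto
  qed (use joined_trans in blast)+
  then show ?thesis by blast
qed

lemma gap:
  "\<exists>d>0. (\<forall>x\<in>A. \<forall>y\<in>B. d \<le> dist x y) \<and> (\<forall>z. d \<le> infdist z A + infdist z B)"
proof -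
  obtain d where d: "0 < d" "\<forall>x\<in>A. \<forall>y\<in>B. d \<le> dist x y"
    using separate_compact_closed[OF compact_A compact_imp_closed[OF compact_B] disjoint] by blast
  have "d \<le> infdist z A + infdist z B" for z
  proof -
    obtain a where a: "a \<in> A" "infdist z A = dist z a"
      using infdist_attains_inf[OF compact_imp_closed[OF compact_A] A_ne] by blast
    obtain b where b: "b \<in> B" "infdist z B = dist z b"
      using infdist_attains_inf[OF compact_imp_closed[OF compact_B] B_ne] by blast
    have "d \<le> dist a b" using d a b by auto
    also have "\<dots> \<le> dist z a + dist z b" by (rule dist_triangle3)
    finally show ?thesis using a b by simp
  qed
  then show ?thesis using d by blast
qed

text \<open>Reaching the frontier must not become dearer as \<delta> shrinks. A frontier point
  \<open>q\<close> nearest to \<open>x\<close> is approached along a radius of a ball around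
  \<open>x\<close> inside \<Omega>, and running through a bounded segment in unit time has bounded
  cost.\<close>

lemma approach:
  assumes G: "G = A \<or> G = B"
  shows "\<exists>x\<in>\<Omega>. \<exists>C. \<forall>\<delta>>0. \<exists>y\<in>\<Omega>. infdist y G < \<delta> \<and> joined x y C \<and> joined y x C"
proof -
  obtain d where d: "0 < d" "\<forall>x\<in>A. \<forall>y\<in>B. d \<le> dist x y" using gap by blast
  obtain q0 where q0: "q0 \<in> G" using G A_ne B_ne by auto
  then have q0f: "q0 \<in> frontier \<Omega>" using G frontier_eq by auto
  then have "q0 \<in> closure \<Omega>" by (simp add: frontier_def)
  \<comment> \<open>The frontier point nearest to such an \<open>x\<close> is within distance
    \<open>d\<close> of \<open>q0\<close>, hence on the same side of the splitting.\<close>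
  then obtain x where x: "x \<in> \<Omega>" "dist x q0 < d / 2"
    using d(1) unfolding closure_approachable by (meson half_gt_zero)
  obtain q where q: "q \<in> frontier \<Omega>" "infdist x (frontier \<Omega>) = dist x q"
    using infdist_attains_inf[OF frontier_closed] q0f by blast
  have "dist x q \<le> dist x q0" using infdist_le[OF q0f, of x] q by simp
  then have "dist q0 q < d" using x dist_triangle3[of q0 q x] by simp
  then have "q \<in> G" using d(2) q(1) q0 G frontier_eq by (force simp: dist_commute)
  define r where "r = dist x q"
  have "q \<notin> \<Omega>" using q(1) frontier_disjoint_eq[of \<Omega>] open_Omega by auto
  then have "0 < r" using x(1) by (auto simp: r_def)
  have "ball x r \<inter> frontier \<Omega> = {}" using infdist_le[of _ "frontier \<Omega>" x] q by (force simp: r_def)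
  then have "ball x r - \<Omega> = {}"
    using connected_Int_frontier[of "ball x r" \<Omega>] x(1) \<open>0 < r\<close> by (metis IntI centre_in_ball connected_ball emptyE)
  then have sub: "ball x r \<subseteq> \<Omega>" by auto
  have "compact (U ` cball x r)" by (intro compact_continuous_image continuous_on_subset[OF cont_U]) auto
  then obtain M where M: "\<And>z. z \<in> cball x r \<Longrightarrow> U z \<le> M"
    using compact_imp_bounded bounded_imp_bdd_above unfolding bdd_above_def by (metis imageI)
  show ?thesis
  proof (rule bexI[OF _ x(1)], rule exI[of _ "r\<^sup>2 / 2 + M"], intro allI impI)
    fix \<delta> :: real assume "0 < \<delta>"
    \<comment> \<open>The segment stops at distance \<open>\<delta> / 2\<close> from
      \<open>q\<close>, or at \<open>x\<close> itself if \<delta> is large.\<close>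
    define \<theta> where "\<theta> = max 0 (1 - \<delta> / (2 * r))"
    have \<theta>: "0 \<le> \<theta>" "\<theta> < 1" "(1 - \<theta>) * r < \<delta>"
      using \<open>0 < \<delta>\<close> \<open>0 < r\<close> by (auto simp: \<theta>_def max_def field_simps)
    define y where "y = x + \<theta> *\<^sub>R (q - x)"
    have xy: "norm (y - x) = \<theta> * r" using \<theta> by (simp add: y_def r_def dist_norm norm_minus_commute)
    have "\<theta> * r < r" using \<theta> \<open>0 < r\<close> by simp
    have seg: "closed_segment x y \<subseteq> ball x r"
      using xy \<open>\<theta> * r < r\<close> \<open>0 < r\<close> by (intro closed_segment_subset) (auto simp: dist_norm norm_minus_commute)
    have y: "y \<in> \<Omega>" using seg sub by auto
    have "q - y = (1 - \<theta>) *\<^sub>R (q - x)" by (simp add: y_def algebra_simps)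
    then have "dist y q = (1 - \<theta>) * r" using \<theta> by (simp add: dist_norm r_def norm_minus_commute[of y] norm_minus_commute[of x])
    then have "infdist y G < \<delta>" using infdist_le[OF \<open>q \<in> G\<close>, of y] \<theta> by simp
    have sq: "(\<theta> * r)\<^sup>2 \<le> r\<^sup>2" using \<open>\<theta> * r < r\<close> \<theta> \<open>0 < r\<close> by (intro power_mono) auto
    have segs: "closed_segment x y \<subseteq> \<Omega>" "closed_segment y x \<subseteq> \<Omega>" using seg sub by (auto simp: closed_segment_commute)
    have MM: "U z \<le> M" if "z \<in> closed_segment x y \<or> z \<in> closed_segment y x" for z
      using that seg M[of z] by (auto simp: closed_segment_commute subset_iff)
    have "joined x y ((norm (y - x))\<^sup>2 / (2 * 1) + 1 * M)" "joined y x ((norm (x - y))\<^sup>2 / (2 * 1) + 1 * M)"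
      using MM by (intro joined_line segs; simp)+
    then have "joined x y (r\<^sup>2 / 2 + M)" "joined y x (r\<^sup>2 / 2 + M)"
      using sq xy by (auto elim!: joined_mono simp: norm_minus_commute)
    then show "\<exists>y\<in>\<Omega>. infdist y G < \<delta> \<and> joined x y (r\<^sup>2 / 2 + M) \<and> joined y x (r\<^sup>2 / 2 + M)"
      using y \<open>infdist y G < \<delta>\<close> by blast
  qed
qed

section \<open>Minimal costs, confinement and normalised almost minimisers\<close>

definition costs :: "real \<Rightarrow> real set" where
  "costs \<delta> = {c. \<exists>x\<in>\<Omega>. \<exists>y\<in>\<Omega>. infdist x A < \<delta> \<and> infdist y B < \<delta> \<and> joined x y c}"

text \<open>A smaller \<delta> leaves fewer \<open>costs\<close>, so this infimum can only grow as
  \<delta> tends to 0; \<open>costs_bounded\<close> keeps it bounded.\<close>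

definition min_cost :: "real \<Rightarrow> real" where
  "min_cost \<delta> = Inf (costs \<delta>)"

lemma costs_bdd_below: "bdd_below (costs \<delta>)"
  using joined_nonneg by (auto simp: bdd_below_def costs_def)

text \<open>The expensive part of the journey joins two fixed points and does not depend on
  \<delta>; \<open>approach\<close> bounds the two end pieces. The constant later bounds the action
  of all almost minimisers.\<close>

lemma costs_bounded: "\<exists>C. \<forall>\<delta>>0. C \<in> costs \<delta>"
proof -
  obtain x C1 where x: "x \<in> \<Omega>" "\<forall>\<delta>>0. \<exists>y\<in>\<Omega>. infdist y A < \<delta> \<and> joined x y C1 \<and> joined y x C1"
    using approach[of A] by blast
  obtain z C2 where z: "z \<in> \<Omega>" "\<forall>\<delta>>0. \<exists>y\<in>\<Omega>. infdist y B < \<delta> \<and> joined z y C2 \<and> joined y z C2"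
    using approach[of B] by blast
  obtain C3 where C3: "joined x z C3" using joined_all[OF x(1) z(1)] by blast
  have "C1 + (C3 + C2) \<in> costs \<delta>" if "0 < \<delta>" for \<delta>
  proof -
    obtain y1 where y1: "y1 \<in> \<Omega>" "infdist y1 A < \<delta>" "joined y1 x C1" using x(2) \<open>0 < \<delta>\<close> by blast
    obtain y2 where y2: "y2 \<in> \<Omega>" "infdist y2 B < \<delta>" "joined z y2 C2" using z(2) \<open>0 < \<delta>\<close> by blast
    have "joined y1 y2 (C1 + (C3 + C2))" by (intro joined_trans[OF y1(3)] joined_trans[OF C3] y2)
    then show ?thesis using y1 y2 unfolding costs_def by blast
  qed
  then show ?thesis by blast
qed

lemma min_cost_le: "c \<in> costs \<delta> \<Longrightarrow> min_cost \<delta> \<le> c"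
  unfolding min_cost_def by (intro cInf_lower costs_bdd_below)

lemma near_minimal_curve:
  assumes "0 < \<delta>"
  obtains u e a b where "a < b" "curve u e a b" "infdist (u a) A < \<delta>" "infdist (u b) B < \<delta>"
    "act u e a b < min_cost \<delta> + \<delta>"
proof -
  have "costs \<delta> \<noteq> {}" using costs_bounded assms by blast
  then obtain c where c: "c \<in> costs \<delta>" "c < min_cost \<delta> + \<delta>"
    using cInf_lessD[of "costs \<delta>" "min_cost \<delta> + \<delta>"] assms unfolding min_cost_def by auto
  then show ?thesis using that unfolding costs_def joined_def by force
qed

text \<open>A curve that starts near \<open>A\<close> and gets beyond radius \<open>R\<close> pays
  for the integral of \<open>\<sigma>\<close> from \<open>r1\<close> to \<open>R\<close>, and
  \<open>R\<close> is chosen so that this exceeds \<open>C\<close>.\<close>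

lemma confined:
  "\<exists>R. \<forall>u e a b. curve u e a b \<longrightarrow> infdist (u a) A < 1 \<longrightarrow> act u e a b \<le> C \<longrightarrow> (\<forall>t\<in>{a..b}. norm (u t) \<le> R)"
proof (cases "bounded \<Omega>")
  case True
  then obtain R where "\<forall>x\<in>\<Omega>. norm x \<le> R" unfolding bounded_iff by blast
  then show ?thesis using curve_in by blast
next
  case False
  obtain r0 \<sigma> where int: "\<And>R. r0 \<le> R \<Longrightarrow> \<sigma> integrable_on {r0..R}"
    and lim: "filterlim (\<lambda>R. integral {r0..R} \<sigma>) at_top at_top"
    and \<sigma>: "\<And>x. x \<in> \<Omega> \<Longrightarrow> r0 \<le> norm x \<Longrightarrow> \<sigma> (norm x) \<le> sqrt (U x)"
    using escape[OF False] by blast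
  obtain a0 where a0: "\<forall>x\<in>A. norm x \<le> a0" using compact_imp_bounded[OF compact_A] unfolding bounded_iff by blast
  \<comment> \<open>Large enough for \<open>\<sigma>\<close> to be available beyond it and for the
    ball of this radius to contain the unit neighbourhood of \<open>A\<close>.\<close>
  define r1 where "r1 = max r0 (a0 + 1)"
  have start: "norm x \<le> r1" if x: "infdist x A < 1" for x
  proof -
    obtain z where z: "z \<in> A" "infdist x A = dist x z"
      using infdist_attains_inf[OF compact_imp_closed[OF compact_A] A_ne] by blast
    have "norm x \<le> norm z + dist x z" using norm_triangle_sub[of x z] by (simp add: dist_norm)
    moreover have "norm z \<le> a0" using a0 z by blast
    ultimately show ?thesis using z x by (simp add: r1_def)
  qed
  have "\<forall>\<^sub>F R in at_top. C + integral {r0..r1} \<sigma> < integral {r0..R} \<sigma> \<and> r1 \<le> R"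
    using lim by (intro eventually_conj eventually_ge_at_top) (simp add: filterlim_at_top_dense)
  then obtain R where R: "C + integral {r0..r1} \<sigma> < integral {r0..R} \<sigma>" "r1 \<le> R"
    unfolding eventually_at_top_linorder by blast
  have "r0 \<le> r1" by (simp add: r1_def)
  then have "r0 \<le> R" using R(2) by simp
  have "integral {r0..r1} \<sigma> + integral {r1..R} \<sigma> = integral {r0..R} \<sigma>"
    by (rule Henstock_Kurzweil_Integration.integral_combine[OF \<open>r0 \<le> r1\<close> R(2) int[OF \<open>r0 \<le> R\<close>]])
  then have big: "C < integral {r1..R} \<sigma>" using R(1) by linarith
  have int1: "\<sigma> integrable_on {r1..R}"
    using \<open>r0 \<le> r1\<close> by (intro integrable_subinterval_real[OF int[OF \<open>r0 \<le> R\<close>]]) auto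
  have "norm (u t) \<le> R" if cu: "curve u e a b" and st: "infdist (u a) A < 1" and ac: "act u e a b \<le> C" and t: "t \<in> {a..b}" for u e a b t
  proof (rule ccontr)
    assume "\<not> norm (u t) \<le> R"
    have "integral {r1..R} \<sigma> \<le> act u e a t"
      by (rule act_radial_lower[OF curve_subset[OF cu]])
        (use t \<sigma>[OF _ order_trans[OF \<open>r0 \<le> r1\<close>]] start[OF st] R(2) int1 \<open>\<not> norm (u t) \<le> R\<close> in \<open>simp_all\<close>)
    also have "\<dots> \<le> act u e a b" using t by (intro act_mono_subset cu) auto
    finally show False using big ac by simp
  qed
  then show ?thesis by blast
qed

text \<open>The case distinctions at \<open>a = p\<close> and \<open>q = b\<close> arise because
  \<open>joined\<close> asks for a positive duration.\<close>

lemma replace_middle: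
  assumes cu: "curve u e a b" and pq: "a \<le> p" "p < q" "q \<le> b" and j: "joined (u p) (u q) c"
  shows "joined (u a) (u b) (act u e a b - act u e p q + c)"
proof -
  have "joined (u a) (u q) (act u e a p + c)"
  proof (cases "a = p")
    case True
    then show ?thesis using j act_nonneg[OF curve_subset[OF cu, of a p]] pq by (auto elim!: joined_mono)
  next
    case False
    then have "joined (u a) (u p) (act u e a p)" using pq by (intro joined_curve curve_subset[OF cu]) auto
    then show ?thesis using j by (rule joined_trans)
  qed
  moreover have "joined (u a) (u b) (x + act u e q b)" if "joined (u a) (u q) x" for x
  proof (cases "q = b")
    case True
    then show ?thesis using that act_nonneg[OF curve_subset[OF cu, of q b]] pq by (auto elim!: joined_mono)
  next
    case False
    then have "joined (u q) (u b) (act u e q b)" using pq by (intro joined_curve curve_subset[OF cu]) auto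
    with that show ?thesis by (rule joined_trans)
  qed
  ultimately have "joined (u a) (u b) (act u e a p + c + act u e q b)" by blast
  moreover have "act u e a b = act u e a p + act u e p q + act u e q b"
    using act_combine[OF cu, of q] act_combine[OF curve_subset[OF cu, of a q], of p] pq by auto
  ultimately show ?thesis by (simp add: algebra_simps)
qed

text \<open>A normalised almost minimiser: defined on the whole line by constant extension, with time
  \<open>0\<close> placed at the last exit from the \<open>\<rho>\<close>-neighbourhood of \<open>A\<close>.\<close>

definition normalised :: "real \<Rightarrow> real \<Rightarrow> real \<Rightarrow> real \<Rightarrow> (real \<Rightarrow> 'a) \<Rightarrow> (real \<Rightarrow> real) \<Rightarrow> real \<Rightarrow> real \<Rightarrow> bool" where
  "normalised \<rho> \<delta> M R X E \<alpha> \<beta> \<longleftrightarrow>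
    (\<forall>s t. energy_budget X E s t) \<and> (\<forall>s t. E t - E s \<le> M) \<and> (\<forall>t. norm (X t) \<le> R) \<and> (\<forall>t. X t \<in> \<Omega>) \<and>
    (\<forall>t\<le>\<alpha>. infdist (X t) A < \<delta>) \<and> (\<forall>t\<ge>\<beta>. infdist (X t) B < \<delta>) \<and>
    infdist (X 0) A = \<rho> \<and> (\<forall>t\<ge>0. \<rho> \<le> infdist (X t) A) \<and>
    (\<forall>s t c. \<alpha> \<le> s \<longrightarrow> s < t \<longrightarrow> t \<le> \<beta> \<longrightarrow> joined (X s) (X t) c \<longrightarrow> act X E s t \<le> c + \<delta>) \<and>
    (\<forall>s t \<delta>'. \<alpha> < s \<longrightarrow> s \<le> t \<longrightarrow> t \<le> \<beta> \<longrightarrow> \<delta> \<le> \<delta>' \<longrightarrow> infdist (X s) B < \<delta>' \<longrightarrow>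
        min_cost \<delta>' + act X E s t \<le> min_cost \<delta> + \<delta>) \<and>
    (\<forall>s t. \<alpha> \<le> s \<longrightarrow> s \<le> t \<longrightarrow> t \<le> \<beta> \<longrightarrow> act X E s t \<le> M)"

lemma normalisedD:
  assumes "normalised \<rho> \<delta> M R X E \<alpha> \<beta>"
  shows "energy_budget X E s t" "E t - E s \<le> M" "norm (X t) \<le> R" "X t \<in> \<Omega>"
    "t \<le> \<alpha> \<Longrightarrow> infdist (X t) A < \<delta>" "\<beta> \<le> t \<Longrightarrow> infdist (X t) B < \<delta>"
    "infdist (X 0) A = \<rho>" "0 \<le> t \<Longrightarrow> \<rho> \<le> infdist (X t) A"
    "\<alpha> \<le> s \<Longrightarrow> s < t \<Longrightarrow> t \<le> \<beta> \<Longrightarrow> joined (X s) (X t) c \<Longrightarrow> act X E s t \<le> c + \<delta>"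
    "\<alpha> < s \<Longrightarrow> s \<le> t \<Longrightarrow> t \<le> \<beta> \<Longrightarrow> \<delta> \<le> \<delta>' \<Longrightarrow> infdist (X s) B < \<delta>' \<Longrightarrow>
        min_cost \<delta>' + act X E s t \<le> min_cost \<delta> + \<delta>"
    "\<alpha> \<le> s \<Longrightarrow> s \<le> t \<Longrightarrow> t \<le> \<beta> \<Longrightarrow> act X E s t \<le> M"
  using assms unfolding normalised_def by simp_all

text \<open>\<open>M\<close> and \<open>R\<close> do not depend on \<delta>, as compactness
  requires. The separation by \<open>3 * \<rho>\<close> ensures that a curve ending near
  \<open>B\<close> has left the \<rho>-neighbourhood of \<open>A\<close>.\<close>

lemma normalised_exists:
  assumes \<rho>: "0 < \<rho>" "\<rho> \<le> 1" "\<And>z. 3 * \<rho> \<le> infdist z A + infdist z B"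
  shows "\<exists>M R. \<forall>\<delta>. 0 < \<delta> \<longrightarrow> \<delta> < \<rho> \<longrightarrow> (\<exists>X E \<alpha> \<beta>. normalised \<rho> \<delta> M R X E \<alpha> \<beta>)"
proof -
  obtain C where C: "\<And>\<delta>. 0 < \<delta> \<Longrightarrow> C \<in> costs \<delta>" using costs_bounded by blast
  obtain R where R: "\<forall>u e a b. curve u e a b \<longrightarrow> infdist (u a) A < 1 \<longrightarrow> act u e a b \<le> C + 1 \<longrightarrow> (\<forall>t\<in>{a..b}. norm (u t) \<le> R)"
    using confined by blast
  \<comment> \<open>The kinetic part of the action is half a budget increment, hence the factor
    2.\<close>
  define M where "M = 2 * (C + 1)"
  have "\<exists>X E \<alpha> \<beta>. normalised \<rho> \<delta> M R X E \<alpha> \<beta>" if \<delta>: "0 < \<delta>" "\<delta> < \<rho>" for \<delta>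
  proof -
    obtain w f a b where ab: "a < b" and cu: "curve w f a b" and ends: "infdist (w a) A < \<delta>" "infdist (w b) B < \<delta>"
      and near: "act w f a b < min_cost \<delta> + \<delta>"
      using near_minimal_curve[OF \<delta>(1)] .
    have total: "act w f a b \<le> C + 1"
      using near min_cost_le[OF C[OF \<delta>(1)]] \<delta> \<rho> by linarith
    have cr: "continuous_on {a..b} (\<lambda>t. infdist (w t) A)" "infdist (w a) A \<le> \<rho>" "\<rho> \<le> infdist (w b) A"
      using ends \<delta> \<rho>(3)[of "w b"] by (auto intro!: continuous_intros curve_cont[OF cu])
    obtain s where s: "s \<in> {a..b}" "infdist (w s) A = \<rho>" "\<And>t. t \<in> {s<..b} \<Longrightarrow> \<rho> < infdist (w t) A"
      using last_crossing[OF cr(1) less_imp_le[OF ab] cr(2,3)] by blast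
    \<comment> \<open>Shifting time by \<open>s\<close> and clamping it to \<open>{a..b}\<close> is
      monotone and nonexpansive, so budgets survive the constant extension.\<close>
    define cl where "cl t = max a (min b (t + s))" for t
    define X where "X t = w (cl t)" for t
    define E where "E t = f (cl t)" for t
    define \<alpha> where "\<alpha> = a - s"
    define \<beta> where "\<beta> = b - s"
    have cl_mem: "cl t \<in> {a..b}" for t using ab by (auto simp: cl_def)
    have cl_mono: "cl x \<le> cl y" if "x \<le> y" for x y using that by (auto simp: cl_def)
    have cl_diff: "cl y - cl x \<le> y - x" if "x \<le> y" for x y using that ab by (auto simp: cl_def max_def min_def)
    have cl_id: "cl t = t + s" if "\<alpha> \<le> t" "t \<le> \<beta>" for t using that ab by (auto simp: cl_def \<alpha>_def \<beta>_def)
    have bw: "energy_budget w f a b" using cu by (simp add: curve_def)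
    have f_mono: "f x \<le> f y" if "a \<le> x" "x \<le> y" "y \<le> b" for x y using energy_budget_mono[OF bw that] .
    have bX: "energy_budget X E p q" for p q
      unfolding energy_budget_def
    proof (intro allI impI)
      fix x y :: real assume "x \<le> y"
      have "(norm (X y - X x))\<^sup>2 \<le> (cl y - cl x) * (E y - E x)"
        unfolding X_def E_def using cl_mem[of x] cl_mem[of y] cl_mono[OF \<open>x \<le> y\<close>]
        by (intro energy_budgetD[OF bw]) auto
      also have "\<dots> \<le> (y - x) * (E y - E x)"
        using cl_diff[OF \<open>x \<le> y\<close>] f_mono[OF _ cl_mono[OF \<open>x \<le> y\<close>]] cl_mem[of x] cl_mem[of y]
        by (intro mult_right_mono) (auto simp: E_def)
      finally show "(norm (X y - X x))\<^sup>2 \<le> (y - x) * (E y - E x)" .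
    qed
    have act_X: "act X E p q = act w f (p + s) (q + s)" if "\<alpha> \<le> p" "p \<le> q" "q \<le> \<beta>" for p q
    proof -
      have "integral {p..q} (\<lambda>t. U (X t)) = integral {p..q} ((\<lambda>t. U (w t)) \<circ> (+) s)"
        using that cl_id by (intro integral_cong) (auto simp: X_def add.commute)
      then show ?thesis using that cl_id by (simp add: act_def E_def integral_shift_Icc_real)
    qed
    have act_le: "act X E p q \<le> C + 1" if "\<alpha> \<le> p" "p \<le> q" "q \<le> \<beta>" for p q
    proof -
      have "act w f (p + s) (q + s) \<le> act w f a b"
        using that by (intro act_mono_subset[OF cu]) (auto simp: \<alpha>_def \<beta>_def)
      then show ?thesis using act_X[OF that] total by simp
    qed
    have "0 \<le> C + 1" using act_nonneg[OF cu] ab total by linarith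
    have X\<Omega>: "X t \<in> \<Omega>" for t unfolding X_def by (rule curve_in[OF cu cl_mem])
    have "normalised \<rho> \<delta> M R X E \<alpha> \<beta>"
      unfolding normalised_def
    proof (intro conjI allI impI)
      fix s' t
      have "E t - E s' \<le> f b - f a"
        using f_mono[of a "cl s'"] f_mono[of "cl t" b] cl_mem[of s'] cl_mem[of t] by (auto simp: E_def)
      also have "\<dots> \<le> M" using act_ge_budget[OF cu] total by (simp add: M_def)
      finally show "E t - E s' \<le> M" .
    next
      fix t show "norm (X t) \<le> R"
        using R cu ends \<delta> \<rho> total cl_mem[of t] unfolding X_def by (meson less_le_trans less_trans)
    next
      fix t assume "t \<le> \<alpha>"
      then have "cl t = a" using ab by (auto simp: cl_def \<alpha>_def)
      then show "infdist (X t) A < \<delta>" using ends by (simp add: X_def)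
    next
      fix t assume "\<beta> \<le> t"
      then have "cl t = b" using ab by (auto simp: cl_def \<beta>_def)
      then show "infdist (X t) B < \<delta>" using ends by (simp add: X_def)
    next
      have "cl 0 = s" using s by (auto simp: cl_def)
      then show "infdist (X 0) A = \<rho>" using s by (simp add: X_def)
    next
      fix t :: real assume "0 \<le> t"
      then have "cl t = s \<or> cl t \<in> {s<..b}" using s ab by (auto simp: cl_def max_def min_def)
      then show "\<rho> \<le> infdist (X t) A" using s(2) s(3)[of "cl t"] by (auto simp: X_def)
    next
      fix p q c assume pq: "\<alpha> \<le> p" "p < q" "q \<le> \<beta>" and j: "joined (X p) (X q) c"
      have "joined (w a) (w b) (act w f a b - act w f (p + s) (q + s) + c)"
        using pq j cl_id[of p] cl_id[of q]
        by (intro replace_middle[OF cu]) (auto simp: X_def \<alpha>_def \<beta>_def)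
      then have "act w f a b - act w f (p + s) (q + s) + c \<in> costs \<delta>"
        unfolding costs_def using ends curve_in[OF cu, of a] curve_in[OF cu, of b] ab by auto
      then show "act X E p q \<le> c + \<delta>"
        using min_cost_le near act_X[of p q] pq by force
    next
      \<comment> \<open>The piece up to \<open>p\<close> is itself a competitor for
        \<open>min_cost \<delta>'\<close>, and the action from \<open>p\<close> to \<open>q\<close>
        comes on top of it. The strict \<open>\<alpha> < p\<close> gives this piece a positive
        duration.\<close>
      fix p q \<delta>' assume pq: "\<alpha> < p" "p \<le> q" "q \<le> \<beta>" and \<delta>': "\<delta> \<le> \<delta>'" "infdist (X p) B < \<delta>'"
      have p: "a < p + s" "p + s \<le> q + s" "q + s \<le> b" using pq by (auto simp: \<alpha>_def \<beta>_def)
      have "joined (w a) (w (p + s)) (act w f a (p + s))"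
        using p by (intro joined_curve curve_subset[OF cu]) auto
      then have "act w f a (p + s) \<in> costs \<delta>'"
        unfolding costs_def using ends \<delta>' cl_id[of p] pq curve_in[OF cu, of a] curve_in[OF cu, of "p + s"] p
        by (auto simp: X_def intro!: bexI)
      then have "min_cost \<delta>' \<le> act w f a (p + s)" by (rule min_cost_le)
      moreover have "act w f a (p + s) + act w f (p + s) (q + s) = act w f a (q + s)"
        using p by (intro act_combine[OF curve_subset[OF cu]]) auto
      moreover have "act w f a (q + s) \<le> act w f a b" using p by (intro act_mono_subset[OF cu]) auto
      ultimately show "min_cost \<delta>' + act X E p q \<le> min_cost \<delta> + \<delta>" using near act_X[of p q] pq by auto
    next
      fix p q assume "\<alpha> \<le> p" "p \<le> q" "q \<le> \<beta>"
      then show "act X E p q \<le> M" using act_le[of p q] \<open>0 \<le> C + 1\<close> by (simp add: M_def)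
    qed (use bX X\<Omega> in auto)
    then show ?thesis by blast
  qed
  then show ?thesis by blast
qed

text \<open>On the last conclusion: if \<open>u\<close> came arbitrarily close to \<open>B\<close>
  before time \<open>- \<tau>\<close>, the earlier part of the almost minimisers would already cost
  almost the supremum \<open>D\<close> of the minimal costs, leaving less than the fixed amount
  spent on \<open>{- \<tau>..0}\<close>.\<close>

lemma limit_curve_exists:
  obtains u X E \<alpha> \<beta> \<epsilon> M R \<rho> where
    "minimizing_limit U \<Omega> g X E \<alpha> \<beta> \<epsilon> u M R" "u 0 \<in> \<Omega>" "\<And>t. u t \<in> closure \<Omega>" "0 < \<rho>"
    "\<And>t. 0 \<le> t \<Longrightarrow> \<rho> \<le> infdist (u t) A"
    "\<And>s t. s \<le> t \<Longrightarrow> u ` {s..t} \<subseteq> \<Omega> \<Longrightarrow> integral {s..t} (\<lambda>\<tau>. U (u \<tau>)) \<le> M"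
    "\<And>\<tau>. 0 < \<tau> \<Longrightarrow> u ` {- \<tau>..0} \<subseteq> \<Omega> \<Longrightarrow> \<exists>\<eta>>0. \<forall>t\<le>- \<tau>. u ` {t..0} \<subseteq> \<Omega> \<longrightarrow> \<eta> \<le> infdist (u t) B"
proof -
  obtain d where d: "0 < d" "\<And>z. d \<le> infdist z A + infdist z B" using gap by blast
  \<comment> \<open>A third of the gap provides the separation \<open>3 * \<rho>\<close>; the bound
    1 matches the unit neighbourhood in \<open>confined\<close>.\<close>
  define \<rho> where "\<rho> = min 1 (d / 3)"
  have \<rho>: "0 < \<rho>" "\<rho> \<le> 1" and \<rho>3: "3 * \<rho> \<le> infdist z A + infdist z B" for z
    using d(1) d(2)[of z] by (auto simp: \<rho>_def)
  obtain M R where MR: "\<And>\<delta>. 0 < \<delta> \<Longrightarrow> \<delta> < \<rho> \<Longrightarrow> \<exists>X E \<alpha> \<beta>. normalised \<rho> \<delta> M R X E \<alpha> \<beta>"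
    using normalised_exists[OF \<rho> \<rho>3] by blast
  define \<delta> where "\<delta> n = \<rho> / (2 + real n)" for n :: nat
  have \<delta>: "0 < \<delta> n" "\<delta> n < \<rho>" for n
  proof -
    have "\<rho> / (2 + real n) \<le> \<rho> / 2" using \<rho> by (intro divide_left_mono) auto
    then show "\<delta> n < \<rho>" using \<rho>(1) unfolding \<delta>_def by linarith
  qed (use \<rho> in \<open>simp add: \<delta>_def add_nonneg_pos\<close>)
  have \<delta>_mono: "\<delta> n \<le> \<delta> m" if "m \<le> n" for m n using that \<rho> by (simp add: \<delta>_def frac_le)
  have \<delta>0: "\<delta> \<longlonglongrightarrow> 0" unfolding \<delta>_def
    by (rule real_tendsto_divide_at_top[OF tendsto_const
          filterlim_tendsto_add_at_top[OF tendsto_const filterlim_real_sequentially]])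
  have "\<forall>n. \<exists>X E \<alpha> \<beta>. normalised \<rho> (\<delta> n) M R X E \<alpha> \<beta>" using MR[OF \<delta>] by blast
  then obtain X' E' \<alpha>' \<beta>' where Q: "\<And>n. normalised \<rho> (\<delta> n) M R (X' n) (E' n) (\<alpha>' n) (\<beta>' n)" by metis
  \<comment> \<open>Diagonal selection at the rational times; the common Hoelder bound then extends
    convergence to all times.\<close>
  obtain k where k: "strict_mono (k::nat \<Rightarrow> nat)" and k_conv: "\<And>x. x \<in> \<rat> \<Longrightarrow> \<exists>l. (\<lambda>n. X' (k n) x) \<longlonglongrightarrow> l"
  proof (rule function_convergent_subsequence[OF countable_rat, of X' R])
    show "norm (X' n x) \<le> R" for n x by (rule normalisedD(3)[OF Q])
  qed (rule that)
  define X where "X n = X' (k n)" for n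
  define E where "E n = E' (k n)" for n
  define \<alpha> where "\<alpha> n = \<alpha>' (k n)" for n
  define \<beta> where "\<beta> n = \<beta>' (k n)" for n
  define \<epsilon> where "\<epsilon> n = \<delta> (k n)" for n
  have N: "normalised \<rho> (\<epsilon> n) M R (X n) (E n) (\<alpha> n) (\<beta> n)" for n
    unfolding X_def E_def \<alpha>_def \<beta>_def \<epsilon>_def by (rule Q)
  note ND = normalisedD[OF N]
  have \<epsilon>0: "\<epsilon> \<longlonglongrightarrow> 0" unfolding \<epsilon>_def[abs_def] using LIMSEQ_subseq_LIMSEQ[OF \<delta>0 k] by (simp add: o_def)
  have "0 \<le> M" using ND(2)[of 0 0 0] by simp
  note hol = energy_budget_global_holder[OF ND(1,2)]
  have "Cauchy (\<lambda>n. X n t)" for t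
  proof (rule metric_CauchyI)
    fix e :: real assume "0 < e"
    define h where "h = (e / 3)\<^sup>2 / (M + 1)"
    have "0 < h" using \<open>0 < e\<close> \<open>0 \<le> M\<close> by (auto simp: h_def intro!: divide_pos_pos)
    then obtain x where x: "x \<in> \<rat>" "t < x" "x < t + h" using Rats_dense_in_real[of t "t + h"] by auto
    have close: "dist (X n t) (X n x) < e / 3" for n
      unfolding dist_norm
      by (rule half_holder_less[OF hol \<open>0 \<le> M\<close>]) (use \<open>0 < e\<close> x in \<open>auto simp: h_def\<close>)
    have "Cauchy (\<lambda>n. X n x)" using k_conv[OF x(1)] LIMSEQ_imp_Cauchy unfolding X_def by blast
    then obtain n0 where n0: "\<And>m n. n0 \<le> m \<Longrightarrow> n0 \<le> n \<Longrightarrow> dist (X m x) (X n x) < e / 3"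
      using \<open>0 < e\<close> unfolding Cauchy_def by (meson divide_pos_pos zero_less_numeral)
    have "dist (X m t) (X n t) < e" if "n0 \<le> m" "n0 \<le> n" for m n
      using close[of m] close[of n] n0[OF that] dist_triangle[of "X m t" "X n t" "X m x"]
        dist_triangle2[of "X m x" "X n t" "X n x"] by (simp add: dist_commute)
    then show "\<exists>n0. \<forall>m\<ge>n0. \<forall>n\<ge>n0. dist (X m t) (X n t) < e" by blast
  qed
  then have "\<forall>t. \<exists>l. (\<lambda>n. X n t) \<longlonglongrightarrow> l" using Cauchy_convergent_iff convergent_def by blast
  then obtain u where u: "\<And>t. (\<lambda>n. X n t) \<longlonglongrightarrow> u t" by metis
  have uA: "(\<lambda>n. infdist (X n t) A) \<longlonglongrightarrow> infdist (u t) A" for t by (intro tendsto_infdist u)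
  have uB: "(\<lambda>n. infdist (X n t) B) \<longlonglongrightarrow> infdist (u t) B" for t by (intro tendsto_infdist u)
  have pos: "0 < infdist x A" "0 < infdist x B" if "x \<in> \<Omega>" for x
    using Omega_disjoint[OF that] A_ne B_ne compact_imp_closed[OF compact_A] compact_imp_closed[OF compact_B]
    by (auto intro!: infdist_pos_not_in_closed)
  \<comment> \<open>Outside its true domain \<open>X n\<close> is within \<open>\<epsilon> n\<close>
    of \<open>A\<close> or \<open>B\<close>, whereas a limit inside \<Omega> has positive distance
    from both.\<close>
  have inner: "\<forall>\<^sub>F n in sequentially. \<alpha> n < t \<and> t < \<beta> n" if "u t \<in> \<Omega>" for t
  proof -
    define m where "m = min (infdist (u t) A) (infdist (u t) B) / 2"
    have m: "0 < m" "m < infdist (u t) A" "m < infdist (u t) B" using pos[OF that] by (auto simp: m_def)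
    show ?thesis
      using order_tendstoD(2)[OF \<epsilon>0 m(1)] order_tendstoD(1)[OF uA m(2)] order_tendstoD(1)[OF uB m(3)]
    proof eventually_elim
      case (elim n)
      show ?case using ND(5)[of t n] ND(6)[of n t] elim by force
    qed
  qed
  interpret lim: minimizing_limit U \<Omega> g X E \<alpha> \<beta> \<epsilon> u M R
    by unfold_locales (rule ND(1-4) ND(9) u \<epsilon>0 inner; assumption)+
  have "(\<lambda>n. infdist (X n 0) A) \<longlonglongrightarrow> \<rho>" using ND(7) by simp
  then have u0A: "infdist (u 0) A = \<rho>" by (rule LIMSEQ_unique[OF uA[of 0]])
  have clos: "u t \<in> closure \<Omega>" for t
    unfolding closure_sequential by (intro exI[of _ "\<lambda>n. X n t"] conjI allI ND(4) u)
  \<comment> \<open>A frontier point has distance 0 from \<open>A\<close> or from \<open>B\<close>;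
    the first contradicts \<open>u0A\<close>, the second the separation by
    \<open>3 * \<rho>\<close>.\<close>
  have "u 0 \<notin> frontier \<Omega>"
  proof
    assume "u 0 \<in> frontier \<Omega>"
    then show False using u0A \<rho> \<rho>3[of "u 0"] frontier_eq by auto
  qed
  then have u0: "u 0 \<in> \<Omega>" using clos[of 0] open_Omega by (simp add: frontier_def interior_open)
  have int: "integral {s..t} (\<lambda>\<tau>. U (u \<tau>)) \<le> M" if "s \<le> t" "u ` {s..t} \<subseteq> \<Omega>" for s t
  proof -
    have "(\<lambda>n. integral {s..t} (\<lambda>\<tau>. U (X n \<tau> + 0))) \<longlonglongrightarrow> integral {s..t} (\<lambda>\<tau>. U (u \<tau> + 0))"
      by (rule lim.integral_converges[of _ _ _ 0]) auto
    moreover have "\<forall>\<^sub>F n in sequentially. integral {s..t} (\<lambda>\<tau>. U (X n \<tau> + 0)) \<le> M"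
      using lim.eventually_inner_interval[OF that(2,1)]
    proof eventually_elim
      case (elim n)
      have "curve (X n) (E n) s t" using ND(1,4) by (auto simp: curve_def)
      then have "integral {s..t} (\<lambda>\<tau>. U (X n \<tau>)) \<le> act (X n) (E n) s t" using that by (intro act_ge_integral)
      also have "\<dots> \<le> M" using ND(11)[of n s t] elim that by simp
      finally show ?case by simp
    qed
    ultimately have "integral {s..t} (\<lambda>\<tau>. U (u \<tau> + 0)) \<le> M" by (rule tendsto_upperbound) simp
    then show ?thesis by simp
  qed
  have excl: "\<exists>\<eta>>0. \<forall>t\<le>- \<tau>. u ` {t..0} \<subseteq> \<Omega> \<longrightarrow> \<eta> \<le> infdist (u t) B" if \<tau>: "0 < \<tau>" and sub: "u ` {- \<tau>..0} \<subseteq> \<Omega>" for \<tau>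
  proof -
    \<comment> \<open>The amount by which a visit near \<open>B\<close> before time
      \<open>- \<tau>\<close> would let the almost minimisers be shortened.\<close>
    define c1 where "c1 = integral {- \<tau>..0} (\<lambda>t. U (u t))"
    have "continuous_on {- \<tau>..0} (\<lambda>t. U (u t))" by (intro U_comp_cont lim.u_continuous)
    then obtain t0 where t0: "t0 \<in> {- \<tau>..0}" "\<And>t. t \<in> {- \<tau>..0} \<Longrightarrow> U (u t0) \<le> U (u t)"
      using continuous_attains_inf[of "{- \<tau>..0}" "\<lambda>t. U (u t)"] \<tau> by auto
    have "integral {- \<tau>..0} (\<lambda>_. U (u t0)) \<le> c1"
      unfolding c1_def using t0 by (intro integral_le U_comp_int lim.u_continuous) auto
    moreover have "u t0 \<in> \<Omega>" using sub t0(1) by blast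
    then have "0 < \<tau> * U (u t0)" using \<tau> U_pos by (intro mult_pos_pos) auto
    ultimately have c1: "0 < c1" using \<tau> by simp
    \<comment> \<open>The supremum stands for the limit of the minimal costs; \<open>m\<close> is
      chosen so that \<open>min_cost (\<delta> m)\<close> falls short of it by less than
      \<open>c1\<close>.\<close>
    define D where "D = Sup (range (\<lambda>n. min_cost (\<delta> n)))"
    obtain C where C: "\<forall>\<delta>>0. C \<in> costs \<delta>" using costs_bounded by blast
    have bdd: "bdd_above (range (\<lambda>n. min_cost (\<delta> n)))"
      using C \<delta>(1) by (intro bdd_aboveI2[where M = C] min_cost_le) blast
    have D: "min_cost (\<delta> n) \<le> D" for n unfolding D_def by (intro cSup_upper bdd) auto
    have "D - c1 < D" using c1 by simp
    then obtain m where m: "D - c1 < min_cost (\<delta> m)"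
      unfolding D_def using less_cSupD[of "range (\<lambda>n. min_cost (\<delta> n))"] by force
    have "\<delta> m \<le> infdist (u t) B" if t: "t \<le> - \<tau>" and tsub: "u ` {t..0} \<subseteq> \<Omega>" for t
    proof (rule ccontr)
      assume "\<not> \<delta> m \<le> infdist (u t) B"
      then have "\<forall>\<^sub>F n in sequentially. infdist (X n t) B < \<delta> m" using order_tendstoD(2)[OF uB] by simp
      moreover have "\<forall>\<^sub>F n in sequentially. \<alpha> n < t \<and> 0 < \<beta> n"
        using t \<tau> by (intro lim.eventually_inner_interval[OF tsub]) auto
      moreover have "\<forall>\<^sub>F n in sequentially. m \<le> n" by (rule eventually_ge_at_top)
      ultimately have "\<forall>\<^sub>F n in sequentially. min_cost (\<delta> m) + integral {- \<tau>..0} (\<lambda>t. U (X n t + 0)) \<le> D + \<epsilon> n"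
      proof eventually_elim
        case (elim n)
        have cu: "curve (X n) (E n) t 0" using ND(1,4) by (auto simp: curve_def)
        have "\<epsilon> n \<le> \<delta> m" unfolding \<epsilon>_def using elim seq_suble[OF k, of n] by (intro \<delta>_mono) simp
        then have "min_cost (\<delta> m) + act (X n) (E n) t 0 \<le> min_cost (\<epsilon> n) + \<epsilon> n"
          using elim t \<tau> by (intro ND(10)) auto
        also have "min_cost (\<epsilon> n) \<le> D" unfolding \<epsilon>_def by (rule D)
        finally have "min_cost (\<delta> m) + act (X n) (E n) t 0 \<le> D + \<epsilon> n" by simp
        moreover have "integral {- \<tau>..0} (\<lambda>t. U (X n t)) \<le> act (X n) (E n) (- \<tau>) 0"
          using t \<tau> by (intro act_ge_integral curve_subset[OF cu]) auto
        moreover have "act (X n) (E n) (- \<tau>) 0 \<le> act (X n) (E n) t 0"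
          using t \<tau> by (intro act_mono_subset[OF cu]) auto
        ultimately show ?case by simp
      qed
      moreover have "(\<lambda>n. min_cost (\<delta> m) + integral {- \<tau>..0} (\<lambda>t. U (X n t + 0)))
        \<longlonglongrightarrow> min_cost (\<delta> m) + integral {- \<tau>..0} (\<lambda>t. U (u t + 0))"
        by (intro tendsto_intros lim.integral_converges[of _ _ _ 0]) auto
      moreover have "(\<lambda>n. D + \<epsilon> n) \<longlonglongrightarrow> D + 0" by (intro tendsto_intros \<epsilon>0)
      ultimately have "min_cost (\<delta> m) + integral {- \<tau>..0} (\<lambda>t. U (u t + 0)) \<le> D + 0"
        using tendsto_le[OF sequentially_bot] by blast
      then show False using m by (simp add: c1_def)
    qed
    then show ?thesis using \<delta>(1)[of m] by blast
  qed
  have "\<rho> \<le> infdist (u t) A" if "0 \<le> t" for t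
    using ND(8)[OF that] by (intro tendsto_lowerbound[OF uA[of t]]) auto
  then show ?thesis using that[OF lim.minimizing_limit_axioms u0 clos \<rho>(1)] int excl by blast
qed

end

section \<open>The connecting orbit\<close>

text \<open>Lets the past end be treated as the future end of the reversed curve.\<close>

lemma tends_at_lower_uminus:
  assumes "0 < T"
  shows "tends_at_lower f l (- T) \<longleftrightarrow> tends_at_upper (\<lambda>t. f (- t)) l T"
proof (cases T)
  case (real x)
  then show ?thesis
    by (simp add: tends_at_lower_def tends_at_upper_def ereal_tendsto_simps filterlim_at_left_to_right)
next
  case PInf
  then show ?thesis
    by (simp add: tends_at_lower_def tends_at_upper_def ereal_tendsto_simps filterlim_at_bot_mirror)
qed (use assms in auto)

lemma tends_at_upper_not_bounded_away:
  fixes f :: "real \<Rightarrow> real"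
  assumes lim: "tends_at_upper f 0 T" and "ereal \<tau> < T" "0 < \<eta>"
    and away: "\<And>t. \<tau> \<le> t \<Longrightarrow> ereal t < T \<Longrightarrow> \<eta> \<le> f t"
  shows False
proof (cases T)
  case (real x)
  have "\<forall>\<^sub>F t in at_left x. f t < \<eta>"
    using lim order_tendstoD(2)[OF _ \<open>0 < \<eta>\<close>] by (auto simp: real tends_at_upper_def ereal_tendsto_simps)
  moreover have "\<forall>\<^sub>F t in at_left x. \<tau> < t \<and> t < x"
    using assms(2) real by (intro eventually_at_leftI[of \<tau>]) auto
  ultimately have "\<forall>\<^sub>F t in at_left x. False"
  proof eventually_elim
    case (elim t)
    then show ?case using away[of t] real by auto
  qed
  then show False by simp
next
  case PInf
  have "\<forall>\<^sub>F t in at_top. f t < \<eta>"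
    using lim order_tendstoD(2)[OF _ \<open>0 < \<eta>\<close>] by (auto simp: PInf tends_at_upper_def ereal_tendsto_simps)
  then have "\<forall>\<^sub>F t in at_top. f t < \<eta> \<and> \<tau> \<le> t" using eventually_ge_at_top by (rule eventually_conj)
  then obtain t where "f t < \<eta>" "\<tau> \<le> t" unfolding eventually_at_top_linorder by blast
  then show False using away[of t] PInf by simp
qed (use assms in auto)

lemma diameter_eq_0_imp_singleton:
  assumes "bounded S" "x \<in> S" "\<not> 0 < diameter S"
  shows "S = {x}"
proof -
  have "y = x" if "y \<in> S" for y
    using diameter_bounded_bound[OF assms(1) that assms(2)] assms(3) zero_le_dist[of y x]
    by (simp only: not_less flip: dist_le_zero_iff)
  then show ?thesis using assms(2) by blast
qed

context smooth_potential
begin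

text \<open>Stated for the forward end and for a general velocity \<open>v\<close>, so that it also
  applies to the reversed curve. Near saddles minimality enters through \<open>window\<close>, which
  is invariant under reversal.\<close>

lemma end_dichotomy:
  assumes contu: "continuous_on UNIV u" and bd: "\<And>t. norm (u t) \<le> R" and clos: "\<And>t. u t \<in> closure \<Omega>"
    and u0: "u 0 \<in> \<Omega>"
    and du: "\<And>t. u t \<in> \<Omega> \<Longrightarrow> (u has_vector_derivative v t) (at t)"
    and dv: "\<And>t. u t \<in> \<Omega> \<Longrightarrow> (v has_vector_derivative g (u t)) (at t)"
    and en: "\<And>t. u t \<in> \<Omega> \<Longrightarrow> (norm (v t))\<^sup>2 / 2 = U (u t)"
    and act: "\<And>\<tau>. 0 \<le> \<tau> \<Longrightarrow> u ` {0..\<tau>} \<subseteq> \<Omega> \<Longrightarrow> integral {0..\<tau>} (\<lambda>t. U (u t)) \<le> C"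
    and U0: "\<And>x. x \<in> frontier \<Omega> \<Longrightarrow> U x = 0" and cfr: "compact (frontier \<Omega>)"
    and P: "P = {p \<in> frontier \<Omega>. g p = 0}" and "finite P"
    and single: "\<And>p. {p} \<in> components (frontier \<Omega>) \<Longrightarrow> p \<in> P"
    and window: "\<And>S p. S \<in> components (frontier \<Omega>) \<Longrightarrow> 0 < diameter S \<Longrightarrow> p \<in> P \<inter> S \<Longrightarrow>
      \<exists>L>0. \<exists>r>0. \<forall>c. u ` {c - L..c + L} \<subseteq> \<Omega> \<longrightarrow> \<not> u ` {c - L..c + L} \<subseteq> ball p r"
  obtains T S where "0 < T" "S \<in> components (frontier \<Omega>)"
    "\<And>t. 0 \<le> t \<Longrightarrow> ereal t < T \<Longrightarrow> u ` {0..t} \<subseteq> \<Omega>"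
    "tends_at_upper (\<lambda>t. infdist (u t) S) 0 T" "T < \<infinity> \<longleftrightarrow> 0 < diameter S"
    "T < \<infinity> \<Longrightarrow> \<exists>x\<in>S - P. tends_at_upper u x T" "T < \<infinity> \<Longrightarrow> tends_at_upper v 0 T"
proof -
  have comp: "\<exists>S. S \<in> components (frontier \<Omega>) \<and> x \<in> S \<and> bounded S" if "x \<in> frontier \<Omega>" for x
    using that Union_components[of "frontier \<Omega>"] bounded_subset[OF compact_imp_bounded[OF cfr] in_components_subset]
    by blast
  show ?thesis
  proof (cases "\<forall>t\<ge>0. u t \<in> \<Omega>")
    case True
    have P': "q \<in> P" if "q \<in> frontier \<Omega>" "g q = 0" for q using P that by simp
    have in\<Omega>: "u t \<in> \<Omega>" if "0 \<le> t" for t using True that by blast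
    have act': "integral {0..\<tau>} (\<lambda>t. U (u t)) \<le> C" if "0 \<le> \<tau>" for \<tau>
      using in\<Omega> by (intro act that) auto
    obtain p where p: "p \<in> P" and lim: "(u \<longlongrightarrow> p) at_top"
      using infinite_end[OF contu bd in\<Omega> du[OF in\<Omega>] dv[OF in\<Omega>] en[OF in\<Omega>] act' \<open>finite P\<close> P'] by blast
    have "p \<in> frontier \<Omega>" using p P by simp
    then obtain S where S: "S \<in> components (frontier \<Omega>)" "p \<in> S" using comp by blast
    have "((\<lambda>t. infdist (u t) S) \<longlongrightarrow> infdist p S) at_top" by (intro tendsto_infdist lim)
    then have inf: "((\<lambda>t. infdist (u t) S) \<longlongrightarrow> 0) at_top" using S by simp
    have "\<not> 0 < diameter S"
    proof
      assume "0 < diameter S"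
      then obtain L r where L: "0 < L" "0 < r" "\<forall>c. u ` {c - L..c + L} \<subseteq> \<Omega> \<longrightarrow> \<not> u ` {c - L..c + L} \<subseteq> ball p r"
        using window[OF S(1) _, of p] p S by blast
      have "\<forall>\<^sub>F t in at_top. dist (u t) p < r" using lim L(2) by (rule tendstoD)
      then obtain t0 where t0: "\<And>t. t0 \<le> t \<Longrightarrow> dist (u t) p < r" unfolding eventually_at_top_linorder by blast
      define c where "c = max 0 t0 + L"
      have "u ` {c - L..c + L} \<subseteq> \<Omega>" "u ` {c - L..c + L} \<subseteq> ball p r"
        using True t0 by (auto simp: c_def dist_commute)
      then show False using L(3) by blast
    qed
    show ?thesis
    proof (rule that[of "\<infinity>" S])
      show "u ` {0..t} \<subseteq> \<Omega>" for t using in\<Omega> by auto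
    qed (use S inf \<open>\<not> 0 < diameter S\<close> in \<open>simp_all add: tends_at_upper_def ereal_tendsto_simps\<close>)
  next
    case False
    \<comment> \<open>The times spent outside the open set \<Omega> form a closed set, so the first
      exit time is attained.\<close>
    define Z where "Z = {0..} \<inter> u -` (- \<Omega>)"
    have cl: "closed Z" unfolding Z_def
      using contu open_Omega by (intro closed_Int closed_vimage) auto
    have ne: "Z \<noteq> {}" using False by (auto simp: Z_def)
    have bdd: "bdd_below Z" by (auto simp: Z_def bdd_below_def)
    have "Inf Z \<in> Z" by (rule closed_contains_Inf[OF ne bdd cl])
    define b where "b = Inf Z"
    have b: "0 \<le> b" "u b \<notin> \<Omega>" using \<open>Inf Z \<in> Z\<close> by (auto simp: Z_def b_def)
    have "0 < b" using b u0 by (cases "b = 0") auto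
    have in\<Omega>: "u t \<in> \<Omega>" if "0 \<le> t" "t < b" for t
    proof (rule ccontr)
      assume "u t \<notin> \<Omega>"
      then have "b \<le> t" unfolding b_def using that by (intro cInf_lower bdd) (auto simp: Z_def)
      then show False using that by simp
    qed
    have fr: "u b \<in> frontier \<Omega>" using clos[of b] b(2) open_Omega by (simp add: frontier_def interior_open)
    then obtain S where S: "S \<in> components (frontier \<Omega>)" "u b \<in> S" "bounded S" using comp by blast
    have fe: "(v \<longlongrightarrow> 0) (at_left b)" "g (u b) \<noteq> 0"
      by (rule finite_end[OF \<open>0 < b\<close> contu bd in\<Omega> du[OF in\<Omega>] en[OF in\<Omega>] b(2) U0[OF fr]]; assumption)+
    have "u b \<notin> P" using fe(2) P by simp
    have ub: "(u \<longlongrightarrow> u b) (at_left b)"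
      using contu by (auto simp: continuous_on_eq_continuous_at isCont_def intro: tendsto_within_subset)
    have "((\<lambda>t. infdist (u t) S) \<longlongrightarrow> infdist (u b) S) (at_left b)" by (intro tendsto_infdist ub)
    then have inf: "((\<lambda>t. infdist (u t) S) \<longlongrightarrow> 0) (at_left b)" using S by simp
    \<comment> \<open>A component without extent would be the single point \<open>u b\<close>, and
      one-point components are critical.\<close>
    have "0 < diameter S"
    proof (rule ccontr)
      assume "\<not> 0 < diameter S"
      then have "S = {u b}" by (rule diameter_eq_0_imp_singleton[OF S(3,2)])
      then show False using single S(1) \<open>u b \<notin> P\<close> by simp
    qed
    moreover have "tends_at_upper u (u b) (ereal b)" using ub by (simp add: tends_at_upper_def ereal_tendsto_simps)
    then have "\<exists>x\<in>S - P. tends_at_upper u x (ereal b)" using S(2) \<open>u b \<notin> P\<close> by blast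
    moreover have "u ` {0..t} \<subseteq> \<Omega>" if "ereal t < ereal b" for t using in\<Omega> that by auto
    moreover have "tends_at_upper (\<lambda>t. infdist (u t) S) 0 (ereal b)" "tends_at_upper v 0 (ereal b)"
      using inf fe(1) by (simp_all add: tends_at_upper_def ereal_tendsto_simps)
    ultimately show ?thesis
      using \<open>0 < b\<close> S(1) by (intro that[of "ereal b" S]) simp_all
  qed
qed

text \<open>A component of positive diameter is connected with more than one point, so
  \<open>p\<close> is a limit of other zeros of \<open>U\<close>, whereas a semidefinite injective
  Hessian would isolate it.\<close>

lemma negative_direction:
  assumes dG: "(g has_derivative H) (at p)" and inj: "\<And>x. H x = 0 \<Longrightarrow> x = 0"
    and U0: "\<And>x. x \<in> frontier \<Omega> \<Longrightarrow> U x = 0" and "g p = 0"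
    and S: "S \<in> components (frontier \<Omega>)" "0 < diameter S" "p \<in> S"
  obtains d where "norm d = 1" "inner (H d) d < 0"
proof -
  interpret H: bounded_linear H using dG by (rule has_derivative_bounded_linear)
  have SU: "U x = 0" if "x \<in> S" for x using U0 in_components_subset[OF S(1)] that by blast
  have "\<exists>x. inner (H x) x < 0"
  proof (rule ccontr)
    assume "\<nexists>x. inner (H x) x < 0"
    then have psd: "0 \<le> inner (H x) x" for x by (simp add: not_less)
    obtain r where r: "0 < r" "\<And>x. x \<in> ball p r \<Longrightarrow> x \<noteq> p \<Longrightarrow> 0 < U x"
      using isolated_zero_of_semidefinite[OF dG \<open>g p = 0\<close> SU[OF S(3)] inj psd] by blast
    have "S \<noteq> {x}" for x using S(2) by auto
    then have "p islimpt S" by (rule connected_imp_perfect[OF in_components_connected[OF S(1)] S(3)])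
    then have "\<exists>x\<in>S. x \<noteq> p \<and> dist x p < r" using r(1) by (simp only: islimpt_approachable)
    then obtain x where "x \<in> S" "x \<noteq> p" "dist x p < r" by blast
    then show False using r(2)[of x] SU[of x] by (simp add: dist_commute)
  qed
  then obtain x where x: "inner (H x) x < 0" by blast
  then have "x \<noteq> 0" by auto
  show ?thesis
  proof (rule that[of "(1 / norm x) *\<^sub>R x"])
    show "inner (H ((1 / norm x) *\<^sub>R x)) ((1 / norm x) *\<^sub>R x) < 0"
      using x \<open>x \<noteq> 0\<close> by (simp add: H.scaleR divide_neg_pos zero_less_mult_iff)
  qed (use \<open>x \<noteq> 0\<close> in simp)
qed

end

context minimizing_limit
begin

lemma ode_at:
  assumes "u t \<in> \<Omega>"
  shows "(u has_vector_derivative vector_derivative u (at t)) (at t)"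
    "((\<lambda>t. vector_derivative u (at t)) has_vector_derivative g (u t)) (at t)"
    "(norm (vector_derivative u (at t)))\<^sup>2 / 2 = U (u t)"
proof -
  have "open (u -` \<Omega>)" using open_Omega u_continuous by (intro open_vimage)
  then obtain e where e: "0 < e" "ball t e \<subseteq> u -` \<Omega>" using assms open_contains_ball by (metis vimageI)
  then have *: "u ` {t - e<..<t + e} \<subseteq> \<Omega>" "t \<in> {t - e<..<t + e}"
    by (auto simp: subset_iff dist_real_def abs_if)
  show 1: "(u has_vector_derivative vector_derivative u (at t)) (at t)"
    "((\<lambda>t. vector_derivative u (at t)) has_vector_derivative g (u t)) (at t)"
    using ode[OF *] by auto
  show "(norm (vector_derivative u (at t)))\<^sup>2 / 2 = U (u t)" using zero_energy[OF assms 1(1)] .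
qed

lemma no_long_stay_near_saddle:
  assumes dG: "\<And>x. (g has_derivative G x) (at x)" and cont: "\<And>d. continuous_on UNIV (\<lambda>x. G x d)"
    and neg: "inner (G p d) d < 0" "norm d = 1"
  shows "\<exists>L>0. \<exists>r>0. \<forall>c. u ` {c - L..c + L} \<subseteq> \<Omega> \<longrightarrow> \<not> u ` {c - L..c + L} \<subseteq> ball p r"
proof -
  obtain r \<mu> where r: "0 < r" "0 < \<mu>" "\<And>x h. x \<in> ball p r \<Longrightarrow> 0 \<le> h \<Longrightarrow> h \<le> r \<Longrightarrow>
    U (x + h *\<^sub>R d) \<le> U x + h * inner (g x) d - \<mu> * h\<^sup>2"
    by (rule concave_direction[OF dG cont neg]) blast
  \<comment> \<open>Any half-width with \<open>\<mu> * L\<^sup>2\<close> above 2 would do; this one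
    gives \<open>\<mu> + 4 + 4 / \<mu>\<close>.\<close>
  define L where "L = 1 + 2 / \<mu>"
  have L: "0 < L" using r by (simp add: L_def add_pos_pos)
  have "\<mu> * L\<^sup>2 = \<mu> + 4 + 4 / \<mu>" using r(2) by (simp add: L_def power2_eq_square field_simps)
  then have wide: "2 < \<mu> * L\<^sup>2" using r(2) by (simp add: add_pos_pos)
  show ?thesis
    using no_wide_window_near_concave_direction[OF r(3,1,2) neg(2) L wide] L r(1) by blast
qed

end

section \<open>From the regularity class to the abstract setting, and assembly of the orbit\<close>

lemma C2_imp_has_derivative:
  assumes "C2 U"
  shows "(U has_derivative (\<lambda>h. inner (grad U x) h)) (at x)"
proof -
  have "U differentiable (at x)" using assms by (auto simp: C2_def differentiable_on_def)
  from gderiv_grad[OF this] show ?thesis by (simp add: gderiv_def inner_commute)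
qed

lemma C2_imp_grad_has_derivative:
  assumes "C2 U"
  shows "(grad U has_derivative (\<lambda>d. hessian U x *v d)) (at x)"
proof -
  have "grad U differentiable (at x)" using assms by (auto simp: C2_def differentiable_on_def)
  then have D: "(grad U has_derivative frechet_derivative (grad U) (at x)) (at x)"
    using frechet_derivative_works by blast
  have "frechet_derivative (grad U) (at x) = (\<lambda>d. hessian U x *v d)"
    unfolding hessian_def by (rule matrix_vector_mul(2)[OF has_derivative_linear[OF D], symmetric])
  with D show ?thesis by simp
qed

lemma C2_imp_hessian_continuous:
  assumes "C2 U"
  shows "continuous_on UNIV (\<lambda>x. hessian U x *v d)"
  unfolding matrix_vector_mult_def using assms by (auto simp: C2_def intro!: continuous_intros)

text \<open>A component is relatively closed in \<open>{x. 0 < U x}\<close>, so a frontier point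
  with positive \<open>U\<close> would belong to the open set \<Omega>, which contains none of its
  frontier points.\<close>

lemma component_frontier_zero:
  fixes U :: "'a::euclidean_space \<Rightarrow> real"
  assumes cont: "continuous_on UNIV U" and \<Omega>: "\<Omega> \<in> components {x. 0 < U x}" and x: "x \<in> frontier \<Omega>"
  shows "U x = 0"
proof -
  have "open {x. 0 < U x}" using cont by (intro open_Collect_less continuous_intros)
  then have "open \<Omega>" by (rule open_components[OF _ \<Omega>])
  have sub: "\<Omega> \<subseteq> {x. 0 < U x}" using \<Omega> by (rule in_components_subset)
  have "closed {x. 0 \<le> U x}" using cont by (intro closed_Collect_le continuous_intros)
  then have "closure \<Omega> \<subseteq> {x. 0 \<le> U x}" using sub by (intro closure_minimal) auto
  then have "0 \<le> U x" using x by (auto simp: frontier_def)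
  moreover have "\<not> 0 < U x"
  proof
    assume "0 < U x"
    obtain T where T: "closed T" "\<Omega> = {x. 0 < U x} \<inter> T"
      using closedin_component[OF \<Omega>] unfolding closedin_closed by blast
    have "closure \<Omega> \<subseteq> T" using T by (intro closure_minimal) auto
    then have "x \<in> \<Omega>" using x \<open>0 < U x\<close> T(2) by (auto simp: frontier_def)
    then show False using x \<open>open \<Omega>\<close> by (simp add: frontier_def interior_open)
  qed
  ultimately show ?thesis by simp
qed

theorem theorem1p1:
  fixes U :: "real^'n \<Rightarrow> real"
    and \<Omega> P :: "(real^'n) set"
    and \<Gamma> :: "nat \<Rightarrow> (real^'n) set"
    and N :: nat
  assumes U_C2: "C2 U"
    and Omega: "\<Omega> \<in> components {x. U x > 0}"
    and frontier_compact: "compact (frontier \<Omega>)"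
    and Gamma: "bij_betw \<Gamma> {1..N} (components (frontier \<Omega>))"
    and a_N: "N \<ge> 2"
    and a_unbounded: "\<not> bounded \<Omega> \<Longrightarrow>
      \<exists>r0>0. \<exists>\<sigma>::real \<Rightarrow> real.
        (\<forall>r\<ge>r0. \<sigma> r \<ge> 0) \<and> improper_integral_infinite r0 \<sigma> \<and>
        (\<forall>x\<in>\<Omega>. norm x \<ge> r0 \<longrightarrow> sqrt (U x) \<ge> \<sigma> (norm x))"
    and P_def: "P = {p \<in> frontier \<Omega>. critical_point U p}"
    and b_finite: "finite P"
    and b_single: "\<forall>j\<in>{1..N}. \<forall>p. \<Gamma> j = {p} \<longrightarrow> p \<in> P"
    and b_hyperbolic: "\<forall>j\<in>{1..N}. diameter (\<Gamma> j) > 0 \<longrightarrow>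
      (\<forall>p\<in>P \<inter> \<Gamma> j. hyperbolic_critical_point U p)"
  shows "\<forall>\<Gamma>m \<in> \<Gamma> ` {1..N}. \<exists>\<Gamma>p \<in> \<Gamma> ` {1..N} - {\<Gamma>m}.
    \<exists>(Tm::ereal) (Tp::ereal) (u::real \<Rightarrow> real^'n) (v::real \<Rightarrow> real^'n).
      Tm < Tp \<and>
      (\<forall>t\<in>einterval Tm Tp.
         u t \<in> \<Omega> \<and>
         (u has_vector_derivative v t) (at t) \<and>
         (v has_vector_derivative grad U (u t)) (at t) \<and>
         1/2 * (norm (v t))\<^sup>2 - U (u t) = 0) \<and>
      tends_at_lower (\<lambda>t. infdist (u t) \<Gamma>m) 0 Tm \<and>
      tends_at_upper (\<lambda>t. infdist (u t) \<Gamma>p) 0 Tp \<and>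
      (Tm > -\<infinity> \<longleftrightarrow> diameter \<Gamma>m > 0) \<and>
      (Tp < \<infinity> \<longleftrightarrow> diameter \<Gamma>p > 0) \<and>
      (Tm > -\<infinity> \<longrightarrow> (\<exists>xm \<in> \<Gamma>m - P. tends_at_lower u xm Tm) \<and> tends_at_lower v 0 Tm) \<and>
      (Tp < \<infinity> \<longrightarrow> (\<exists>xp \<in> \<Gamma>p - P. tends_at_upper u xp Tp) \<and> tends_at_upper v 0 Tp)"
proof (rule ballI, goal_cases)
  case (1 A)
  define F where "F = components (frontier \<Omega>)"
  have F: "\<Gamma> ` {1..N} = F" using Gamma by (simp add: bij_betw_def F_def)
  then have A: "A \<in> F" using 1 by simp
  have "finite F" using F by (metis finite_atLeastAtMost finite_imageI)
  have "card F = N" using bij_betw_same_card[OF Gamma] by (simp add: F_def)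
  note dU = C2_imp_has_derivative[OF U_C2] and dG = C2_imp_grad_has_derivative[OF U_C2]
    and contG = C2_imp_hessian_continuous[OF U_C2]
  have contU: "continuous_on UNIV U"
    by (intro continuous_at_imp_continuous_on ballI has_derivative_continuous[OF dU])
  have \<Omega>_sub: "\<Omega> \<subseteq> {x. 0 < U x}" using Omega by (rule in_components_subset)
  have "open {x. 0 < U x}" using contU by (intro open_Collect_less continuous_intros)
  then have "open \<Omega>" by (rule open_components[OF _ Omega])
  note U0 = component_frontier_zero[OF contU Omega]
  have Fcompact: "compact S" if "S \<in> F" for S
  proof -
    have "closed S" by (rule closed_components[OF frontier_closed that[unfolded F_def]])
    moreover have "S \<subseteq> frontier \<Omega>" by (rule in_components_subset[OF that[unfolded F_def]])
    ultimately show ?thesis using compact_Int_closed[OF frontier_compact, of S] by (simp add: inf.absorb2)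
  qed
  have Fne: "S \<noteq> {}" if "S \<in> F" for S using that in_components_nonempty by (simp add: F_def)
  \<comment> \<open>All other components together form the target; finiteness of \<open>F\<close>
    keeps the union compact.\<close>
  define B where "B = \<Union>(F - {A})"
  have "F - {A} \<noteq> {}"
  proof
    assume "F - {A} = {}"
    then have "card F \<le> card {A}" using A by (intro card_mono) auto
    then show False using \<open>card F = N\<close> a_N by simp
  qed
  then have Bne: "B \<noteq> {}" using Fne by (auto simp: B_def)
  have "compact B" unfolding B_def using \<open>finite F\<close> Fcompact by (intro compact_Union) auto
  have "A \<union> B = \<Union>F" using A by (auto simp: B_def)
  then have AB: "frontier \<Omega> = A \<union> B" by (simp add: F_def)
  have "A \<inter> S = {}" if "S \<in> F - {A}" for S
    using components_nonoverlap[of A "frontier \<Omega>" S] A that by (auto simp: F_def)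
  then have disj: "A \<inter> B = {}" by (auto simp: B_def)
  interpret split_frontier U \<Omega> "grad U" A B
  proof unfold_locales
    show "open \<Omega>" by fact
    show "continuous_on UNIV U" by fact
    show "0 < U x" if "x \<in> \<Omega>" for x using that \<Omega>_sub by auto
    show "(U has_derivative (\<lambda>h. inner (grad U x) h)) (at x)" for x by (rule dU)
    show "\<exists>K\<ge>0. \<forall>x\<in>cball 0 R. \<forall>y\<in>cball 0 R. norm (grad U x - grad U y) \<le> K * norm (x - y)" for R
      by (rule continuous_derivative_imp_lipschitz_on_cball[OF dG contG])
    show "connected \<Omega>" using Omega by (rule in_components_connected)
    show "frontier \<Omega> = A \<union> B" by fact
    show "compact A" using Fcompact A by blast
    show "compact B" by fact
    show "A \<noteq> {}" using Fne A by blast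
    show "B \<noteq> {}" by fact
    show "A \<inter> B = {}" by fact
    show "\<exists>r0 \<sigma>. (\<forall>R\<ge>r0. \<sigma> integrable_on {r0..R}) \<and> filterlim (\<lambda>R. integral {r0..R} \<sigma>) at_top at_top \<and>
        (\<forall>x\<in>\<Omega>. r0 \<le> norm x \<longrightarrow> \<sigma> (norm x) \<le> sqrt (U x))" if "\<not> bounded \<Omega>"
      using a_unbounded[OF that] unfolding improper_integral_infinite_def by blast
  qed
  obtain u X E \<alpha> \<beta> \<epsilon> M R \<rho> where ml: "minimizing_limit U \<Omega> (grad U) X E \<alpha> \<beta> \<epsilon> u M R"
    and u0: "u 0 \<in> \<Omega>" and clos: "\<And>t. u t \<in> closure \<Omega>" and "0 < \<rho>"
    and leaveA: "\<And>t. 0 \<le> t \<Longrightarrow> \<rho> \<le> infdist (u t) A"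
    and act: "\<And>s t. s \<le> t \<Longrightarrow> u ` {s..t} \<subseteq> \<Omega> \<Longrightarrow> integral {s..t} (\<lambda>\<tau>. U (u \<tau>)) \<le> M"
    and avoidB: "\<And>\<tau>. 0 < \<tau> \<Longrightarrow> u ` {- \<tau>..0} \<subseteq> \<Omega> \<Longrightarrow>
      \<exists>\<eta>>0. \<forall>t\<le>- \<tau>. u ` {t..0} \<subseteq> \<Omega> \<longrightarrow> \<eta> \<le> infdist (u t) B"
    by (rule limit_curve_exists) (rule that)
  interpret lim: minimizing_limit U \<Omega> "grad U" X E \<alpha> \<beta> \<epsilon> u M R by (rule ml)
  define v where "v t = vector_derivative u (at t)" for t
  note ode = lim.ode_at[folded v_def]
  have P': "P = {p \<in> frontier \<Omega>. grad U p = 0}" by (simp add: P_def critical_point_def)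
  have single: "p \<in> P" if "{p} \<in> components (frontier \<Omega>)" for p
  proof -
    have "{p} \<in> \<Gamma> ` {1..N}" using that unfolding F F_def .
    then obtain j where "j \<in> {1..N}" "\<Gamma> j = {p}" by (metis imageE)
    then show ?thesis using b_single by blast
  qed
  \<comment> \<open>Hyperbolicity makes the Hessian injective, which yields a direction of negative
    curvature, and minimality then forbids long stays near \<open>p\<close>.\<close>
  have window: "\<exists>L>0. \<exists>r>0. \<forall>c. u ` {c - L..c + L} \<subseteq> \<Omega> \<longrightarrow> \<not> u ` {c - L..c + L} \<subseteq> ball p r"
    if S: "S \<in> components (frontier \<Omega>)" "0 < diameter S" and p: "p \<in> P \<inter> S" for S p
  proof -
    have "S \<in> \<Gamma> ` {1..N}" using S(1) unfolding F F_def .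
    then obtain j where "j \<in> {1..N}" "S = \<Gamma> j" by blast
    then have "hyperbolic_critical_point U p" using b_hyperbolic S(2) p by blast
    then have inv: "invertible (hessian U p)" "grad U p = 0"
      by (auto simp: hyperbolic_critical_point_def critical_point_def)
    have inj: "x = 0" if "hessian U p *v x = 0" for x
      using injD[OF inj_matrix_vector_mult[OF inv(1)], of x 0] that by simp
    obtain d where "norm d = 1" "inner (hessian U p *v d) d < 0"
      using negative_direction[OF dG inj U0 inv(2) S] p by blast
    then show ?thesis by (intro lim.no_long_stay_near_saddle[OF dG contG]) auto
  qed
  obtain Tp C where Tp: "0 < Tp" and C: "C \<in> components (frontier \<Omega>)"
    and inp: "\<And>t. 0 \<le> t \<Longrightarrow> ereal t < Tp \<Longrightarrow> u ` {0..t} \<subseteq> \<Omega>"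
    and limp: "tends_at_upper (\<lambda>t. infdist (u t) C) 0 Tp" "Tp < \<infinity> \<longleftrightarrow> 0 < diameter C"
    "Tp < \<infinity> \<Longrightarrow> \<exists>x\<in>C - P. tends_at_upper u x Tp" "Tp < \<infinity> \<Longrightarrow> tends_at_upper v 0 Tp"
    by (rule end_dichotomy[OF lim.u_continuous lim.u_bound clos u0 ode act U0 frontier_compact P' b_finite single window]) (assumption | rule that)+
  \<comment> \<open>Equation and energy are invariant under time reversal, which replaces the
    velocity by \<open>- v (- t)\<close>.\<close>
  have du': "((\<lambda>t. u (- t)) has_vector_derivative - v (- t)) (at t)" if "u (- t) \<in> \<Omega>" for t
  proof -
    have "(uminus has_vector_derivative - 1) (at t)" by (auto intro!: derivative_eq_intros simp: has_vector_derivative_minus)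
    from vector_diff_chain_at[OF this ode(1)[OF that]] show ?thesis by (simp add: o_def)
  qed
  have dv': "((\<lambda>t. - v (- t)) has_vector_derivative grad U (u (- t))) (at t)" if "u (- t) \<in> \<Omega>" for t
  proof -
    have "(uminus has_vector_derivative - 1) (at t)" by (auto intro!: derivative_eq_intros)
    from has_vector_derivative_minus[OF vector_diff_chain_at[OF this ode(2)[OF that]]] show ?thesis by (simp add: o_def)
  qed
  have en': "(norm (- v (- t)))\<^sup>2 / 2 = U (u (- t))" if "u (- t) \<in> \<Omega>" for t using ode(3)[OF that] by simp
  have refl: "(\<lambda>t. u (- t)) ` {a..b} = u ` {- b..- a}" for a b
    by (simp only: image_image[of u uminus "{a..b}", symmetric] image_uminus_atLeastAtMost)
  have act': "integral {0..\<tau>} (\<lambda>t. U (u (- t))) \<le> M" if "0 \<le> \<tau>" "(\<lambda>t. u (- t)) ` {0..\<tau>} \<subseteq> \<Omega>" for \<tau>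
    using act[of "- \<tau>" 0] that Henstock_Kurzweil_Integration.integral_reflect_real[of 0 "- \<tau>" "\<lambda>t. U (u t)"] by (simp add: refl)
  have window': "\<exists>L>0. \<exists>r>0. \<forall>c. (\<lambda>t. u (- t)) ` {c - L..c + L} \<subseteq> \<Omega> \<longrightarrow> \<not> (\<lambda>t. u (- t)) ` {c - L..c + L} \<subseteq> ball p r"
    if S: "S \<in> components (frontier \<Omega>)" "0 < diameter S" "p \<in> P \<inter> S" for S p
  proof -
    obtain L r where L: "0 < L" "0 < r" "\<forall>c. u ` {c - L..c + L} \<subseteq> \<Omega> \<longrightarrow> \<not> u ` {c - L..c + L} \<subseteq> ball p r"
      using window[OF S] by blast
    have "(\<lambda>t. u (- t)) ` {c - L..c + L} = u ` {- c - L..- c + L}" for c by (simp add: refl)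
    then have "\<forall>c. (\<lambda>t. u (- t)) ` {c - L..c + L} \<subseteq> \<Omega> \<longrightarrow> \<not> (\<lambda>t. u (- t)) ` {c - L..c + L} \<subseteq> ball p r"
      using L(3) by (simp only:) blast
    then show ?thesis using L(1,2) by blast
  qed
  have contu': "continuous_on UNIV (\<lambda>t. u (- t))"
    by (rule continuous_on_compose2[OF lim.u_continuous[of UNIV]]) (auto intro!: continuous_intros)
  have u0': "u (- 0) \<in> \<Omega>" using u0 by simp
  obtain T C' where T: "0 < T" and C': "C' \<in> components (frontier \<Omega>)"
    and inm: "\<And>t. 0 \<le> t \<Longrightarrow> ereal t < T \<Longrightarrow> (\<lambda>t. u (- t)) ` {0..t} \<subseteq> \<Omega>"
    and limm: "tends_at_upper (\<lambda>t. infdist (u (- t)) C') 0 T" "T < \<infinity> \<longleftrightarrow> 0 < diameter C'"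
    "T < \<infinity> \<Longrightarrow> \<exists>x\<in>C' - P. tends_at_upper (\<lambda>t. u (- t)) x T" "T < \<infinity> \<Longrightarrow> tends_at_upper (\<lambda>t. - v (- t)) 0 T"
    by (rule end_dichotomy[OF contu' lim.u_bound clos u0' du' dv' en' act' U0 frontier_compact P' b_finite single window']) (assumption | rule that)+
  \<comment> \<open>From time 0 on the curve keeps the distance \<open>\<rho>\<close> from
    \<open>A\<close>, as time 0 was placed at the last exit.\<close>
  have "C \<noteq> A"
  proof
    assume "C = A"
    show False
      by (rule tends_at_upper_not_bounded_away[OF limp(1), of 0 \<rho>])
        (use Tp \<open>0 < \<rho>\<close> leaveA \<open>C = A\<close> in \<open>auto simp: zero_ereal_def\<close>)
  qed
  \<comment> \<open>Any other component lies in \<open>B\<close>, and \<open>avoidB\<close> keeps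
    the past of the curve away from \<open>B\<close>.\<close>
  have "C' = A"
  proof (rule ccontr)
    assume "C' \<noteq> A"
    then have "C' \<subseteq> B" using C' by (auto simp: B_def F_def)
    obtain \<tau> where \<tau>: "0 < \<tau>" "ereal \<tau> < T" using ereal_dense2[OF T] by (auto simp: zero_ereal_def)
    have "u ` {- \<tau>..0} \<subseteq> \<Omega>" using inm[of \<tau>] \<tau> by (simp add: refl)
    then obtain \<eta> where \<eta>: "0 < \<eta>" "\<forall>t\<le>- \<tau>. u ` {t..0} \<subseteq> \<Omega> \<longrightarrow> \<eta> \<le> infdist (u t) B"
      using avoidB[OF \<tau>(1)] by blast
    show False
    proof (rule tends_at_upper_not_bounded_away[OF limm(1) \<tau>(2) \<eta>(1)])
      fix t assume t: "\<tau> \<le> t" "ereal t < T"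
      have "u ` {- t..0} \<subseteq> \<Omega>" using inm[of t] t \<tau> by (simp add: refl)
      then have "\<eta> \<le> infdist (u (- t)) B" using \<eta>(2) t by auto
      also have "\<dots> \<le> infdist (u (- t)) C'" using Fne C' by (intro infdist_mono \<open>C' \<subseteq> B\<close>) (simp add: F_def)
      finally show "\<eta> \<le> infdist (u (- t)) C'" .
    qed
  qed
  have in\<Omega>: "u t \<in> \<Omega>" if "t \<in> einterval (- T) Tp" for t
  proof (cases "0 \<le> t")
    case True
    then show ?thesis using inp[of t] that by (auto simp: einterval_iff)
  next
    case False
    then have "ereal (- t) < T" using that by (cases T) (auto simp: einterval_iff)
    then show ?thesis using inm[of "- t"] False by (auto simp: refl)
  qed
  have T_fin: "- \<infinity> < - T \<longleftrightarrow> T < \<infinity>" by (cases T) auto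
  have C_mem: "C \<in> \<Gamma> ` {1..N} - {A}" using C \<open>C \<noteq> A\<close> F by (simp add: F_def)
  show ?case
  proof (rule bexI[OF _ C_mem], rule exI[of _ "- T"], rule exI[of _ Tp], rule exI[of _ u], rule exI[of _ v],
      intro conjI impI ballI)
    show "- T < Tp" using T Tp by (cases T; cases Tp) auto
    show "tends_at_lower (\<lambda>t. infdist (u t) A) 0 (- T)"
      using limm(1) \<open>C' = A\<close> by (simp add: tends_at_lower_uminus[OF T])
    show "- \<infinity> < - T \<longleftrightarrow> 0 < diameter A" using T_fin limm(2) \<open>C' = A\<close> by simp
    show "\<exists>xm\<in>A - P. tends_at_lower u xm (- T)" if "- \<infinity> < - T"
      using limm(3) that \<open>C' = A\<close> by (simp add: T_fin tends_at_lower_uminus[OF T])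
    show "tends_at_lower v 0 (- T)" if "- \<infinity> < - T"
      using tendsto_minus[OF limm(4)[unfolded tends_at_upper_def]] that
      by (simp add: T_fin tends_at_lower_uminus[OF T] tends_at_upper_def o_def)
    fix t assume t: "t \<in> einterval (- T) Tp"
    show "u t \<in> \<Omega>" by (rule in\<Omega>[OF t])
    show "(u has_vector_derivative v t) (at t)" "(v has_vector_derivative grad U (u t)) (at t)"
      by (rule ode(1,2)[OF in\<Omega>[OF t]])+
    show "1/2 * (norm (v t))\<^sup>2 - U (u t) = 0" using ode(3)[OF in\<Omega>[OF t]] by simp
  qed (fact limp)+
qed

end
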